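(* Let $\Omega\subset\mathbb{R}^d$ be a domain of finite diameter with $C^1$ boundary $\partial\Omega$, and let $f\colon\overline\Omega\to\mathbb{R}$ be a continuous function such that $\overline c_f=0$. Then the equation $$-\Delta_\infty u=f\ \text{ in }\Omega,\qquad \nabla_\nu u=0\ \text{ on }\partial\Omega$$ has a viscosity solution $u$ which is Lipschitz continuous, with Lipschitz constant depending on $\Omega$ and the norm $\|f\|$ (i.e. bounded by a constant that depends only on $\Omega$ and $\|f\|$).
   Context: A domain is an open, bounded, connected subset of $\mathbb{R}^d$. $\|f\|=\max_{\overline\Omega}|f|$. The constant $\overline c_f$: equip $\overline\Omega$ with the intrinsic metric $d(x,y)$, the infimum of lengths of rectifiable paths contained in $\overline\Omega$ between $x$ and $y$ (this makes $\overline\Omega$ a compact metric space with the Euclidean topology), and let $B(x,\epsilon)=\{y\in\overline\Omega:d(x,y)\le\epsilon\}$. For $\epsilon>0$ and continuous $u_0\colon\overline\Omega\to\mathbb{R}$ define $(u_n)_{n\ge0}$ starting from $u_0$ by $$u_{n+1}(x)=\tfrac12\big(\min_{B(x,\epsilon)}u_n+\max_{B(x,\epsilon)}u_n\big)+f(x).$$ $c_f(\epsilon)$ is the unique real constant $c$ such that, for any such $u_0$, the sequence of functions $(u_n-nc)$ is uniformly bounded (it exists and is independent of $u_0$). Then $\overline c_f=\lim_{\epsilon\downarrow0}c_f(\epsilon)$ (this limit exists). Viscosity solutions: $\nu(x)$ is the outward normal vector to $\partial\Omega$ at $x\in\partial\Omega$, and $\nabla_\nu$ the derivative in its direction. For a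 twice differentiable $\varphi$ with $\nabla\varphi(x)\ne0$ set $\Delta_\infty^+\varphi(x)=\Delta_\infty\varphi(x)=|\nabla\varphi(x)|^{-2}\sum_{i,j}\varphi_{x_i}(x)\varphi_{x_ix_j}(x)\varphi_{x_j}(x)$; if $\nabla\varphi(x)=0$ set $\Delta_\infty^+\varphi(x)=\max_{|\mathbf v|=1}\sum_{i,j}\varphi_{x_ix_j}(x)\mathbf v_i\mathbf v_j$. $C^\infty(\overline\Omega)$ denotes functions infinitely differentiable on an open set containing $\overline\Omega$. A continuous $u\colon\overline\Omega\to\mathbb{R}$ is a viscosity subsolution of the equation if for any $\varphi\in C^\infty(\overline\Omega)$ and $x_0\in\overline\Omega$ such that $u-\varphi$ has a strict local maximum at $x_0$ (on $\overline\Omega$), either (a) $-\Delta_\infty^+\varphi(x_0)\le f(x_0)$, or (b) $x_0\in\partial\Omega$ and $\nabla_{\nu(x_0)}\varphi(x_0)\le0$. It is a viscosity supersolution if $-u$ is a viscosity subsolution of the equation with $f$ replaced by $-f$. It is a viscosity solution if it is both. *)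

theory Defs
  imports "HOL-Analysis.Analysis"
begin

section \<open>Domains with continuously differentiable boundary\<close>

definition domain :: "'a::euclidean_space set \<Rightarrow> bool" where
  "domain \<Omega> \<longleftrightarrow> open \<Omega> \<and> bounded \<Omega> \<and> connected \<Omega>"

definition C1_function :: "('a::euclidean_space \<Rightarrow> real) \<Rightarrow> bool" where
  "C1_function \<gamma> \<longleftrightarrow> (\<exists>G. (\<forall>x. GDERIV \<gamma> x :> G x) \<and> continuous_on UNIV G)"

text \<open>Near each boundary point, \<open>\<Omega>\<close> is the region above a \<open>C\<^sup>1\<close> graph, in orthonormal
  coordinates whose last axis is \<open>e\<close>. The vector \<open>y - (y \<bullet> e) *\<^sub>R e\<close> is the projection of \<open>y\<close> to
  the hyperplane orthogonal to \<open>e\<close>, so only the restriction of \<open>\<gamma>\<close> to that hyperplane matters.\<close>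
definition C1_boundary :: "'a::euclidean_space set \<Rightarrow> bool" where
  "C1_boundary \<Omega> \<longleftrightarrow>
    (\<forall>x\<in>frontier \<Omega>. \<exists>r>0. \<exists>e \<gamma>. norm e = 1 \<and> C1_function \<gamma> \<and>
       \<Omega> \<inter> ball x r = {y \<in> ball x r. \<gamma> (y - (y \<bullet> e) *\<^sub>R e) < y \<bullet> e})"

definition tangent_vector :: "'a::euclidean_space set \<Rightarrow> 'a \<Rightarrow> 'a \<Rightarrow> bool" where
  "tangent_vector S x v \<longleftrightarrow>
    (\<exists>(g :: real \<Rightarrow> 'a) \<delta>. \<delta> > 0 \<and> g 0 = x \<and> (\<forall>t. \<bar>t\<bar> < \<delta> \<longrightarrow> g t \<in> S) \<and>
       (g has_vector_derivative v) (at 0))"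

definition is_outward_normal :: "'a::euclidean_space set \<Rightarrow> 'a \<Rightarrow> 'a \<Rightarrow> bool" where
  "is_outward_normal \<Omega> x n \<longleftrightarrow>
    norm n = 1 \<and> (\<forall>v. tangent_vector (frontier \<Omega>) x v \<longrightarrow> n \<bullet> v = 0) \<and>
    (\<forall>\<^sub>F t in at_right 0. x + t *\<^sub>R n \<notin> closure \<Omega>)"

text \<open>Existence and uniqueness hold at every boundary point if the boundary is \<open>C\<^sup>1\<close>.\<close>
definition outward_normal :: "'a::euclidean_space set \<Rightarrow> 'a \<Rightarrow> 'a" where
  "outward_normal \<Omega> x = (THE n. is_outward_normal \<Omega> x n)"


section \<open>The intrinsic metric\<close>

text \<open>Lengths take values in \<open>ennreal\<close>; a path is rectifiable iff its length is finite. Hence the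
  infimum over all paths below equals the infimum over the rectifiable ones, and it is \<open>\<infinity>\<close> if
  there are none.\<close>
definition curve_length :: "(real \<Rightarrow> 'a::metric_space) \<Rightarrow> ennreal" where
  "curve_length g =
    (SUP ts\<in>{ts. sorted ts \<and> set ts \<subseteq> {0..1}}.
       ennreal (\<Sum>k<length ts - 1. dist (g (ts ! k)) (g (ts ! Suc k))))"

definition intrinsic_dist :: "'a::euclidean_space set \<Rightarrow> 'a \<Rightarrow> 'a \<Rightarrow> ennreal" where
  "intrinsic_dist \<Omega> x y =
    (INF g\<in>{g. path g \<and> path_image g \<subseteq> closure \<Omega> \<and> pathstart g = x \<and> pathfinish g = y}.
       curve_length g)"

definition intrinsic_diameter :: "'a::euclidean_space set \<Rightarrow> ennreal" where
  "intrinsic_diameter \<Omega> = (SUP x\<in>closure \<Omega>. SUP y\<in>closure \<Omega>. intrinsic_dist \<Omega> x y)"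

definition intrinsic_cball :: "'a::euclidean_space set \<Rightarrow> 'a \<Rightarrow> real \<Rightarrow> 'a set" where
  "intrinsic_cball \<Omega> x \<epsilon> = {y \<in> closure \<Omega>. intrinsic_dist \<Omega> x y \<le> ennreal \<epsilon>}"


section \<open>The constant \<open>c\<^sub>f(\<epsilon>)\<close>\<close>

text \<open>For continuous initial data the infimum and supremum below are the minimum and maximum
  over a compact ball.\<close>
primrec value_iter ::
  "'a::euclidean_space set \<Rightarrow> ('a \<Rightarrow> real) \<Rightarrow> real \<Rightarrow> ('a \<Rightarrow> real) \<Rightarrow> nat \<Rightarrow> 'a \<Rightarrow> real" where
  "value_iter \<Omega> f \<epsilon> u\<^sub>0 0 = u\<^sub>0"
| "value_iter \<Omega> f \<epsilon> u\<^sub>0 (Suc n) =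
    (\<lambda>x. 1/2 * ((INF y\<in>intrinsic_cball \<Omega> x \<epsilon>. value_iter \<Omega> f \<epsilon> u\<^sub>0 n y) +
                (SUP y\<in>intrinsic_cball \<Omega> x \<epsilon>. value_iter \<Omega> f \<epsilon> u\<^sub>0 n y)) + f x)"

definition c_const :: "'a::euclidean_space set \<Rightarrow> ('a \<Rightarrow> real) \<Rightarrow> real \<Rightarrow> real" where
  "c_const \<Omega> f \<epsilon> =
    (THE c. \<forall>u\<^sub>0. continuous_on (closure \<Omega>) u\<^sub>0 \<longrightarrow>
       (\<exists>K. \<forall>n. \<forall>x\<in>closure \<Omega>. \<bar>value_iter \<Omega> f \<epsilon> u\<^sub>0 n x - real n * c\<bar> \<le> K))"

definition sup_norm :: "'a::euclidean_space set \<Rightarrow> ('a \<Rightarrow> real) \<Rightarrow> real" where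
  "sup_norm \<Omega> f = (SUP x\<in>closure \<Omega>. \<bar>f x\<bar>)"


section \<open>Smooth functions and the infinity Laplacian\<close>

definition partial_deriv :: "'a::euclidean_space \<Rightarrow> ('a \<Rightarrow> real) \<Rightarrow> 'a \<Rightarrow> real" where
  "partial_deriv i \<phi> x = frechet_derivative \<phi> (at x) i"

primrec iter_partial_deriv :: "'a::euclidean_space list \<Rightarrow> ('a \<Rightarrow> real) \<Rightarrow> 'a \<Rightarrow> real" where
  "iter_partial_deriv [] \<phi> = \<phi>"
| "iter_partial_deriv (i # is) \<phi> = partial_deriv i (iter_partial_deriv is \<phi>)"

definition smooth_on_closure :: "'a::euclidean_space set \<Rightarrow> ('a \<Rightarrow> real) \<Rightarrow> bool" where
  "smooth_on_closure \<Omega> \<phi> \<longleftrightarrow>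
    (\<exists>U. open U \<and> closure \<Omega> \<subseteq> U \<and>
       (\<forall>is. set is \<subseteq> Basis \<longrightarrow> (\<forall>x\<in>U. iter_partial_deriv is \<phi> differentiable (at x))))"

definition gradient :: "('a::euclidean_space \<Rightarrow> real) \<Rightarrow> 'a \<Rightarrow> 'a" where
  "gradient \<phi> x = (\<Sum>i\<in>Basis. partial_deriv i \<phi> x *\<^sub>R i)"

definition hessian_form :: "('a::euclidean_space \<Rightarrow> real) \<Rightarrow> 'a \<Rightarrow> 'a \<Rightarrow> real" where
  "hessian_form \<phi> x v =
    (\<Sum>i\<in>Basis. \<Sum>j\<in>Basis. partial_deriv j (partial_deriv i \<phi>) x * (v \<bullet> i) * (v \<bullet> j))"

definition inf_laplacian_plus :: "('a::euclidean_space \<Rightarrow> real) \<Rightarrow> 'a \<Rightarrow> real" where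
  "inf_laplacian_plus \<phi> x =
    (if gradient \<phi> x \<noteq> 0
     then hessian_form \<phi> x (gradient \<phi> x) / (norm (gradient \<phi> x))\<^sup>2
     else (SUP v\<in>sphere 0 1. hessian_form \<phi> x v))"


section \<open>Viscosity solutions of the Neumann problem\<close>

definition strict_local_max_on :: "'a::euclidean_space set \<Rightarrow> ('a \<Rightarrow> real) \<Rightarrow> 'a \<Rightarrow> bool" where
  "strict_local_max_on S w x \<longleftrightarrow>
    x \<in> S \<and> (\<exists>r>0. \<forall>y\<in>S \<inter> ball x r. y \<noteq> x \<longrightarrow> w y < w x)"

definition viscosity_subsolution ::
  "'a::euclidean_space set \<Rightarrow> ('a \<Rightarrow> real) \<Rightarrow> ('a \<Rightarrow> real) \<Rightarrow> bool" where
  "viscosity_subsolution \<Omega> f u \<longleftrightarrow>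
    continuous_on (closure \<Omega>) u \<and>
    (\<forall>\<phi> x\<^sub>0. smooth_on_closure \<Omega> \<phi> \<longrightarrow> x\<^sub>0 \<in> closure \<Omega> \<longrightarrow>
       strict_local_max_on (closure \<Omega>) (\<lambda>x. u x - \<phi> x) x\<^sub>0 \<longrightarrow>
       - inf_laplacian_plus \<phi> x\<^sub>0 \<le> f x\<^sub>0 \<or>
       (x\<^sub>0 \<in> frontier \<Omega> \<and> frechet_derivative \<phi> (at x\<^sub>0) (outward_normal \<Omega> x\<^sub>0) \<le> 0))"

definition viscosity_supersolution ::
  "'a::euclidean_space set \<Rightarrow> ('a \<Rightarrow> real) \<Rightarrow> ('a \<Rightarrow> real) \<Rightarrow> bool" where
  "viscosity_supersolution \<Omega> f u \<longleftrightarrow> viscosity_subsolution \<Omega> (\<lambda>x. - f x) (\<lambda>x. - u x)"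

definition viscosity_solution ::
  "'a::euclidean_space set \<Rightarrow> ('a \<Rightarrow> real) \<Rightarrow> ('a \<Rightarrow> real) \<Rightarrow> bool" where
  "viscosity_solution \<Omega> f u \<longleftrightarrow> viscosity_subsolution \<Omega> f u \<and> viscosity_supersolution \<Omega> f u"

end

theory Submission
  imports Defs "HOL-Complex_Analysis.Great_Picard"
begin

text \<open>Let \<open>T u x\<close> be the mean of the minimum and the maximum of \<open>u\<close> over \<open>B(x, \<epsilon>)\<close>. If
  \<open>u - T u\<close> is bounded, then following steepest steps from a nearly maximal step bounds all steps
  of \<open>u\<close>, and \<open>\<epsilon>\<^sup>2 / 2 * u\<close> is Lipschitz at scale \<open>\<epsilon>\<close>, uniformly in \<open>\<epsilon>\<close>. Approximate solutions of
  \<open>u = T u + f - c\<close> come from the game with a vanishing discount. They need not be continuous, but they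
  control the value iteration and so identify \<open>c\<close> with \<open>c\<^sub>f(\<epsilon>)\<close>. Since \<open>T \<phi> - \<phi>\<close> is close to
  \<open>\<epsilon>\<^sup>2 / 2\<close> times the infinity Laplacian of \<open>\<phi>\<close>, limits of \<open>\<epsilon>\<^sup>2 / 2 * u\<close> are viscosity solutions; at
  boundary points with \<open>\<nabla>\<^sub>\<nu> \<phi> > 0\<close> the direction of steepest descent points into \<open>\<Omega>\<close>, and the
  interior argument still applies.

  Of the intrinsic metric only three properties matter: it is symmetric, dominates the Euclidean
  metric, and agrees with it along segments contained in the closure of \<open>\<Omega>\<close>. Chains of such
  segments take the place of geodesics.\<close>

section \<open>Intrinsic balls and the tug-of-war operator\<close>

text \<open>The powers of \<epsilon> decide the proof. Two points are joined by O(1/\<epsilon>)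
  steps, so a bounded \<open>u - T u\<close> gives steps of size O(1/\<epsilon>) and an oscillation
  O(1/\<epsilon>^2). The factor \<epsilon>^2/2 brings this to O(1), and it is also the scale on
  which T acts on smooth functions; one scaling serves both compactness and the limit equation.
  Every error in the comparison with a test function must therefore be o(\<epsilon>^2). Showing that
  T preserves continuity would call for finer properties of the intrinsic metric. Working with
  bounded functions avoids this; the price is that suprema need not be attained, so optimal choices
  are replaced by nearly optimal ones with a slack. An upper bound for T on a test function is
  one-sided: only the reflection of a maximising step has to be an admissible move, while the
  maximiser itself may lie outside the domain. This is how the Neumann condition emerges.\<close>

lemma curve_length_reversepath_le: "curve_length (reversepath g) \<le> curve_length g"
  unfolding curve_length_def
proof (rule SUP_least)
  fix ts :: "real list"
  assume "ts \<in> {ts. sorted ts \<and> set ts \<subseteq> {0..1}}"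
  then have ts: "sorted ts" "set ts \<subseteq> {0..1}" by auto
  define us where "us = rev (map (\<lambda>t. 1 - t) ts)"
  have us: "us \<in> {ts. sorted ts \<and> set ts \<subseteq> {0..1}}"
    using ts by (auto simp: us_def sorted_wrt_rev sorted_wrt_map)
  define n where "n = length ts - 1"
  have eq: "dist (reversepath g (ts ! k)) (reversepath g (ts ! Suc k))
      = dist (g (us ! (n - Suc k))) (g (us ! Suc (n - Suc k)))" if "k < n" for k
  proof -
    have "us ! (n - Suc k) = 1 - ts ! Suc k" "us ! Suc (n - Suc k) = 1 - ts ! k"
      using that unfolding us_def n_def by (auto simp: rev_nth Suc_diff_Suc)
    then show ?thesis by (simp add: reversepath_def dist_commute)
  qed
  have "(\<Sum>k<n. dist (reversepath g (ts ! k)) (reversepath g (ts ! Suc k)))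
     = (\<Sum>k<n. dist (g (us ! (n - Suc k))) (g (us ! Suc (n - Suc k))))"
    by (rule sum.cong) (use eq in auto)
  also have "\<dots> = (\<Sum>k<n. dist (g (us ! k)) (g (us ! Suc k)))"
    by (rule sum.nat_diff_reindex)
  finally have "ennreal (\<Sum>k<length ts - 1. dist (reversepath g (ts ! k)) (reversepath g (ts ! Suc k)))
     = ennreal (\<Sum>k<length us - 1. dist (g (us ! k)) (g (us ! Suc k)))"
    by (simp add: n_def us_def)
  also have "\<dots> \<le> (SUP ts\<in>{ts. sorted ts \<and> set ts \<subseteq> {0..1}}.
       ennreal (\<Sum>k<length ts - 1. dist (g (ts ! k)) (g (ts ! Suc k))))"
    by (rule SUP_upper[OF us])
  finally show "ennreal (\<Sum>k<length ts - 1. dist (reversepath g (ts ! k)) (reversepath g (ts ! Suc k)))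
     \<le> (SUP ts\<in>{ts. sorted ts \<and> set ts \<subseteq> {0..1}}.
       ennreal (\<Sum>k<length ts - 1. dist (g (ts ! k)) (g (ts ! Suc k))))" .
qed

lemma intrinsic_dist_commute: "intrinsic_dist \<Omega> x y = intrinsic_dist \<Omega> y x"
proof -
  have "intrinsic_dist \<Omega> x y \<le> intrinsic_dist \<Omega> y x" for x y
    unfolding intrinsic_dist_def
  proof (rule INF_mono)
    fix g assume "g \<in> {g. path g \<and> path_image g \<subseteq> closure \<Omega> \<and> pathstart g = y \<and> pathfinish g = x}"
    then show "\<exists>h\<in>{g. path g \<and> path_image g \<subseteq> closure \<Omega> \<and> pathstart g = x \<and> pathfinish g = y}.
        curve_length h \<le> curve_length g"
      by (intro bexI[of _ "reversepath g"] curve_length_reversepath_le) auto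
  qed
  then show ?thesis by (simp add: antisym)
qed

lemma dist_le_intrinsic_dist: "ennreal (dist x y) \<le> intrinsic_dist \<Omega> x y"
  unfolding intrinsic_dist_def
proof (rule INF_greatest)
  fix g assume "g \<in> {g. path g \<and> path_image g \<subseteq> closure \<Omega> \<and> pathstart g = x \<and> pathfinish g = y}"
  then have g: "g 0 = x" "g 1 = y" by (auto simp: pathstart_def pathfinish_def)
  \<comment> \<open>The partition into the two points 0 and 1 already measures the chord.\<close>
  have "ennreal (\<Sum>k<length [0::real, 1] - 1. dist (g ([0, 1] ! k)) (g ([0, 1] ! Suc k))) \<le> curve_length g"
    unfolding curve_length_def by (rule SUP_upper) simp
  then show "ennreal (dist x y) \<le> curve_length g" by (simp add: g)
qed

text \<open>The gaps telescope to the last entry minus the first. The empty list stands apart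
  because \<open>length ts - 1\<close> truncates to 0 there.\<close>

lemma sorted_sum_gaps_le:
  fixes ts :: "real list"
  assumes "sorted ts" "set ts \<subseteq> {0..1}"
  shows "(\<Sum>k<length ts - 1. ts ! Suc k - ts ! k) \<le> 1"
proof (cases "ts = []")
  case False
  then have "ts ! (length ts - 1) \<in> {0..1}" "ts ! 0 \<in> {0..1}"
    using assms(2) by (auto simp only: length_greater_0_conv intro!: subsetD[OF assms(2)] nth_mem diff_less)
  then show ?thesis by (simp only: sum_lessThan_telescope) auto
qed auto

lemma intrinsic_dist_segment_le:
  assumes "closed_segment x y \<subseteq> closure \<Omega>"
  shows "intrinsic_dist \<Omega> x y \<le> ennreal (dist x y)"
proof -
  have "intrinsic_dist \<Omega> x y \<le> curve_length (linepath x y)"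
    unfolding intrinsic_dist_def by (rule INF_lower) (use assms in auto)
  also have "\<dots> \<le> ennreal (dist x y)"
    unfolding curve_length_def
  proof (rule SUP_least)
    fix ts :: "real list"
    assume "ts \<in> {ts. sorted ts \<and> set ts \<subseteq> {0..1}}"
    then have ts: "sorted ts" "set ts \<subseteq> {0..1}" by auto
    have "dist (linepath x y (ts ! k)) (linepath x y (ts ! Suc k)) = (ts ! Suc k - ts ! k) * dist x y"
      if "k < length ts - 1" for k
    proof -
      have "ts ! k \<le> ts ! Suc k" using ts(1) that by (simp add: sorted_nth_mono)
      moreover have "linepath x y (ts ! k) - linepath x y (ts ! Suc k) = (ts ! Suc k - ts ! k) *\<^sub>R (x - y)"
        by (simp add: linepath_def algebra_simps)
      ultimately show ?thesis by (simp add: dist_norm)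
    qed
    then have "(\<Sum>k<length ts - 1. dist (linepath x y (ts ! k)) (linepath x y (ts ! Suc k)))
        = (\<Sum>k<length ts - 1. ts ! Suc k - ts ! k) * dist x y"
      by (simp add: sum_distrib_right)
    also have "\<dots> \<le> dist x y"
      using mult_right_mono[OF sorted_sum_gaps_le[OF ts], of "dist x y"] by simp
    finally show "ennreal (\<Sum>k<length ts - 1. dist (linepath x y (ts ! k)) (linepath x y (ts ! Suc k)))
        \<le> ennreal (dist x y)" by (rule ennreal_leI)
  qed
  finally show ?thesis .
qed

lemma intrinsic_cball_subset:
  assumes "0 \<le> \<epsilon>"
  shows "intrinsic_cball \<Omega> x \<epsilon> \<subseteq> closure \<Omega> \<inter> cball x \<epsilon>"
proof
  fix y assume y: "y \<in> intrinsic_cball \<Omega> x \<epsilon>"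
  then have "ennreal (dist x y) \<le> ennreal \<epsilon>"
    using dist_le_intrinsic_dist[of x y \<Omega>] unfolding intrinsic_cball_def by (auto intro: order_trans)
  then show "y \<in> closure \<Omega> \<inter> cball x \<epsilon>"
    using y assms unfolding intrinsic_cball_def by (auto simp: ennreal_le_iff)
qed

lemma intrinsic_cball_segment:
  assumes "closed_segment x y \<subseteq> closure \<Omega>" "dist x y \<le> \<epsilon>"
  shows "y \<in> intrinsic_cball \<Omega> x \<epsilon>"
  using intrinsic_dist_segment_le[OF assms(1)] assms ennreal_leI[OF assms(2)]
  unfolding intrinsic_cball_def by (auto intro: order_trans)

lemma intrinsic_cball_self:
  assumes "x \<in> closure \<Omega>" "0 \<le> \<epsilon>"
  shows "x \<in> intrinsic_cball \<Omega> x \<epsilon>"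
  using assms by (intro intrinsic_cball_segment) auto

lemma intrinsic_cball_commute:
  assumes "y \<in> intrinsic_cball \<Omega> x \<epsilon>" "x \<in> closure \<Omega>"
  shows "x \<in> intrinsic_cball \<Omega> y \<epsilon>"
  using assms unfolding intrinsic_cball_def by (auto simp: intrinsic_dist_commute)

text \<open>Infimum and supremum are those of the reals, meaningful for bounded images; hence the
  boundedness hypotheses below. Continuity is not asked for, so the operator can be iterated
  freely.\<close>

definition tug :: "'a::euclidean_space set \<Rightarrow> real \<Rightarrow> ('a \<Rightarrow> real) \<Rightarrow> 'a \<Rightarrow> real" where
  "tug \<Omega> \<epsilon> u x =
    1/2 * ((INF y\<in>intrinsic_cball \<Omega> x \<epsilon>. u y) + (SUP y\<in>intrinsic_cball \<Omega> x \<epsilon>. u y))"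

lemma value_iter_Suc_tug:
  "value_iter \<Omega> f \<epsilon> u\<^sub>0 (Suc n) x = tug \<Omega> \<epsilon> (value_iter \<Omega> f \<epsilon> u\<^sub>0 n) x + f x"
  by (simp add: tug_def)

context
  fixes \<Omega> :: "'a::euclidean_space set" and \<epsilon> :: real and x :: 'a
  assumes x: "x \<in> closure \<Omega>" and \<epsilon>: "0 \<le> \<epsilon>"
begin

lemma intrinsic_cball_nonempty: "intrinsic_cball \<Omega> x \<epsilon> \<noteq> {}"
  using intrinsic_cball_self[OF x \<epsilon>] by auto

lemma bdd_intrinsic_cball:
  assumes "bounded (u ` closure \<Omega>)"
  shows "bdd_above (u ` intrinsic_cball \<Omega> x \<epsilon>)" "bdd_below (u ` intrinsic_cball \<Omega> x \<epsilon> :: real set)"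
proof -
  have "bounded (u ` intrinsic_cball \<Omega> x \<epsilon>)"
    using assms by (rule bounded_subset) (auto simp: intrinsic_cball_def)
  then show "bdd_above (u ` intrinsic_cball \<Omega> x \<epsilon>)" "bdd_below (u ` intrinsic_cball \<Omega> x \<epsilon>)"
    by (simp_all add: bounded_imp_bdd_above bounded_imp_bdd_below)
qed

text \<open>Monotonicity and commutation with constants in one statement; together they make
  \<open>tug\<close> nonexpansive in the sup norm. The inequality is asked on the ball around x
  only, which allows comparison with a function that dominates just locally.\<close>

lemma tug_le_add:
  assumes u: "bounded (u ` closure \<Omega>)" and w: "bounded (w ` closure \<Omega>)"
    and le: "\<And>y. y \<in> intrinsic_cball \<Omega> x \<epsilon> \<Longrightarrow> u y \<le> w y + c"
  shows "tug \<Omega> \<epsilon> u x \<le> tug \<Omega> \<epsilon> w x + c"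
proof -
  let ?B = "intrinsic_cball \<Omega> x \<epsilon>"
  have "(SUP y\<in>?B. u y) \<le> (SUP y\<in>?B. w y) + c"
  proof (rule cSUP_least[OF intrinsic_cball_nonempty])
    fix y assume "y \<in> ?B"
    then show "u y \<le> (SUP y\<in>?B. w y) + c"
      using le[of y] cSUP_upper[of y ?B w] bdd_intrinsic_cball[OF w] by simp
  qed
  moreover have "(INF y\<in>?B. u y) - c \<le> (INF y\<in>?B. w y)"
  proof (rule cINF_greatest[OF intrinsic_cball_nonempty])
    fix y assume "y \<in> ?B"
    then show "(INF y\<in>?B. u y) - c \<le> w y"
      using le[of y] cINF_lower[of u ?B y] bdd_intrinsic_cball[OF u] by simp
  qed
  moreover have "1/2 * (i + s) \<le> 1/2 * (i' + s') + c" if "s \<le> s' + c" "i - c \<le> i'" for i i' s s' :: real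
    using that by (simp add: field_simps)
  ultimately show ?thesis unfolding tug_def by blast
qed

lemma tug_const: "tug \<Omega> \<epsilon> (\<lambda>_. c) x = c"
  using intrinsic_cball_nonempty by (simp add: tug_def)

lemma tug_le:
  assumes "bounded (u ` closure \<Omega>)" "\<And>y. y \<in> closure \<Omega> \<Longrightarrow> u y \<le> c"
  shows "tug \<Omega> \<epsilon> u x \<le> c"
  using tug_le_add[OF assms(1), of "\<lambda>_. c" 0] assms(2)
  by (auto simp: tug_const intrinsic_cball_def image_constant_conv)

lemma tug_ge:
  assumes "bounded (u ` closure \<Omega>)" "\<And>y. y \<in> closure \<Omega> \<Longrightarrow> c \<le> u y"
  shows "c \<le> tug \<Omega> \<epsilon> u x"
  using tug_le_add[OF _ assms(1), of "\<lambda>_. c" 0] assms(2)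
  by (auto simp: tug_const intrinsic_cball_def image_constant_conv)

lemma tug_affine:
  assumes u: "bounded (u ` closure \<Omega>)" and a: "0 < a"
  shows "tug \<Omega> \<epsilon> (\<lambda>y. a * u y + b) x = a * tug \<Omega> \<epsilon> u x + b"
proof -
  let ?B = "intrinsic_cball \<Omega> x \<epsilon>"
  have m: "mono (\<lambda>t. a * t + b)" using a by (auto simp: mono_def)
  have c: "continuous (at z within S) (\<lambda>t. a * t + b)" for z S
    by (intro continuous_intros)
  have "a * (SUP y\<in>?B. u y) + b = (SUP y\<in>?B. a * u y + b)"
    using continuous_at_Sup_mono[OF m c, of "u ` ?B"] intrinsic_cball_nonempty bdd_intrinsic_cball[OF u]
    by (simp add: image_image)
  moreover have "a * (INF y\<in>?B. u y) + b = (INF y\<in>?B. a * u y + b)"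
    using continuous_at_Inf_mono[OF m c, of "u ` ?B"] intrinsic_cball_nonempty bdd_intrinsic_cball[OF u]
    by (simp add: image_image)
  ultimately show ?thesis by (simp add: tug_def field_simps)
qed

text \<open>The real infimum is by definition minus the supremum of the negated set, so the identity
  holds for arbitrary u.\<close>

lemma tug_uminus: "tug \<Omega> \<epsilon> (\<lambda>y. - u y) x = - tug \<Omega> \<epsilon> u x"
proof -
  have "(SUP y\<in>A. - u y) = - (INF y\<in>A. u y)" "(INF y\<in>A. - u y) = - (SUP y\<in>A. u y)" for A
    by (simp_all add: Inf_real_def image_image)
  then show ?thesis unfolding tug_def by (simp only:) (simp add: field_simps)
qed

end

section \<open>Chains of short segments\<close>

definition seg_step :: "'a::euclidean_space set \<Rightarrow> real \<Rightarrow> 'a \<Rightarrow> 'a \<Rightarrow> bool" where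
  "seg_step S \<epsilon> a b \<longleftrightarrow> closed_segment a b \<subseteq> S \<and> dist a b \<le> \<epsilon>"

text \<open>Think of a polygonal path of length l with n segments: cutting a segment into steps of
  size \<epsilon> costs at most one extra step for rounding. One pair (n, l) serves all \<epsilon>,
  and both numbers add up under concatenation.\<close>

definition chain_bound :: "'a::euclidean_space set \<Rightarrow> real \<Rightarrow> real \<Rightarrow> 'a \<Rightarrow> 'a \<Rightarrow> bool" where
  "chain_bound S n l x y \<longleftrightarrow>
    (\<forall>\<epsilon>>0. \<exists>N. real N \<le> l / \<epsilon> + n \<and> (seg_step S \<epsilon> ^^ N) x y)"

lemma chain_bound_trans:
  assumes "chain_bound S m a x y" "chain_bound S n b y z"
  shows "chain_bound S (m + n) (a + b) x z"
  unfolding chain_bound_def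
proof (intro allI impI)
  fix \<epsilon> :: real assume "0 < \<epsilon>"
  then obtain N N' where "real N \<le> a / \<epsilon> + m" "(seg_step S \<epsilon> ^^ N) x y"
      "real N' \<le> b / \<epsilon> + n" "(seg_step S \<epsilon> ^^ N') y z"
    using assms unfolding chain_bound_def by meson
  then show "\<exists>N. real N \<le> (a + b) / \<epsilon> + (m + n) \<and> (seg_step S \<epsilon> ^^ N) x z"
    by (intro exI[of _ "N + N'"]) (auto simp: add_divide_distrib relpowp_add)
qed

lemma chain_bound_mono:
  assumes "chain_bound S m a x y" "m \<le> n" "a \<le> b"
  shows "chain_bound S n b x y"
  unfolding chain_bound_def
proof (intro allI impI)
  fix \<epsilon> :: real assume "0 < \<epsilon>"
  moreover from this have "a / \<epsilon> \<le> b / \<epsilon>" using assms(3) by (simp add: divide_right_mono)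
  ultimately show "\<exists>N. real N \<le> b / \<epsilon> + n \<and> (seg_step S \<epsilon> ^^ N) x y"
    using assms(1,2) unfolding chain_bound_def by (meson add_mono order_trans)
qed

lemma chain_bound_segment:
  assumes "closed_segment x y \<subseteq> S"
  shows "chain_bound S 1 (dist x y) x y"
  unfolding chain_bound_def
proof (intro allI impI)
  fix \<epsilon> :: real assume \<epsilon>: "0 < \<epsilon>"
  define N where "N = nat \<lceil>dist x y / \<epsilon>\<rceil>"
  have N: "dist x y / \<epsilon> \<le> real N" "real N \<le> dist x y / \<epsilon> + 1"
    using \<epsilon> ceiling_correct[of "dist x y / \<epsilon>"] unfolding N_def by auto
  define p where "p k = x + (real k / real N) *\<^sub>R (y - x)" for k
  have "(seg_step S \<epsilon> ^^ N) x y"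
    unfolding relpowp_fun_conv
  proof (intro exI[of _ p] conjI allI impI)
    show "p 0 = x" by (simp add: p_def)
    show "p N = y"
    \<comment> \<open>For N = 0 the points coincide, and division by zero gives
      \<open>p 0 = x\<close>.\<close>
    proof (cases "N = 0")
      case True
      then have "dist x y \<le> 0" using N(1) \<epsilon> by (simp add: divide_le_0_iff)
      then show ?thesis by (simp add: p_def True)
    qed (simp add: p_def)
    fix k assume k: "k < N"
    have in_seg: "p j \<in> closed_segment x y" if "j \<le> N" for j
      unfolding in_segment
      by (rule exI[of _ "real j / real N"]) (use that k in \<open>auto simp: p_def algebra_simps\<close>)
    have "closed_segment (p k) (p (Suc k)) \<subseteq> closed_segment x y"
      using in_seg[of k] in_seg[of "Suc k"] k by (simp add: subset_closed_segment)
    moreover have "p (Suc k) - p k = (1 / real N) *\<^sub>R (y - x)"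
      by (simp add: p_def scaleR_left_diff_distrib[symmetric] add_divide_distrib)
    then have "dist (p k) (p (Suc k)) = dist x y / real N"
      by (subst (1 2) dist_commute) (simp add: dist_norm)
    moreover have "dist x y / real N \<le> \<epsilon>"
      using N(1) \<epsilon> k by (simp add: field_simps)
    ultimately show "seg_step S \<epsilon> (p k) (p (Suc k))"
      using assms by (auto simp: seg_step_def)
  qed
  then show "\<exists>N. real N \<le> dist x y / \<epsilon> + 1 \<and> (seg_step S \<epsilon> ^^ N) x y" using N(2) by blast
qed

section \<open>Charts at the boundary\<close>

locale boundary_chart =
  fixes \<Omega> :: "'a::euclidean_space set" and z :: 'a and r :: real and e :: 'a
    and F :: "'a \<Rightarrow> real" and G :: "'a \<Rightarrow> 'a"
  assumes open_dom: "open \<Omega>"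
    and r_pos: "0 < r"
    and norm_e: "norm e = 1"
    and F_deriv: "\<And>x. (F has_derivative (\<lambda>h. G x \<bullet> h)) (at x)"
    and G_cont: "continuous_on UNIV G"
    and dom_chart: "\<Omega> \<inter> ball z r = {y \<in> ball z r. F y < 0}"
    and F_shift: "\<And>x t. F (x + t *\<^sub>R e) = F x - t"

lemma boundary_chart_exists:
  fixes \<Omega> :: "'a::euclidean_space set"
  assumes "open \<Omega>" "C1_boundary \<Omega>" "z \<in> frontier \<Omega>"
  obtains r e F G where "boundary_chart \<Omega> z r e F G"
proof -
  obtain r e \<gamma> where r: "r > 0" "norm e = 1" "C1_function \<gamma>"
      and dom: "\<Omega> \<inter> ball z r = {y \<in> ball z r. \<gamma> (y - (y \<bullet> e) *\<^sub>R e) < y \<bullet> e}"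
    using assms(2,3) unfolding C1_boundary_def by blast
  obtain G where G: "\<And>x. GDERIV \<gamma> x :> G x" "continuous_on UNIV G"
    using r(3) unfolding C1_function_def by blast
  define P where "P y = y - (y \<bullet> e) *\<^sub>R e" for y
  have P_lin: "bounded_linear P"
    unfolding P_def by (intro bounded_linear_intros)
  \<comment> \<open>A defining function, negative inside. As P annihilates e, it falls at unit rate
    along e, which is how the locale records that the boundary is a graph. Self-adjointness of P
    yields the gradient \<open>P (G (P x)) - e\<close>.\<close>
  define F where "F y = \<gamma> (P y) - y \<bullet> e" for y
  have "boundary_chart \<Omega> z r e F (\<lambda>x. P (G (P x)) - e)"
  proof
    show "(F has_derivative (\<lambda>h. (P (G (P x)) - e) \<bullet> h)) (at x)" for x
    proof -
      have "(\<gamma> has_derivative (\<lambda>h. G (P x) \<bullet> h)) (at (P x))"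
        using G(1)[of "P x"] by (simp add: gderiv_def inner_commute)
      then have "((\<lambda>y. \<gamma> (P y) - y \<bullet> e) has_derivative (\<lambda>h. G (P x) \<bullet> P h - h \<bullet> e)) (at x)"
        by (intro has_derivative_diff has_derivative_compose[OF bounded_linear_imp_has_derivative[OF P_lin]]
            bounded_linear_imp_has_derivative bounded_linear_inner_left)
      moreover have "G (P x) \<bullet> P h - h \<bullet> e = (P (G (P x)) - e) \<bullet> h" for h
        by (simp add: P_def inner_diff_left inner_diff_right inner_commute algebra_simps)
      ultimately show ?thesis by (simp add: F_def[abs_def])
    qed
    have "continuous_on UNIV P" by (rule linear_continuous_on[OF P_lin])
    then show "continuous_on UNIV (\<lambda>x. P (G (P x)) - e)"
      by (intro continuous_intros continuous_on_compose2[OF \<open>continuous_on UNIV P\<close>]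
            continuous_on_compose2[OF G(2)]) auto
    show "\<Omega> \<inter> ball z r = {y \<in> ball z r. F y < 0}" using dom by (simp add: F_def P_def)
    have "e \<bullet> e = 1" using r(2) by (simp add: dot_square_norm)
    then show "F (x + t *\<^sub>R e) = F x - t" for x t
      by (simp add: F_def P_def inner_add_left scaleR_add_left)
  qed (use assms r in auto)
  then show ?thesis by (rule that)
qed

context boundary_chart
begin

lemma F_cont: "continuous_on UNIV F"
  by (intro continuous_at_imp_continuous_on ballI has_derivative_continuous[OF F_deriv])

text \<open>The set where F > 0 is open and misses \<Omega>; a point with F \<le> 0 is approached
  from \<Omega> by moving along e, which lowers F.\<close>

lemma closure_chart: "closure \<Omega> \<inter> ball z r = {y \<in> ball z r. F y \<le> 0}"
proof (intro equalityI subsetI)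
  fix y assume y: "y \<in> closure \<Omega> \<inter> ball z r"
  have "open {y. 0 < F y}"
    using F_cont by (intro open_Collect_less) (auto intro: continuous_intros)
  then have "open (ball z r \<inter> {y. 0 < F y})" by blast
  moreover have "(ball z r \<inter> {y. 0 < F y}) \<inter> \<Omega> = {}" using dom_chart by force
  ultimately have "(ball z r \<inter> {y. 0 < F y}) \<inter> closure \<Omega> = {}"
    by (simp add: open_Int_closure_eq_empty)
  then show "y \<in> {y \<in> ball z r. F y \<le> 0}" using y by force
next
  fix y assume "y \<in> {y \<in> ball z r. F y \<le> 0}"
  then have y: "y \<in> ball z r" "F y \<le> 0" by auto
  have "\<exists>x\<in>\<Omega>. dist x y < d" if d: "0 < d" for d
  proof -
    obtain d' where d': "d' > 0" "ball y d' \<subseteq> ball z r"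
      using y(1) open_ball openE by blast
    define t where "t = min d d' / 2"
    have t: "0 < t" "t < d" "t < d'" using d d' by (auto simp: t_def)
    have "dist y (y + t *\<^sub>R e) = t" using norm_e t(1) by (simp add: dist_norm)
    then have "y + t *\<^sub>R e \<in> ball y d'" using t by simp
    then have "y + t *\<^sub>R e \<in> ball z r" using d'(2) by blast
    moreover have "F (y + t *\<^sub>R e) < 0" using F_shift y(2) t(1) by simp
    ultimately have "y + t *\<^sub>R e \<in> \<Omega>" using dom_chart by auto
    then show ?thesis using \<open>dist y (y + t *\<^sub>R e) = t\<close> t(2) by (metis dist_commute)
  qed
  then show "y \<in> closure \<Omega> \<inter> ball z r" using y(1) by (simp add: closure_approachable)
qed

lemma mem_closure_chart: "y \<in> ball z r \<Longrightarrow> y \<in> closure \<Omega> \<longleftrightarrow> F y \<le> 0"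
  using closure_chart by blast

lemma mem_dom_chart: "y \<in> ball z r \<Longrightarrow> y \<in> \<Omega> \<longleftrightarrow> F y < 0"
  using dom_chart by blast

lemma frontier_chart: "frontier \<Omega> \<inter> ball z r = {y \<in> ball z r. F y = 0}"
proof -
  have "y \<in> frontier \<Omega> \<longleftrightarrow> F y = 0" if "y \<in> ball z r" for y
    unfolding frontier_def interior_open[OF open_dom] Diff_iff
      mem_closure_chart[OF that] mem_dom_chart[OF that] by linarith
  then show ?thesis by blast
qed

text \<open>The path goes from x along e by s = M |x - y|, across to the translate of y, and back
  down to y. As M bounds the gradient of F, F rises by at most s on the segment from x to y, so the
  middle piece, lowered by s, has F \<le> 0. These are three pieces of total length (2 M + 1) |x -
  y|.\<close>

lemma chain_bound_chart:
  obtains \<rho> K where "0 < \<rho>"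
    "\<And>x y. x \<in> closure \<Omega> \<Longrightarrow> y \<in> closure \<Omega> \<Longrightarrow> dist z x < \<rho> \<Longrightarrow> dist z y < \<rho> \<Longrightarrow>
      chain_bound (closure \<Omega>) 3 (K * dist x y) x y"
proof -
  have "bounded (G ` cball z r)"
    by (intro compact_imp_bounded compact_continuous_image continuous_on_subset[OF G_cont]) auto
  then obtain M where M: "0 < M" "\<And>x. x \<in> cball z r \<Longrightarrow> norm (G x) \<le> M"
    unfolding bounded_pos by auto
  have lip: "F x \<le> F y + M * dist x y" if "x \<in> cball z r" "y \<in> cball z r" for x y
  proof -
    have "onorm (\<lambda>h. G w \<bullet> h) \<le> M" if "w \<in> cball z r" for w
    proof (rule onorm_le)
      fix h
      have "\<bar>G w \<bullet> h\<bar> \<le> norm (G w) * norm h" by (rule Cauchy_Schwarz_ineq2)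
      also have "\<dots> \<le> M * norm h" using M(2)[OF that] by (intro mult_right_mono) auto
      finally show "norm (G w \<bullet> h) \<le> M * norm h" by simp
    qed
    then have "norm (F x - F y) \<le> M * norm (x - y)"
      using that F_deriv by (intro differentiable_bound[of "cball z r" F "\<lambda>w h. G w \<bullet> h"])
        (auto intro: has_derivative_at_withinI)
    then show ?thesis by (simp add: dist_norm)
  qed
  \<comment> \<open>Here s is at most 2 M \<rho>, so the raised path stays in the chart if \<rho> +
    2 M \<rho> < r.\<close>
  define \<rho> where "\<rho> = r / (2 * (1 + M))"
  have \<rho>: "0 < \<rho>" "\<rho> * (1 + 2 * M) < r"
    using r_pos M(1) by (auto simp: \<rho>_def field_simps)
  have "chain_bound (closure \<Omega>) 3 ((2 * M + 1) * dist x y) x y"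
    if x: "x \<in> closure \<Omega>" and y: "y \<in> closure \<Omega>" and d: "dist z x < \<rho>" "dist z y < \<rho>" for x y
  proof -
    define s where "s = M * dist x y"
    have "\<rho> \<le> \<rho> * (1 + 2 * M)" using \<rho>(1) M(1) by simp
    then have \<rho>r: "\<rho> \<le> r" using \<rho>(2) by simp
    have "dist x y \<le> 2 * \<rho>" using d dist_triangle3[of x y z] by simp
    then have "s \<le> M * (2 * \<rho>)" unfolding s_def using M(1) by (intro mult_left_mono) auto
    moreover have "M * (2 * \<rho>) + \<rho> < r" using \<rho>(2) by (simp add: algebra_simps)
    moreover have "0 \<le> s" using M(1) by (simp add: s_def)
    ultimately have s: "0 \<le> s" "\<rho> + s < r" by linarith+
    have in_cl: "w + t *\<^sub>R e \<in> closure \<Omega>"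
      if w: "dist z w < \<rho>" and t: "0 \<le> t" "t \<le> s" and F: "F w \<le> t" for w t
    proof -
      have "dist z (w + t *\<^sub>R e) \<le> dist z w + t"
        using norm_triangle_ineq4[of "z - w" "t *\<^sub>R e"] norm_e t(1) by (simp add: dist_norm algebra_simps)
      then have "w + t *\<^sub>R e \<in> ball z r" using s(2) w t by simp
      then show ?thesis using F by (simp add: F_shift mem_closure_chart)
    qed
    have F_le: "F w \<le> 0" if "w \<in> closure \<Omega>" "dist z w < \<rho>" for w
      using mem_closure_chart[of w] that \<rho>r by simp
    have up: "closed_segment w (w + s *\<^sub>R e) \<subseteq> closure \<Omega>"
      if "w \<in> closure \<Omega>" "dist z w < \<rho>" for w
    proof
      fix v assume "v \<in> closed_segment w (w + s *\<^sub>R e)"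
      then obtain u where u: "0 \<le> u" "u \<le> 1" "v = (1 - u) *\<^sub>R w + u *\<^sub>R (w + s *\<^sub>R e)"
        unfolding in_segment by blast
      then have "v = w + (u * s) *\<^sub>R e" by (simp add: algebra_simps)
      moreover have "0 \<le> u * s" "u * s \<le> s" using u s(1) by (simp_all add: mult_left_le_one_le)
      ultimately show "v \<in> closure \<Omega>"
        using in_cl[OF that(2), of "u * s"] F_le[OF that] by simp
    qed
    have across: "closed_segment (x + s *\<^sub>R e) (y + s *\<^sub>R e) \<subseteq> closure \<Omega>"
    proof
      fix v assume "v \<in> closed_segment (x + s *\<^sub>R e) (y + s *\<^sub>R e)"
      then obtain u where u: "0 \<le> u" "u \<le> 1" "v = (1 - u) *\<^sub>R (x + s *\<^sub>R e) + u *\<^sub>R (y + s *\<^sub>R e)"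
        unfolding in_segment by blast
      define w where "w = (1 - u) *\<^sub>R x + u *\<^sub>R y"
      have v: "v = w + s *\<^sub>R e" using u(3) by (simp add: w_def algebra_simps)
      have w: "w \<in> closed_segment x y" using u by (auto simp: in_segment w_def)
      then have "w \<in> ball z \<rho>"
        using closed_segment_subset[of x "ball z \<rho>" y] d by auto
      moreover have "dist w x \<le> dist x y"
        using dist_in_closed_segment[OF w] by (simp add: dist_commute)
      then have "M * dist w x \<le> M * dist x y" using M(1) by (intro mult_left_mono) auto
      then have "F w \<le> F x + M * dist x y"
        using lip[of w x] \<open>w \<in> ball z \<rho>\<close> d \<rho>r by auto
      ultimately show "v \<in> closure \<Omega>"
        unfolding v using in_cl[of w s] s F_le[OF x d(1)] by (simp add: s_def)
    qed
    have d1: "dist w (w + s *\<^sub>R e) = s" for w using norm_e s(1) by (simp add: dist_norm)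
    have "chain_bound (closure \<Omega>) (1 + (1 + 1)) (s + (dist x y + s)) x y"
      using chain_bound_segment[OF up[OF x d(1)]] chain_bound_segment[OF across]
        chain_bound_segment[of "y + s *\<^sub>R e" y "closure \<Omega>"] up[OF y d(2)]
      by (intro chain_bound_trans[of _ _ _ x "x + s *\<^sub>R e"] chain_bound_trans[of _ _ _ _ "y + s *\<^sub>R e"])
        (simp_all add: d1 closed_segment_commute dist_commute)
    then show ?thesis by (rule chain_bound_mono) (auto simp: s_def algebra_simps)
  qed
  then show ?thesis using that \<rho>(1) by blast
qed

end

section \<open>A chain bound on the whole closure\<close>

lemma chain_bound_local:
  assumes "open \<Omega>" "C1_boundary \<Omega>" "z \<in> closure \<Omega>"
  obtains \<rho> K where "0 < \<rho>"
    "\<And>x y. x \<in> closure \<Omega> \<Longrightarrow> y \<in> closure \<Omega> \<Longrightarrow> dist z x < \<rho> \<Longrightarrow> dist z y < \<rho> \<Longrightarrow>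
      chain_bound (closure \<Omega>) 3 (K * dist x y) x y"
proof (cases "z \<in> \<Omega>")
  case True
  then obtain \<rho> where \<rho>: "0 < \<rho>" "ball z \<rho> \<subseteq> \<Omega>" using assms(1) openE by blast
  have "chain_bound (closure \<Omega>) 3 (1 * dist x y) x y" if "dist z x < \<rho>" "dist z y < \<rho>" for x y
  proof -
    have "closed_segment x y \<subseteq> ball z \<rho>" using that by (intro closed_segment_subset) auto
    then have "closed_segment x y \<subseteq> closure \<Omega>" using \<rho>(2) closure_subset by blast
    then show ?thesis using chain_bound_mono[OF chain_bound_segment, of x y "closure \<Omega>" 3 "1 * dist x y"] by simp
  qed
  then show ?thesis using that \<rho>(1) by blast
next
  case False
  then have "z \<in> frontier \<Omega>" using assms by (simp add: frontier_def interior_open)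
  then obtain r e F G where "boundary_chart \<Omega> z r e F G"
    using boundary_chart_exists assms by blast
  then show ?thesis by (rule boundary_chart.chain_bound_chart) (rule that)
qed

text \<open>Points closer than a Lebesgue number \<delta> of a finite cover share a local patch. For
  all others a bound E uniform in x and y suffices, because E \<le> (E / \<delta>) |x - y|; it comes
  from linking the finitely many centres, which connectedness makes possible.\<close>

lemma chain_bound_closure:
  assumes dom: "domain \<Omega>" and C1: "C1_boundary \<Omega>"
  obtains K where "0 < K"
    "\<And>x y. x \<in> closure \<Omega> \<Longrightarrow> y \<in> closure \<Omega> \<Longrightarrow> chain_bound (closure \<Omega>) K (K * dist x y) x y"
proof -
  let ?X = "closure \<Omega>"
  have X: "open \<Omega>" "compact ?X" "connected ?X"
    using dom unfolding domain_def by (auto simp: compact_closure connected_imp_connected_closure)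
  have "\<forall>z\<in>?X. \<exists>\<rho> K. 0 < \<rho> \<and> (\<forall>x\<in>?X. \<forall>y\<in>?X. dist z x < \<rho> \<longrightarrow> dist z y < \<rho> \<longrightarrow>
      chain_bound ?X 3 (K * dist x y) x y)"
  proof
    fix z assume "z \<in> ?X"
    then show "\<exists>\<rho> K. 0 < \<rho> \<and> (\<forall>x\<in>?X. \<forall>y\<in>?X. dist z x < \<rho> \<longrightarrow> dist z y < \<rho> \<longrightarrow>
      chain_bound ?X 3 (K * dist x y) x y)"
      by (rule chain_bound_local[OF X(1) C1]) blast
  qed
  then obtain \<rho> K where \<rho>: "\<And>z. z \<in> ?X \<Longrightarrow> 0 < \<rho> z"
    and K: "\<And>z x y. z \<in> ?X \<Longrightarrow> x \<in> ?X \<Longrightarrow> y \<in> ?X \<Longrightarrow> dist z x < \<rho> z \<Longrightarrow> dist z y < \<rho> z \<Longrightarrow>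
      chain_bound ?X 3 (K z * dist x y) x y"
    by metis
  \<comment> \<open>An equivalence relation with open classes, so connectedness leaves a single
    class. Asking for both directions makes symmetry immediate.\<close>
  define R where "R x y \<longleftrightarrow> (\<exists>c. chain_bound ?X c c x y) \<and> (\<exists>c. chain_bound ?X c c y x)" for x y
  have R_trans: "\<exists>c. chain_bound ?X c c x z"
    if "\<exists>c. chain_bound ?X c c x y" "\<exists>c. chain_bound ?X c c y z" for x y z
    using that by (elim exE) (rule exI, rule chain_bound_trans)
  have K': "\<exists>c. chain_bound ?X c c x y"
    if "z \<in> ?X" "x \<in> ?X" "y \<in> ?X" "dist z x < \<rho> z" "dist z y < \<rho> z" for x y z
    using chain_bound_mono[OF K[OF that], of "max 3 (K z * dist x y)" "max 3 (K z * dist x y)"] by auto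
  have R: "R x y" if "x \<in> ?X" "y \<in> ?X" for x y
  proof (rule connected_equivalence_relation[OF X(3) that])
    show "R y x" if "R x y" for x y using that by (auto simp: R_def)
    show "R x z" if "R x y" "R y z" for x y z using that R_trans unfolding R_def by blast
    fix a assume a: "a \<in> ?X"
    have "R a x" if "x \<in> ?X" "dist a x < \<rho> a" for x
      using that a \<rho>[OF a] K'[of a a x] K'[of a x a] by (simp add: R_def)
    then show "\<exists>T. openin (top_of_set ?X) T \<and> a \<in> T \<and> (\<forall>x\<in>T. R a x)"
      using a \<rho>[OF a] by (intro exI[of _ "?X \<inter> ball a (\<rho> a)"]) auto
  qed
  obtain Z where Z: "finite Z" "Z \<subseteq> ?X" "?X \<subseteq> (\<Union>z\<in>Z. ball z (\<rho> z))"
  proof (rule compactE_image[OF X(2), of ?X "\<lambda>z. ball z (\<rho> z)"])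
    show "?X \<subseteq> (\<Union>z\<in>?X. ball z (\<rho> z))" using \<rho> by fastforce
  qed auto
  obtain \<delta> where \<delta>: "0 < \<delta>" "\<forall>x\<in>?X. \<exists>B\<in>(\<lambda>z. ball z (\<rho> z)) ` Z. ball x \<delta> \<subseteq> B"
  proof (rule Heine_Borel_lemma[OF X(2), of "(\<lambda>z. ball z (\<rho> z)) ` Z"])
    show "?X \<subseteq> \<Union>((\<lambda>z. ball z (\<rho> z)) ` Z)" using Z(3) .
  qed auto
  define c where "c z w = (SOME c. chain_bound ?X c c z w)" for z w
  have c: "chain_bound ?X (c z w) (c z w) z w" if "z \<in> Z" "w \<in> Z" for z w
  proof -
    have "\<exists>c. chain_bound ?X c c z w" using R[of z w] Z(2) that unfolding R_def by blast
    then show ?thesis unfolding c_def by (rule someI_ex)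
  qed
  \<comment> \<open>Finite sums stand in for the maxima of K, \<rho> and c over the cover.\<close>
  define A where "A = (\<Sum>z\<in>Z. \<bar>K z\<bar>)"
  have A: "K z \<le> A" "0 \<le> A" if "z \<in> Z" for z
    using member_le_sum[OF that, of "\<lambda>z. \<bar>K z\<bar>"] Z(1) unfolding A_def by auto
  define D where "D = (\<Sum>z\<in>Z. \<rho> z)"
  have D: "\<rho> z \<le> D" if "z \<in> Z" for z
    using member_le_sum[OF that, of \<rho>] Z \<rho> unfolding D_def by force
  define C where "C = (\<Sum>(z,w)\<in>Z\<times>Z. \<bar>c z w\<bar>)"
  have C: "c z w \<le> C" if "z \<in> Z" "w \<in> Z" for z w
    using member_le_sum[of "(z,w)" "Z \<times> Z" "\<lambda>(z,w). \<bar>c z w\<bar>"] Z(1) that unfolding C_def by auto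
  \<comment> \<open>Serves as both parameters: going from x to z to w to y takes 3 + C + 3 in the
    count and A D + C + A D in the length.\<close>
  define E where "E = 6 + 2 * (A * D) + C"
  have far: "chain_bound ?X E E x y" and E0: "0 \<le> E" if x: "x \<in> ?X" and y: "y \<in> ?X" for x y
  proof -
    obtain z w where z: "z \<in> Z" "dist z x < \<rho> z" and w: "w \<in> Z" "dist w y < \<rho> w"
    proof -
      have "x \<in> (\<Union>z\<in>Z. ball z (\<rho> z))" "y \<in> (\<Union>z\<in>Z. ball z (\<rho> z))" using x y Z(3) by blast+
      then show ?thesis using that by auto
    qed
    have "A * dist x z \<le> A * D"
      using A[OF z(1)] z D[OF z(1)] by (intro mult_left_mono) (auto simp: dist_commute)
    moreover have "K z * dist x z \<le> A * dist x z" using A z by (intro mult_right_mono) auto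
    ultimately have 1: "chain_bound ?X 3 (A * D) x z"
      using chain_bound_mono[OF K[of z x z], of 3 "A * D"] x z \<rho> Z(2) by auto
    have "A * dist w y \<le> A * D"
      using A[OF w(1)] w D[OF w(1)] by (intro mult_left_mono) auto
    moreover have "K w * dist w y \<le> A * dist w y" using A w by (intro mult_right_mono) auto
    ultimately have 2: "chain_bound ?X 3 (A * D) w y"
      using chain_bound_mono[OF K[of w w y], of 3 "A * D"] y w \<rho> Z(2) by auto
    have 3: "chain_bound ?X C C z w"
      using chain_bound_mono[OF c[OF z(1) w(1)] C[OF z(1) w(1)] C[OF z(1) w(1)]] .
    have AD: "0 \<le> A * D" using A z D[OF z(1)] \<rho>[of z] Z(2) by (intro mult_nonneg_nonneg) force+
    show "0 \<le> E" using AD C[OF z(1) w(1)] sum_nonneg[of "Z\<times>Z" "\<lambda>(z,w). \<bar>c z w\<bar>"]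
      unfolding E_def C_def by force
    from chain_bound_trans[OF 1 chain_bound_trans[OF 3 2]]
    show "chain_bound ?X E E x y"
      by (rule chain_bound_mono) (use AD in \<open>auto simp: E_def\<close>)
  qed
  define L where "L = 3 + \<bar>A\<bar> + E + E / \<delta>"
  show thesis
  proof (cases "?X = {}")
    case True
    then show ?thesis using that[of 1] by auto
  next
    case False
    then have "\<exists>x. x \<in> ?X" by (simp only: ex_in_conv not_False_eq_True)
    then have E: "0 \<le> E" by (elim exE) (rule E0)
    then have "0 \<le> E / \<delta>" using \<delta>(1) by simp
    then have L: "0 < L" "3 \<le> L" "A \<le> L" "E \<le> L" "E / \<delta> \<le> L" using E by (auto simp: L_def)
    show ?thesis
    proof (rule that[OF L(1)])
      fix x y assume x: "x \<in> ?X" and y: "y \<in> ?X"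
      show "chain_bound ?X L (L * dist x y) x y"
      proof (cases "dist x y < \<delta>")
        case True
        obtain z where z: "z \<in> Z" "ball x \<delta> \<subseteq> ball z (\<rho> z)" using \<delta>(2) x by auto
        moreover have "x \<in> ball x \<delta>" "y \<in> ball x \<delta>" using \<delta>(1) True by auto
        ultimately have "x \<in> ball z (\<rho> z)" "y \<in> ball z (\<rho> z)" by blast+
        then have "chain_bound ?X 3 (K z * dist x y) x y" using K x y z Z(2) by auto
        then show ?thesis
          by (rule chain_bound_mono) (use L A[OF z(1)] in \<open>auto intro!: mult_right_mono\<close>)
      next
        case False
        have "E = E / \<delta> * \<delta>" using \<delta>(1) by simp
        also have "\<dots> \<le> L * dist x y"
          using L \<open>0 \<le> E / \<delta>\<close> False \<delta>(1) by (intro mult_mono) auto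
        finally show ?thesis by (rule chain_bound_mono[OF far[OF x y] L(4)])
      qed
    qed
  qed
qed

section \<open>Approximate solutions of the discrete equation\<close>

lemma chain_increment_le:
  assumes "(seg_step X \<epsilon> ^^ N) x y"
    and "\<And>a b. seg_step X \<epsilon> a b \<Longrightarrow> u b - u a \<le> s"
  shows "u y - u x \<le> real N * s"
  using assms(1)
proof (induction N arbitrary: y)
  case (Suc N)
  then obtain w where "(seg_step X \<epsilon> ^^ N) x w" "seg_step X \<epsilon> w y" by auto
  then have "u w - u x \<le> real N * s" "u y - u w \<le> s" using Suc.IH assms(2) by auto
  then show ?case by (simp add: algebra_simps)
qed simp

lemma seg_step_imp_intrinsic_cball:
  "seg_step (closure \<Omega>) \<epsilon> a b \<Longrightarrow> a \<in> closure \<Omega> \<and> b \<in> intrinsic_cball \<Omega> a \<epsilon>"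
  unfolding seg_step_def by (auto intro: intrinsic_cball_segment)

text \<open>Since a lies in the ball around b, the infimum there is at most u a; the mean is at
  least u b - G, so the supremum is at least 2 (u b - G) - u a. Hence the next increment can lose at
  most 2 G. The \<eta> pays for a supremum that is not attained.\<close>

lemma steepest_step:
  assumes \<epsilon>: "0 \<le> \<epsilon>" and u: "bounded (u ` closure \<Omega>)" and a: "a \<in> closure \<Omega>"
    and b: "b \<in> intrinsic_cball \<Omega> a \<epsilon>" and G: "u b - tug \<Omega> \<epsilon> u b \<le> G" and \<eta>: "0 < \<eta>"
  obtains c where "c \<in> intrinsic_cball \<Omega> b \<epsilon>" "u b - u a - (2 * G + \<eta>) \<le> u c - u b"
proof -
  let ?B = "intrinsic_cball \<Omega> b \<epsilon>"
  have bX: "b \<in> closure \<Omega>" using b by (simp add: intrinsic_cball_def)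
  have "(INF y\<in>?B. u y) \<le> u a"
    using bdd_intrinsic_cball[OF bX \<epsilon> u] intrinsic_cball_commute[OF b a] by (intro cINF_lower)
  moreover have "2 * tug \<Omega> \<epsilon> u b = (INF y\<in>?B. u y) + (SUP y\<in>?B. u y)" by (simp add: tug_def)
  ultimately have "2 * u b - 2 * G - u a - \<eta> < (SUP y\<in>?B. u y)" using G \<eta> by linarith
  then obtain c where "c \<in> ?B" "2 * u b - 2 * G - u a - \<eta> < u c"
    using less_cSUP_iff[OF intrinsic_cball_nonempty[OF bX \<epsilon>] bdd_intrinsic_cball(1)[OF bX \<epsilon> u]] by blast
  then show ?thesis by (intro that[of c]) auto
qed

text \<open>The last increment and the total rise are carried through the induction together:
  increments fall at most arithmetically, and the second bound is the sum of that progression over n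
  + 1 steps.\<close>

lemma steepest_path:
  fixes n :: nat
  assumes \<epsilon>: "0 \<le> \<epsilon>" and u: "bounded (u ` closure \<Omega>)"
    and G: "\<And>x. x \<in> closure \<Omega> \<Longrightarrow> u x - tug \<Omega> \<epsilon> u x \<le> G" and \<eta>: "0 < \<eta>"
    and x: "x \<in> closure \<Omega>" and y: "y \<in> intrinsic_cball \<Omega> x \<epsilon>" and s: "s \<le> u y - u x"
  shows "\<exists>a\<in>closure \<Omega>. \<exists>b\<in>intrinsic_cball \<Omega> a \<epsilon>.
    s - real n * (2 * G + \<eta>) \<le> u b - u a \<and>
    (real n + 1) * s - (real n * (real n + 1) / 2) * (2 * G + \<eta>) \<le> u b - u x"
proof (induction n)
  case 0
  then show ?case using x y s by (intro bexI[of _ x] bexI[of _ y]) auto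
next
  case (Suc n)
  then obtain a b where ab: "a \<in> closure \<Omega>" "b \<in> intrinsic_cball \<Omega> a \<epsilon>"
    "s - real n * (2 * G + \<eta>) \<le> u b - u a"
    "(real n + 1) * s - (real n * (real n + 1) / 2) * (2 * G + \<eta>) \<le> u b - u x" by auto
  have bX: "b \<in> closure \<Omega>" using ab by (simp add: intrinsic_cball_def)
  obtain c where c: "c \<in> intrinsic_cball \<Omega> b \<epsilon>" "u b - u a - (2 * G + \<eta>) \<le> u c - u b"
    by (rule steepest_step[OF \<epsilon> u ab(1,2) G[OF bX] \<eta>])
  define h where "h = 2 * G + \<eta>"
  have 1: "s - real (Suc n) * h \<le> u c - u b"
    using ab(3) c(2) unfolding h_def[symmetric] by (simp add: algebra_simps)
  have "(real (Suc n) + 1) * s - (real (Suc n) * (real (Suc n) + 1) / 2) * h =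
      ((real n + 1) * s - (real n * (real n + 1) / 2) * h) + (s - real (Suc n) * h)"
    by (simp add: field_simps)
  also have "\<dots> \<le> (u b - u x) + (u c - u b)"
    using ab(4) 1 unfolding h_def[symmetric] by linarith
  finally show ?case using bX c(1) 1 unfolding h_def by (intro bexI[of _ b] bexI[of _ c]) auto
qed

text \<open>Following steepest steps from a nearly maximal step \<open>s\<close>, the increments decrease by at most about
  \<open>2 * G\<close> per step, while \<open>2 * M\<close> of them cannot add up to more than the oscillation \<open>M * s\<close>.\<close>
lemma step_bound:
  assumes \<epsilon>: "0 \<le> \<epsilon>" and u: "bounded (u ` closure \<Omega>)"
    and G': "\<And>x. x \<in> closure \<Omega> \<Longrightarrow> \<bar>u x - tug \<Omega> \<epsilon> u x\<bar> \<le> G"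
    and M: "\<And>x y. x \<in> closure \<Omega> \<Longrightarrow> y \<in> closure \<Omega> \<Longrightarrow> \<exists>N\<le>M. (seg_step (closure \<Omega>) \<epsilon> ^^ N) x y"
      "0 < M"
    and x: "x \<in> closure \<Omega>" and y: "y \<in> intrinsic_cball \<Omega> x \<epsilon>"
  shows "u y - u x \<le> 4 * real M * G"
proof -
  let ?X = "closure \<Omega>" and ?B = "\<lambda>x. intrinsic_cball \<Omega> x \<epsilon>"
  define D where "D = (\<lambda>(a, b). u b - u a) ` (SIGMA a:?X. ?B a)"
  define S where "S = Sup D"
  obtain C where C: "\<And>x. x \<in> ?X \<Longrightarrow> \<bar>u x\<bar> \<le> C" using u by (auto simp: bounded_iff)
  have B: "?B a \<subseteq> ?X" for a by (auto simp: intrinsic_cball_def)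
  have bdd: "bdd_above D"
  proof (rule bdd_aboveI)
    fix d assume "d \<in> D"
    then obtain a b where "a \<in> ?X" "b \<in> ?B a" "d = u b - u a" unfolding D_def by auto
    then show "d \<le> 2 * C" using C[of a] C[of b] B by fastforce
  qed
  have step: "u b - u a \<le> S" if "a \<in> ?X" "b \<in> ?B a" for a b
    unfolding S_def by (rule cSup_upper[OF _ bdd]) (use that in \<open>force simp: D_def\<close>)
  have G: "u x - tug \<Omega> \<epsilon> u x \<le> G" if "x \<in> ?X" for x using G'[OF that] by linarith
  have G0: "0 \<le> G" using G'[OF x] by linarith
  have S0: "0 \<le> S" using step[OF x intrinsic_cball_self[OF x \<epsilon>]] by simp
  have osc: "u b - u a \<le> real M * S" if ab: "a \<in> ?X" "b \<in> ?X" for a b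
  proof -
    obtain N where N: "N \<le> M" "(seg_step ?X \<epsilon> ^^ N) a b" using M(1)[OF ab] by blast
    have "u b - u a \<le> real N * S"
      by (rule chain_increment_le[OF N(2)]) (use step seg_step_imp_intrinsic_cball in blast)
    also have "\<dots> \<le> real M * S" using N(1) S0 by (intro mult_right_mono) auto
    finally show ?thesis .
  qed
  have "D \<noteq> {}" using x y unfolding D_def by auto
  have bound: "S \<le> 4 * real M * G + (2 * real M + 1) * \<eta>" if \<eta>: "0 < \<eta>" for \<eta>
  proof -
    obtain d where "d \<in> D" "S - \<eta> < d"
      using less_cSup_iff[OF \<open>D \<noteq> {}\<close> bdd, of "S - \<eta>"] \<eta> unfolding S_def by auto
    then obtain a b where ab: "a \<in> ?X" "b \<in> ?B a" "S - \<eta> \<le> u b - u a"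
      unfolding D_def by auto
    \<comment> \<open>This makes 2 M steps. The oscillation bound M S absorbs half of the leading
      term 2 M S, and dividing by M leaves S \<le> 2 (2 M - 1) G up to multiples of \<eta>.\<close>
    define n where "n = 2 * M - 1"
    have n: "real n = 2 * real M - 1" using M(2) by (simp add: n_def of_nat_diff)
    obtain a' b' where ab': "a' \<in> ?X" "b' \<in> ?B a'"
      "(real n + 1) * (S - \<eta>) - (real n * (real n + 1) / 2) * (2 * G + \<eta>) \<le> u b' - u a"
      using steepest_path[OF \<epsilon> u G \<eta> ab, of n] by blast
    have "u b' - u a \<le> real M * S" using osc ab(1) ab' B by blast
    then have "2 * real M * (S - \<eta>) - (2 * real M - 1) * real M * (2 * G + \<eta>) \<le> real M * S"
      using ab'(3) unfolding n by simp
    then have "real M * S \<le> real M * (2 * \<eta> + (2 * real M - 1) * (2 * G + \<eta>))"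
      by (simp add: algebra_simps)
    then have "S \<le> 2 * \<eta> + (2 * real M - 1) * (2 * G + \<eta>)" using M(2) by simp
    also have "\<dots> = 4 * real M * G - 2 * G + (2 * real M + 1) * \<eta>" by (simp add: algebra_simps)
    finally show ?thesis using G0 by simp
  qed
  have "S \<le> 4 * real M * G"
  proof (rule field_le_epsilon)
    fix e :: real assume e: "0 < e"
    have "0 < 2 * real M + 1" by simp
    then show "S \<le> 4 * real M * G + e" using bound[of "e / (2 * real M + 1)"] e by simp
  qed
  then show ?thesis using step[OF x y] by linarith
qed

section \<open>The discounted game\<close>

primrec discounted_iter ::
  "'a::euclidean_space set \<Rightarrow> ('a \<Rightarrow> real) \<Rightarrow> real \<Rightarrow> real \<Rightarrow> nat \<Rightarrow> 'a \<Rightarrow> real" where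
  "discounted_iter \<Omega> f \<epsilon> \<delta> 0 = (\<lambda>x. 0)"
| "discounted_iter \<Omega> f \<epsilon> \<delta> (Suc n) =
    (\<lambda>x. (1 - \<delta>) * tug \<Omega> \<epsilon> (discounted_iter \<Omega> f \<epsilon> \<delta> n) x + f x)"

lemma bounded_imageI: "(\<And>x. x \<in> A \<Longrightarrow> \<bar>u x\<bar> \<le> c) \<Longrightarrow> bounded ((u :: _ \<Rightarrow> real) ` A)"
  by (auto simp: bounded_iff)

lemma abs_tug_le:
  assumes \<epsilon>: "0 \<le> \<epsilon>" and x: "x \<in> closure \<Omega>"
    and le: "\<And>y. y \<in> closure \<Omega> \<Longrightarrow> \<bar>u y\<bar> \<le> c"
  shows "\<bar>tug \<Omega> \<epsilon> u x\<bar> \<le> c"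
proof -
  have u: "bounded (u ` closure \<Omega>)" using le by (rule bounded_imageI)
  have "tug \<Omega> \<epsilon> u x \<le> c"
    by (rule tug_le[OF x \<epsilon> u]) (use le in fastforce)
  moreover have "- c \<le> tug \<Omega> \<epsilon> u x"
    by (rule tug_ge[OF x \<epsilon> u]) (use le in fastforce)
  ultimately show ?thesis by simp
qed

lemma abs_tug_diff_le:
  assumes \<epsilon>: "0 \<le> \<epsilon>" and x: "x \<in> closure \<Omega>"
    and u: "bounded (u ` closure \<Omega>)" and w: "bounded (w ` closure \<Omega>)"
    and le: "\<And>y. y \<in> closure \<Omega> \<Longrightarrow> \<bar>u y - w y\<bar> \<le> c"
  shows "\<bar>tug \<Omega> \<epsilon> u x - tug \<Omega> \<epsilon> w x\<bar> \<le> c"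
proof -
  have "tug \<Omega> \<epsilon> u x \<le> tug \<Omega> \<epsilon> w x + c"
  proof (rule tug_le_add[OF x \<epsilon> u w])
    fix y assume "y \<in> intrinsic_cball \<Omega> x \<epsilon>"
    then show "u y \<le> w y + c" using le[of y] by (simp add: intrinsic_cball_def abs_le_iff)
  qed
  moreover have "tug \<Omega> \<epsilon> w x \<le> tug \<Omega> \<epsilon> u x + c"
  proof (rule tug_le_add[OF x \<epsilon> w u])
    fix y assume "y \<in> intrinsic_cball \<Omega> x \<epsilon>"
    then show "w y \<le> u y + c" using le[of y] by (simp add: intrinsic_cball_def abs_le_iff)
  qed
  ultimately show ?thesis by simp
qed

lemma nonpos_if_multiples_bounded:
  assumes "\<And>n::nat. real n * t \<le> (c::real)"
  shows "t \<le> 0"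
proof (rule ccontr)
  assume "\<not> t \<le> 0"
  then obtain n where "c < real n * t" using reals_Archimedean3[of t] by auto
  then show False using assms[of n] by simp
qed

context
  fixes \<Omega> :: "'a::euclidean_space set" and f :: "'a \<Rightarrow> real" and \<epsilon> F :: real
  assumes \<epsilon>: "0 \<le> \<epsilon>" and F: "\<And>x. x \<in> closure \<Omega> \<Longrightarrow> \<bar>f x\<bar> \<le> F"
begin

text \<open>F / \<delta> is the fixed point of the map taking t to (1 - \<delta>) t + F.\<close>

lemma discounted_iter_bound:
  assumes \<delta>: "0 < \<delta>" "\<delta> < 1" and x: "x \<in> closure \<Omega>"
  shows "\<bar>discounted_iter \<Omega> f \<epsilon> \<delta> n x\<bar> \<le> F / \<delta>"
  using x
proof (induction n arbitrary: x)
  case 0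
  then show ?case using F[of x] \<delta> by simp
next
  case (Suc n)
  let ?t = "tug \<Omega> \<epsilon> (discounted_iter \<Omega> f \<epsilon> \<delta> n) x"
  have "\<bar>?t\<bar> \<le> F / \<delta>" using Suc by (intro abs_tug_le \<epsilon>) auto
  then have "\<bar>(1 - \<delta>) * ?t\<bar> \<le> (1 - \<delta>) * (F / \<delta>)"
    using \<delta> by (simp only: abs_mult) (intro mult_mono, auto)
  then have "\<bar>(1 - \<delta>) * ?t + f x\<bar> \<le> (1 - \<delta>) * (F / \<delta>) + F" using F[OF Suc.prems] by linarith
  also have "\<dots> = F / \<delta>" using \<delta> by (simp add: field_simps)
  finally show ?case by simp
qed

text \<open>The discount turns a nonexpansive operator into a contraction with factor 1 - \<delta>.
  A single late iterate can then replace the fixed point, and no limit of functions has to be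
  taken.\<close>

lemma discounted_iter_diff:
  assumes \<delta>: "0 < \<delta>" "\<delta> < 1" and x: "x \<in> closure \<Omega>"
  shows "\<bar>discounted_iter \<Omega> f \<epsilon> \<delta> (Suc n) x - discounted_iter \<Omega> f \<epsilon> \<delta> n x\<bar> \<le> (1 - \<delta>) ^ n * F"
  using x
proof (induction n arbitrary: x)
  case 0
  then show ?case using F[of x] by (simp add: tug_const[OF 0 \<epsilon>])
next
  case (Suc n)
  let ?v = "discounted_iter \<Omega> f \<epsilon> \<delta>"
  have b: "bounded (?v k ` closure \<Omega>)" for k
    using discounted_iter_bound[OF \<delta>] by (rule bounded_imageI)
  have "\<bar>tug \<Omega> \<epsilon> (?v (Suc n)) x - tug \<Omega> \<epsilon> (?v n) x\<bar> \<le> (1 - \<delta>) ^ n * F"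
    by (rule abs_tug_diff_le[OF \<epsilon> Suc.prems b b Suc.IH])
  moreover have "?v (Suc (Suc n)) x - ?v (Suc n) x = (1 - \<delta>) * (tug \<Omega> \<epsilon> (?v (Suc n)) x - tug \<Omega> \<epsilon> (?v n) x)"
    by (simp add: algebra_simps)
  ultimately show ?case
    using \<delta> by (simp only: abs_mult power_Suc mult.assoc) (intro mult_mono, auto)
qed

text \<open>For a late iterate v, \<open>v - T v\<close> is close to f - \<delta> T v, and |\<delta>
  T v| \<le> F whatever \<delta> is; so \<open>step_bound\<close> yields an oscillation bound C free
  of \<delta>. With m the infimum of v, \<delta> T v differs from the constant \<delta> m by at most
  \<delta> C. This constant is a.\<close>

lemma approx_corrector:
  assumes M: "\<And>x y. x \<in> closure \<Omega> \<Longrightarrow> y \<in> closure \<Omega> \<Longrightarrow> \<exists>N\<le>M. (seg_step (closure \<Omega>) \<epsilon> ^^ N) x y"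
      "0 < M"
    and \<theta>: "0 < \<theta>" and ne: "closure \<Omega> \<noteq> {}"
  obtains u a where
    "\<And>x. x \<in> closure \<Omega> \<Longrightarrow> 0 \<le> u x \<and> u x \<le> 12 * (real M)\<^sup>2 * F"
    "\<And>x. x \<in> closure \<Omega> \<Longrightarrow> \<bar>u x - tug \<Omega> \<epsilon> u x\<bar> \<le> 3 * F"
    "\<And>x. x \<in> closure \<Omega> \<Longrightarrow> \<bar>u x - tug \<Omega> \<epsilon> u x - f x + a\<bar> \<le> \<theta>"
proof -
  let ?X = "closure \<Omega>"
  define C where "C = 12 * (real M)\<^sup>2 * F"
  obtain x0 where "x0 \<in> ?X" using ne by (auto simp only: ex_in_conv[symmetric])
  then have F0: "0 \<le> F" using F[of x0] by linarith
  then have C0: "0 \<le> C" by (simp add: C_def)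
  \<comment> \<open>Gives \<delta> C \<le> \<theta> / 2; the other half of \<theta> goes to the
    iteration error through the choice of n.\<close>
  define \<delta> where "\<delta> = min (1/2) (\<theta> / (2 * (C + 1)))"
  have \<delta>: "0 < \<delta>" "\<delta> < 1" using \<theta> C0 by (auto simp: \<delta>_def)
  have "\<delta> * C \<le> \<theta> / (2 * (C + 1)) * C" using C0 by (intro mult_right_mono) (auto simp: \<delta>_def)
  also have "\<dots> \<le> \<theta> / 2" using C0 \<theta> by (simp add: field_simps)
  finally have \<delta>C: "\<delta> * C \<le> \<theta> / 2" .
  have "(\<lambda>n. (1 - \<delta>) ^ n * F) \<longlonglongrightarrow> 0 * F"
    using \<delta> by (intro tendsto_intros LIMSEQ_power_zero) auto
  then have "\<forall>\<^sub>F n in sequentially. (1 - \<delta>) ^ n * F < \<theta> / 2"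
    using \<theta> by (intro order_tendstoD(2)) auto
  then obtain n where n: "(1 - \<delta>) ^ n * F < \<theta> / 2" by (auto simp: eventually_sequentially)
  define v where "v = discounted_iter \<Omega> f \<epsilon> \<delta> n"
  define T where "T = tug \<Omega> \<epsilon> v"
  have vb: "\<bar>v x\<bar> \<le> F / \<delta>" if "x \<in> ?X" for x
    unfolding v_def by (rule discounted_iter_bound[OF \<delta> that])
  then have v: "bounded (v ` ?X)" by (rule bounded_imageI)
  have d: "\<bar>(1 - \<delta>) * T x + f x - v x\<bar> \<le> (1 - \<delta>) ^ n * F" if "x \<in> ?X" for x
    using discounted_iter_diff[OF \<delta> that, of n] by (simp add: v_def T_def)
  \<comment> \<open>The three summands F bound f, \<delta> T v and the error of the iterate.\<close>
  have vT: "\<bar>v x - T x\<bar> \<le> 3 * F" if x: "x \<in> ?X" for x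
  proof -
    have "\<bar>T x\<bar> \<le> F / \<delta>" unfolding T_def by (rule abs_tug_le[OF \<epsilon> x vb])
    then have "\<delta> * \<bar>T x\<bar> \<le> F" using \<delta> by (simp add: field_simps)
    then have "\<bar>\<delta> * T x\<bar> \<le> F" using \<delta> by (simp add: abs_mult)
    moreover have "(1 - \<delta>) ^ n * F \<le> 1 * F"
      using \<delta> F0 by (intro mult_right_mono power_le_one) auto
    ultimately show ?thesis using d[OF x] F[OF x] by (simp add: algebra_simps abs_le_iff)
  qed
  have osc: "v y - v x \<le> C" if xy: "x \<in> ?X" "y \<in> ?X" for x y
  proof -
    obtain N where N: "N \<le> M" "(seg_step ?X \<epsilon> ^^ N) x y" using M(1)[OF xy] by blast
    have "v y - v x \<le> real N * (4 * real M * (3 * F))"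
    proof (rule chain_increment_le[OF N(2)])
      fix a b assume "seg_step ?X \<epsilon> a b"
      then have "a \<in> ?X" "b \<in> intrinsic_cball \<Omega> a \<epsilon>" using seg_step_imp_intrinsic_cball by blast+
      then show "v b - v a \<le> 4 * real M * (3 * F)"
        using step_bound[OF \<epsilon> v _ M] vT unfolding T_def by blast
    qed
    also have "\<dots> \<le> real M * (4 * real M * (3 * F))" using N(1) F0 by (intro mult_right_mono) auto
    also have "\<dots> = C" by (simp add: C_def power2_eq_square)
    finally show ?thesis .
  qed
  define m where "m = (INF x\<in>?X. v x)"
  have m: "m \<le> v x" if "x \<in> ?X" for x
    unfolding m_def using v that by (intro cINF_lower bounded_imp_bdd_below)
  have m': "v x \<le> m + C" if "x \<in> ?X" for x
  proof -
    have "v x - C \<le> m" unfolding m_def using osc[OF _ that] by (intro cINF_greatest[OF ne]) (auto simp: algebra_simps)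
    then show ?thesis by simp
  qed
  have T: "tug \<Omega> \<epsilon> (\<lambda>y. v y - m) x = T x - m" if "x \<in> ?X" for x
    using tug_affine[OF that \<epsilon> v, of 1 "- m"] by (simp add: T_def)
  show thesis
  proof (rule that[of "\<lambda>y. v y - m" "\<delta> * m"])
    fix x assume x: "x \<in> ?X"
    show "0 \<le> v x - m \<and> v x - m \<le> 12 * (real M)\<^sup>2 * F"
      using m[OF x] m'[OF x] unfolding C_def by linarith
    show "\<bar>v x - m - tug \<Omega> \<epsilon> (\<lambda>y. v y - m) x\<bar> \<le> 3 * F"
      unfolding T[OF x] using vT[OF x] by simp
    have "m \<le> T x" "T x \<le> m + C"
      unfolding T_def using x \<epsilon> v m m' by (auto intro: tug_le tug_ge)
    then have "\<bar>T x - m\<bar> \<le> C" by linarith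
    then have "\<delta> * \<bar>T x - m\<bar> \<le> \<delta> * C" using \<delta> by (intro mult_left_mono) auto
    then have "\<delta> * \<bar>T x - m\<bar> \<le> \<theta> / 2" using \<delta>C by linarith
    then have "\<bar>\<delta> * (T x - m)\<bar> \<le> \<theta> / 2" using \<delta> by (simp add: abs_mult)
    moreover have "v x - T x - f x + \<delta> * m = - (((1 - \<delta>) * T x + f x - v x) + \<delta> * (T x - m))"
      by (simp add: algebra_simps)
    ultimately have "\<bar>v x - T x - f x + \<delta> * m\<bar> \<le> \<theta>"
      using d[OF x] n by linarith
    then show "\<bar>v x - m - tug \<Omega> \<epsilon> (\<lambda>y. v y - m) x - f x + \<delta> * m\<bar> \<le> \<theta>"
      unfolding T[OF x] by (simp add: algebra_simps)
  qed
qed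

section \<open>Value iteration and its growth rate\<close>

lemma value_iter_bounded:
  assumes "bounded (w ` closure \<Omega>)"
  shows "bounded (value_iter \<Omega> f \<epsilon> w n ` closure \<Omega>)"
proof (induction n)
  case (Suc n)
  then obtain c where c: "\<And>x. x \<in> closure \<Omega> \<Longrightarrow> \<bar>value_iter \<Omega> f \<epsilon> w n x\<bar> \<le> c"
    by (auto simp: bounded_iff)
  show ?case
  proof (rule bounded_imageI)
    fix x assume x: "x \<in> closure \<Omega>"
    show "\<bar>value_iter \<Omega> f \<epsilon> w (Suc n) x\<bar> \<le> c + F"
      unfolding value_iter_Suc_tug
      using abs_tug_le[OF \<epsilon> x, of "value_iter \<Omega> f \<epsilon> w n" c] c F[OF x] by (simp add: abs_le_iff)
  qed
qed (use assms in simp)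

text \<open>The functions u + n a satisfy the recursion up to \<theta> in each round, and
  \<open>tug\<close> does not expand distances, so the errors merely add up.\<close>

lemma value_iter_near_corrector:
  assumes w: "bounded (w ` closure \<Omega>)" and u: "bounded (u ` closure \<Omega>)"
    and D: "\<And>x. x \<in> closure \<Omega> \<Longrightarrow> \<bar>w x - u x\<bar> \<le> D"
    and \<theta>: "\<And>x. x \<in> closure \<Omega> \<Longrightarrow> \<bar>u x - tug \<Omega> \<epsilon> u x - f x + a\<bar> \<le> \<theta>"
    and x: "x \<in> closure \<Omega>"
  shows "\<bar>value_iter \<Omega> f \<epsilon> w n x - (u x + real n * a)\<bar> \<le> D + real n * \<theta>"
  using x
proof (induction n arbitrary: x)
  case 0
  then show ?case using D by simp
next
  case (Suc n)
  have na: "tug \<Omega> \<epsilon> (\<lambda>y. 1 * u y + real n * a) x = tug \<Omega> \<epsilon> u x + real n * a"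
    using tug_affine[OF Suc.prems \<epsilon> u, of 1 "real n * a"] by simp
  have bb: "bounded ((\<lambda>y. 1 * u y + real n * a) ` closure \<Omega>)"
    using bounded_translation[OF u, of "real n * a"] by (simp add: image_image add.commute)
  have "\<bar>tug \<Omega> \<epsilon> (value_iter \<Omega> f \<epsilon> w n) x - tug \<Omega> \<epsilon> (\<lambda>y. 1 * u y + real n * a) x\<bar> \<le> D + real n * \<theta>"
    using Suc.IH by (intro abs_tug_diff_le[OF \<epsilon> Suc.prems value_iter_bounded[OF w] bb]) simp
  then show ?case
    unfolding value_iter_Suc_tug using \<theta>[OF Suc.prems] unfolding na
    by (simp add: algebra_simps abs_le_iff)
qed

text \<open>Two approximate correctors follow the same iteration for n rounds, so n |a - a'| is at
  most n (\<theta> + \<theta>') plus a constant. Hence the numbers a converge as \<theta> tends to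
  0, and their limit has the property that defines \<open>c_const\<close>. It is essential that C
  does not depend on \<theta>.\<close>

lemma c_const_near_corrector:
  assumes comp: "compact (closure \<Omega>)" and ne: "closure \<Omega> \<noteq> {}"
    and C: "\<And>\<theta>. 0 < \<theta> \<Longrightarrow> \<exists>u a. (\<forall>x\<in>closure \<Omega>. \<bar>u x\<bar> \<le> C \<and> \<bar>u x - tug \<Omega> \<epsilon> u x - f x + a\<bar> \<le> \<theta>)"
    and u: "bounded (u ` closure \<Omega>)"
    and \<theta>: "\<And>x. x \<in> closure \<Omega> \<Longrightarrow> \<bar>u x - tug \<Omega> \<epsilon> u x - f x + a\<bar> \<le> \<theta>"
  shows "\<bar>c_const \<Omega> f \<epsilon> - a\<bar> \<le> \<theta>"
proof -
  let ?X = "closure \<Omega>"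
  obtain x0 where x0: "x0 \<in> ?X" using ne by (auto simp only: ex_in_conv[symmetric])
  have cmp: "\<bar>a - a'\<bar> \<le> \<theta> + \<theta>'"
    if u: "bounded (u ` ?X)" "\<And>x. x \<in> ?X \<Longrightarrow> \<bar>u x - tug \<Omega> \<epsilon> u x - f x + a\<bar> \<le> \<theta>"
      and u': "bounded (u' ` ?X)" "\<And>x. x \<in> ?X \<Longrightarrow> \<bar>u' x - tug \<Omega> \<epsilon> u' x - f x + a'\<bar> \<le> \<theta>'"
    for u u' a a' \<theta> \<theta>'
  proof -
    obtain D where D: "\<And>x. x \<in> ?X \<Longrightarrow> \<bar>0 - u x\<bar> \<le> D" using u(1) by (auto simp: bounded_iff)
    obtain D' where D': "\<And>x. x \<in> ?X \<Longrightarrow> \<bar>0 - u' x\<bar> \<le> D'" using u'(1) by (auto simp: bounded_iff)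
    have z: "bounded ((\<lambda>_. 0 :: real) ` ?X)" by (rule bounded_imageI[of _ _ 0]) simp
    have "real n * (\<bar>a - a'\<bar> - (\<theta> + \<theta>')) \<le> 2 * D + 2 * D'" for n
    proof -
      let ?w = "value_iter \<Omega> f \<epsilon> (\<lambda>_. 0) n x0"
      have 1: "\<bar>?w - (u x0 + real n * a)\<bar> \<le> D + real n * \<theta>"
        by (rule value_iter_near_corrector[OF z u(1) D u(2) x0])
      have 2: "\<bar>?w - (u' x0 + real n * a')\<bar> \<le> D' + real n * \<theta>'"
        by (rule value_iter_near_corrector[OF z u'(1) D' u'(2) x0])
      have "\<bar>real n * a - real n * a'\<bar> \<le> 2 * D + 2 * D' + real n * \<theta> + real n * \<theta>'"
        using 1 2 D[OF x0] D'[OF x0] by linarith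
      moreover have "\<bar>real n * a - real n * a'\<bar> = real n * \<bar>a - a'\<bar>"
        by (simp add: right_diff_distrib[symmetric] abs_mult)
      ultimately show ?thesis by (simp add: algebra_simps)
    qed
    then show ?thesis using nonpos_if_multiples_bounded by force
  qed
  have "\<forall>k. \<exists>u a. \<forall>x\<in>?X. \<bar>u x\<bar> \<le> C \<and> \<bar>u x - tug \<Omega> \<epsilon> u x - f x + a\<bar> \<le> 1 / real (Suc k)"
    using C by simp
  then obtain U A where UA: "\<And>k x. x \<in> ?X \<Longrightarrow> \<bar>U k x\<bar> \<le> C"
      "\<And>k x. x \<in> ?X \<Longrightarrow> \<bar>U k x - tug \<Omega> \<epsilon> (U k) x - f x + A k\<bar> \<le> 1 / real (Suc k)"
    by metis
  have Ub: "bounded (U k ` ?X)" for k using UA(1) by (rule bounded_imageI)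
  have inv0: "(\<lambda>k. 1 / real (Suc k)) \<longlonglongrightarrow> 0" by (rule LIMSEQ_Suc[OF lim_1_over_n])
  have AA: "\<bar>A k - A j\<bar> \<le> 1 / real (Suc k) + 1 / real (Suc j)" for k j
    by (rule cmp[OF Ub UA(2) Ub UA(2)])
  have "Cauchy A"
  proof (rule metric_CauchyI)
    fix e :: real assume "0 < e"
    then obtain N where N: "\<And>k. k \<ge> N \<Longrightarrow> 1 / real (Suc k) < e / 2"
      using order_tendstoD(2)[OF inv0, of "e / 2"] by (auto simp: eventually_sequentially)
    have "dist (A k) (A j) < e" if "k \<ge> N" "j \<ge> N" for k j
      using AA[of k j] N[OF that(1)] N[OF that(2)] by (simp add: dist_real_def)
    then show "\<exists>N. \<forall>k\<ge>N. \<forall>j\<ge>N. dist (A k) (A j) < e" by blast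
  qed
  then obtain c where c: "A \<longlonglongrightarrow> c" using Cauchy_convergent convergent_def by blast
  have near: "\<bar>a - c\<bar> \<le> \<theta>" if "bounded (u ` ?X)" "\<And>x. x \<in> ?X \<Longrightarrow> \<bar>u x - tug \<Omega> \<epsilon> u x - f x + a\<bar> \<le> \<theta>" for u a \<theta>
  proof (rule LIMSEQ_le)
    show "(\<lambda>k. \<bar>a - A k\<bar>) \<longlonglongrightarrow> \<bar>a - c\<bar>" by (intro tendsto_intros c)
    show "(\<lambda>k. \<theta> + 1 / real (Suc k)) \<longlonglongrightarrow> \<theta>" using tendsto_add[OF tendsto_const inv0, of \<theta>] by simp
    show "\<exists>N. \<forall>k\<ge>N. \<bar>a - A k\<bar> \<le> \<theta> + 1 / real (Suc k)"
      using cmp[OF that Ub UA(2)] by blast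
  qed
  \<comment> \<open>With n fixed, k tends to infinity; this removes the error that grows with n and
    leaves a bound free of n.\<close>
  have growth: "\<exists>K. \<forall>n. \<forall>x\<in>?X. \<bar>value_iter \<Omega> f \<epsilon> w n x - real n * c\<bar> \<le> K"
    if w: "continuous_on ?X w" for w
  proof -
    have wb: "bounded (w ` ?X)" using w comp by (intro compact_imp_bounded compact_continuous_image)
    then obtain W where W: "\<And>x. x \<in> ?X \<Longrightarrow> \<bar>w x\<bar> \<le> W" by (auto simp: bounded_iff)
    have "\<bar>value_iter \<Omega> f \<epsilon> w n x - real n * c\<bar> \<le> W + 2 * C" if x: "x \<in> ?X" for n x
    proof (rule LIMSEQ_le_const)
      show "(\<lambda>k. (W + 2 * C) + 2 * real n * (1 / real (Suc k))) \<longlonglongrightarrow> W + 2 * C"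
        using tendsto_add[OF tendsto_const tendsto_mult[OF tendsto_const inv0], of "W + 2 * C" "2 * real n"] by simp
      have "\<bar>value_iter \<Omega> f \<epsilon> w n x - real n * c\<bar> \<le> (W + 2 * C) + 2 * real n * (1 / real (Suc k))" for k
      proof -
        have 1: "\<bar>value_iter \<Omega> f \<epsilon> w n x - (U k x + real n * A k)\<bar> \<le> (W + C) + real n * (1 / real (Suc k))"
        proof (rule value_iter_near_corrector[OF wb Ub _ UA(2) x])
          fix y assume "y \<in> ?X"
          then show "\<bar>w y - U k y\<bar> \<le> W + C" using W[of y] UA(1)[of y k] by linarith
        qed
        have "\<bar>A k - c\<bar> \<le> 1 / real (Suc k)" by (rule near[OF Ub UA(2)])
        then have "real n * \<bar>A k - c\<bar> \<le> real n * (1 / real (Suc k))"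
          by (rule mult_left_mono) simp
        then have "\<bar>real n * A k - real n * c\<bar> \<le> real n * (1 / real (Suc k))"
          by (simp add: right_diff_distrib[symmetric] abs_mult)
        with 1 UA(1)[OF x, of k] have "\<bar>value_iter \<Omega> f \<epsilon> w n x - real n * c\<bar>
            \<le> (W + 2 * C) + real n * (1 / real (Suc k)) + real n * (1 / real (Suc k))"
          by linarith
        then show ?thesis by linarith
      qed
      then show "\<exists>N. \<forall>k\<ge>N. \<bar>value_iter \<Omega> f \<epsilon> w n x - real n * c\<bar> \<le> (W + 2 * C) + 2 * real n * (1 / real (Suc k))"
        by blast
    qed
    then show ?thesis by blast
  qed
  \<comment> \<open>The definite description also needs uniqueness; the initial function 0 is enough
    to tell two constants apart.\<close>
  have "c_const \<Omega> f \<epsilon> = c"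
    unfolding c_const_def
  proof (rule the_equality)
    show "\<forall>w. continuous_on ?X w \<longrightarrow> (\<exists>K. \<forall>n. \<forall>x\<in>?X. \<bar>value_iter \<Omega> f \<epsilon> w n x - real n * c\<bar> \<le> K)"
      using growth by blast
    fix c' assume "\<forall>w. continuous_on ?X w \<longrightarrow> (\<exists>K. \<forall>n. \<forall>x\<in>?X. \<bar>value_iter \<Omega> f \<epsilon> w n x - real n * c'\<bar> \<le> K)"
    then obtain K where K: "\<And>n x. x \<in> ?X \<Longrightarrow> \<bar>value_iter \<Omega> f \<epsilon> (\<lambda>_. 0) n x - real n * c'\<bar> \<le> K"
      using continuous_on_const[of ?X "0 :: real"] by blast
    obtain K' where K': "\<And>n x. x \<in> ?X \<Longrightarrow> \<bar>value_iter \<Omega> f \<epsilon> (\<lambda>_. 0) n x - real n * c\<bar> \<le> K'"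
      using growth[OF continuous_on_const] by blast
    have "real n * \<bar>c' - c\<bar> \<le> K + K'" for n
    proof -
      have "\<bar>real n * c' - real n * c\<bar> \<le> K + K'" using K[OF x0, of n] K'[OF x0, of n] by linarith
      then show ?thesis by (simp add: right_diff_distrib[symmetric] abs_mult)
    qed
    then have "\<bar>c' - c\<bar> \<le> 0" by (rule nonpos_if_multiples_bounded)
    then show "c' = c" by simp
  qed
  then show ?thesis using near[OF u \<theta>] by (simp add: abs_minus_commute)
qed

lemma game_solution:
  assumes comp: "compact (closure \<Omega>)" and ne: "closure \<Omega> \<noteq> {}"
    and M: "\<And>x y. x \<in> closure \<Omega> \<Longrightarrow> y \<in> closure \<Omega> \<Longrightarrow> \<exists>N\<le>M. (seg_step (closure \<Omega>) \<epsilon> ^^ N) x y"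
      "0 < M"
    and \<theta>: "0 < \<theta>"
  obtains u where "bounded (u ` closure \<Omega>)"
    "\<And>x. x \<in> closure \<Omega> \<Longrightarrow> \<bar>u x - tug \<Omega> \<epsilon> u x - f x + c_const \<Omega> f \<epsilon>\<bar> \<le> \<theta>"
    "\<And>a b. seg_step (closure \<Omega>) \<epsilon> a b \<Longrightarrow> u b - u a \<le> 12 * real M * F"
proof -
  let ?X = "closure \<Omega>" and ?C = "12 * (real M)\<^sup>2 * F"
  have ex: "\<exists>u a. \<forall>x\<in>?X. \<bar>u x\<bar> \<le> ?C \<and> \<bar>u x - tug \<Omega> \<epsilon> u x - f x + a\<bar> \<le> \<theta>'" if \<theta>': "0 < \<theta>'" for \<theta>'
  proof (rule approx_corrector[OF M \<theta>' ne])
    fix u a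
    assume "\<And>x. x \<in> ?X \<Longrightarrow> 0 \<le> u x \<and> u x \<le> ?C"
      "\<And>x. x \<in> ?X \<Longrightarrow> \<bar>u x - tug \<Omega> \<epsilon> u x - f x + a\<bar> \<le> \<theta>'"
    then show ?thesis by (intro exI[of _ u] exI[of _ a]) auto
  qed
  \<comment> \<open>One half of \<theta> is for the corrector, the other for replacing a by
    \<open>c_const\<close>.\<close>
  have "0 < \<theta> / 2" using \<theta> by simp
  then obtain u a where u: "\<And>x. x \<in> ?X \<Longrightarrow> 0 \<le> u x \<and> u x \<le> ?C"
      "\<And>x. x \<in> ?X \<Longrightarrow> \<bar>u x - tug \<Omega> \<epsilon> u x\<bar> \<le> 3 * F"
      "\<And>x. x \<in> ?X \<Longrightarrow> \<bar>u x - tug \<Omega> \<epsilon> u x - f x + a\<bar> \<le> \<theta> / 2"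
    using approx_corrector[OF M _ ne, of "\<theta> / 2"] by blast
  have ub: "bounded (u ` ?X)" by (rule bounded_imageI[of _ _ ?C]) (use u(1) in fastforce)
  have c: "\<bar>c_const \<Omega> f \<epsilon> - a\<bar> \<le> \<theta> / 2"
    by (rule c_const_near_corrector[OF comp ne ex ub u(3)])
  show thesis
  proof (rule that[OF ub])
    fix x assume "x \<in> ?X"
    from u(3)[OF this] c show "\<bar>u x - tug \<Omega> \<epsilon> u x - f x + c_const \<Omega> f \<epsilon>\<bar> \<le> \<theta>" by linarith
  next
    fix a b assume "seg_step ?X \<epsilon> a b"
    then have "a \<in> ?X" "b \<in> intrinsic_cball \<Omega> a \<epsilon>" using seg_step_imp_intrinsic_cball by blast+
    then have "u b - u a \<le> 4 * real M * (3 * F)"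
      using step_bound[OF \<epsilon> ub u(2) M] by blast
    then show "u b - u a \<le> 12 * real M * F" by simp
  qed
qed

end

section \<open>Limits of the discrete solutions\<close>

text \<open>In use, w k is an approximate game solution times \<epsilon>^2 / 2, so f carries the
  same factor. The defect is o(\<epsilon>^2) and vanishes in the limit equation. The viscosity
  argument knows v only through this property.\<close>

definition game_limit :: "'a::euclidean_space set \<Rightarrow> ('a \<Rightarrow> real) \<Rightarrow> ('a \<Rightarrow> real) \<Rightarrow> bool" where
  "game_limit \<Omega> f v \<longleftrightarrow>
    (\<exists>(\<epsilon> :: nat \<Rightarrow> real) w \<tau>. (\<forall>k. 0 < \<epsilon> k) \<and> \<epsilon> \<longlonglongrightarrow> 0 \<and> \<tau> \<longlonglongrightarrow> 0 \<and>
      (\<forall>k. bounded (w k ` closure \<Omega>)) \<and>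
      (\<forall>k. \<forall>x\<in>closure \<Omega>. \<bar>w k x - tug \<Omega> (\<epsilon> k) (w k) x - (\<epsilon> k)\<^sup>2 / 2 * f x\<bar> \<le> (\<epsilon> k)\<^sup>2 * \<tau> k) \<and>
      (\<forall>e>0. \<exists>N. \<forall>k\<ge>N. \<forall>x\<in>closure \<Omega>. \<bar>w k x - v x\<bar> < e))"

text \<open>Exchanging the two players; it reduces supersolutions to subsolutions.\<close>

lemma game_limit_uminus:
  assumes "game_limit \<Omega> f v"
  shows "game_limit \<Omega> (\<lambda>x. - f x) (\<lambda>x. - v x)"
proof -
  obtain \<epsilon> w \<tau> where *: "\<And>k. 0 < \<epsilon> k" "\<epsilon> \<longlonglongrightarrow> 0" "\<tau> \<longlonglongrightarrow> 0" "\<And>k. bounded (w k ` closure \<Omega>)"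
      "\<And>k x. x \<in> closure \<Omega> \<Longrightarrow> \<bar>w k x - tug \<Omega> (\<epsilon> k) (w k) x - (\<epsilon> k)\<^sup>2 / 2 * f x\<bar> \<le> (\<epsilon> k)\<^sup>2 * \<tau> k"
      "\<And>e. e > 0 \<Longrightarrow> \<exists>N. \<forall>k\<ge>N. \<forall>x\<in>closure \<Omega>. \<bar>w k x - v x\<bar> < e"
    using assms unfolding game_limit_def by blast
  define w' where "w' k x = - w k x" for k x
  have 1: "bounded (w' k ` closure \<Omega>)" for k using *(4)[of k] by (simp add: bounded_iff w'_def)
  have 2: "\<bar>w' k x - tug \<Omega> (\<epsilon> k) (w' k) x - (\<epsilon> k)\<^sup>2 / 2 * - f x\<bar> \<le> (\<epsilon> k)\<^sup>2 * \<tau> k"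
    if x: "x \<in> closure \<Omega>" for k x
  proof -
    have "tug \<Omega> (\<epsilon> k) (w' k) x = - tug \<Omega> (\<epsilon> k) (w k) x"
      unfolding w'_def by (rule tug_uminus[OF x less_imp_le[OF *(1)]])
    then show ?thesis using *(5)[OF x, of k] by (simp add: w'_def abs_le_iff)
  qed
  have "\<bar>w' k x - - v x\<bar> = \<bar>w k x - v x\<bar>" for k x unfolding w'_def by linarith
  then have 3: "\<exists>N. \<forall>k\<ge>N. \<forall>x\<in>closure \<Omega>. \<bar>w' k x - - v x\<bar> < e" if "e > 0" for e
    using *(6)[OF that] by simp
  show ?thesis
    unfolding game_limit_def
    by (rule exI[of _ \<epsilon>], rule exI[of _ w'], rule exI[of _ \<tau>]) (intro conjI allI ballI impI *(1-3) 1 2 3)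
qed

text \<open>An infimal convolution in the manner of McShane. The scaled game values may jump at
  scales below \<epsilon>, so compactness is applied to these regularisations instead, which stay
  within c of them.\<close>

lemma lipschitz_minorant:
  fixes w :: "'a::metric_space \<Rightarrow> real"
  assumes A: "0 \<le> A" and w: "\<And>x y. x \<in> X \<Longrightarrow> y \<in> X \<Longrightarrow> w x - w y \<le> A * dist x y + c"
  obtains g where "\<And>x y. x \<in> X \<Longrightarrow> y \<in> X \<Longrightarrow> \<bar>g x - g y\<bar> \<le> A * dist x y"
    "\<And>x. x \<in> X \<Longrightarrow> g x \<le> w x" "\<And>x. x \<in> X \<Longrightarrow> w x \<le> g x + c"
proof -
  define g where "g x = (INF y\<in>X. w y + A * dist x y)" for x
  have below: "w x - c \<le> w y + A * dist x y" if "x \<in> X" "y \<in> X" for x y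
    using w[OF that] by simp
  have bdd: "bdd_below ((\<lambda>y. w y + A * dist x y) ` X)" if "x \<in> X" for x
    using below[OF that] by (intro bdd_belowI2) auto
  have half: "g x \<le> g y + A * dist x y" if x: "x \<in> X" and y: "y \<in> X" for x y
  proof -
    have "g x - A * dist x y \<le> g y"
      unfolding g_def[of y]
    proof (rule cINF_greatest)
      fix z assume z: "z \<in> X"
      have "g x \<le> w z + A * dist x z" unfolding g_def by (rule cINF_lower[OF bdd[OF x] z])
      moreover have "A * dist x z \<le> A * (dist x y + dist y z)"
        using A by (intro mult_left_mono dist_triangle)
      ultimately show "g x - A * dist x y \<le> w z + A * dist y z" by (simp add: distrib_left)
    qed (use y in auto)
    then show ?thesis by simp
  qed
  show thesis
  proof (rule that)
    fix x y assume "x \<in> X" "y \<in> X"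
    then show "\<bar>g x - g y\<bar> \<le> A * dist x y" using half[of x y] half[of y x] by (simp add: dist_commute abs_le_iff)
  next
    fix x assume x: "x \<in> X"
    show "g x \<le> w x" unfolding g_def using cINF_lower[OF bdd[OF x] x] by simp
    have "w x - c \<le> g x" unfolding g_def using below[OF x] x by (intro cINF_greatest) auto
    then show "w x \<le> g x + c" by simp
  qed
qed

text \<open>From y to x there are at most K |x - y| / \<epsilon> + K steps, each raising u by at
  most 12 M F with M \<le> K D / \<epsilon> + K + 1; the factor \<epsilon>^2 / 2 cancels both powers
  of 1 / \<epsilon>. The additive term of order \<epsilon> is what rounding leaves. Omitting
  \<open>c_const\<close> from the equation is charged to the defect.\<close>

lemma scaled_game_solution:
  assumes comp: "compact (closure \<Omega>)" and x0: "x0 \<in> closure \<Omega>"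
    and K: "0 < K" "\<And>x y. x \<in> closure \<Omega> \<Longrightarrow> y \<in> closure \<Omega> \<Longrightarrow> chain_bound (closure \<Omega>) K (K * dist x y) x y"
    and D: "\<And>x y. x \<in> closure \<Omega> \<Longrightarrow> y \<in> closure \<Omega> \<Longrightarrow> dist x y \<le> D"
    and F: "\<And>x. x \<in> closure \<Omega> \<Longrightarrow> \<bar>f x\<bar> \<le> F"
    and \<epsilon>: "0 < \<epsilon>" "\<epsilon> \<le> 1" and \<theta>: "0 < \<theta>"
  obtains w where "bounded (w ` closure \<Omega>)" "w x0 = 0"
    "\<And>x. x \<in> closure \<Omega> \<Longrightarrow> \<bar>w x - tug \<Omega> \<epsilon> w x - \<epsilon>\<^sup>2 / 2 * f x\<bar> \<le> \<epsilon>\<^sup>2 * ((\<theta> + \<bar>c_const \<Omega> f \<epsilon>\<bar>) / 2)"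
    "\<And>x y. x \<in> closure \<Omega> \<Longrightarrow> y \<in> closure \<Omega> \<Longrightarrow>
       w x - w y \<le> 6 * K * (K * D + K + 1) * F * dist x y + 6 * K * (K * D + K + 1) * F * \<epsilon>"
proof -
  let ?X = "closure \<Omega>"
  have D0: "0 \<le> D" using D[OF x0 x0] by simp
  have F0: "0 \<le> F" using F[OF x0] by linarith
  define M where "M = nat \<lceil>K * D / \<epsilon> + K\<rceil>"
  have KD: "0 < K * D / \<epsilon> + K" using K(1) D0 \<epsilon> by (intro add_nonneg_pos) auto
  have M0: "0 < M" using KD by (simp add: M_def)
  have M_le: "real M \<le> K * D / \<epsilon> + K + 1"
    using KD ceiling_correct[of "K * D / \<epsilon> + K"] unfolding M_def by simp
  have chain: "\<exists>N. real N \<le> K * dist x y / \<epsilon> + K \<and> (seg_step ?X \<epsilon> ^^ N) x y" if "x \<in> ?X" "y \<in> ?X" for x y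
    using K(2)[OF that] \<epsilon>(1) unfolding chain_bound_def by blast
  have M: "\<exists>N\<le>M. (seg_step ?X \<epsilon> ^^ N) x y" if xy: "x \<in> ?X" "y \<in> ?X" for x y
  proof -
    obtain N where N: "real N \<le> K * dist x y / \<epsilon> + K" "(seg_step ?X \<epsilon> ^^ N) x y" using chain[OF xy] by blast
    have "K * dist x y / \<epsilon> \<le> K * D / \<epsilon>"
      using D[OF xy] K(1) \<epsilon> by (intro divide_right_mono mult_left_mono) auto
    then have "real N \<le> K * D / \<epsilon> + K" using N(1) by linarith
    then have "N \<le> M" unfolding M_def by linarith
    then show ?thesis using N(2) by blast
  qed
  have ne: "?X \<noteq> {}" using x0 by auto
  obtain u where u: "bounded (u ` ?X)"
    "\<And>x. x \<in> ?X \<Longrightarrow> \<bar>u x - tug \<Omega> \<epsilon> u x - f x + c_const \<Omega> f \<epsilon>\<bar> \<le> \<theta>"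
    "\<And>a b. seg_step ?X \<epsilon> a b \<Longrightarrow> u b - u a \<le> 12 * real M * F"
    using game_solution[OF less_imp_le[OF \<epsilon>(1)], of \<Omega> f F M \<theta>, OF F comp ne M M0 \<theta>] by blast
  define w where "w x = \<epsilon>\<^sup>2 / 2 * u x + (- (\<epsilon>\<^sup>2 / 2 * u x0))" for x
  have e2: "0 < \<epsilon>\<^sup>2 / 2" using \<epsilon> by simp
  obtain C where C: "\<And>x. x \<in> ?X \<Longrightarrow> \<bar>u x\<bar> \<le> C" using u(1) by (auto simp: bounded_iff)
  show thesis
  proof (rule that[of w])
    show "w x0 = 0" by (simp add: w_def)
    have "w ` ?X = (\<lambda>t. - (\<epsilon>\<^sup>2 / 2 * u x0) + t) ` (\<lambda>t. (\<epsilon>\<^sup>2 / 2) *\<^sub>R t) ` u ` ?X"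
      by (simp add: image_image w_def)
    then show "bounded (w ` ?X)"
      by (simp only: bounded_translation bounded_scaling u(1))
    fix x assume x: "x \<in> ?X"
    have "tug \<Omega> \<epsilon> w x = \<epsilon>\<^sup>2 / 2 * tug \<Omega> \<epsilon> u x + (- (\<epsilon>\<^sup>2 / 2 * u x0))"
      unfolding w_def by (rule tug_affine[OF x less_imp_le[OF \<epsilon>(1)] u(1) e2])
    then have eq: "w x - tug \<Omega> \<epsilon> w x - \<epsilon>\<^sup>2 / 2 * f x = \<epsilon>\<^sup>2 / 2 * (u x - tug \<Omega> \<epsilon> u x - f x)"
      by (simp add: w_def algebra_simps)
    have "\<bar>u x - tug \<Omega> \<epsilon> u x - f x\<bar> \<le> \<theta> + \<bar>c_const \<Omega> f \<epsilon>\<bar>" using u(2)[OF x] by linarith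
    then have "\<epsilon>\<^sup>2 / 2 * \<bar>u x - tug \<Omega> \<epsilon> u x - f x\<bar> \<le> \<epsilon>\<^sup>2 / 2 * (\<theta> + \<bar>c_const \<Omega> f \<epsilon>\<bar>)"
      using e2 by (intro mult_left_mono) auto
    then show "\<bar>w x - tug \<Omega> \<epsilon> w x - \<epsilon>\<^sup>2 / 2 * f x\<bar> \<le> \<epsilon>\<^sup>2 * ((\<theta> + \<bar>c_const \<Omega> f \<epsilon>\<bar>) / 2)"
      unfolding eq abs_mult abs_of_pos[OF e2] by simp
  next
    fix x y assume x: "x \<in> ?X" and y: "y \<in> ?X"
    obtain N where N: "real N \<le> K * dist y x / \<epsilon> + K" "(seg_step ?X \<epsilon> ^^ N) y x" using chain[OF y x] by blast
    have "u x - u y \<le> real N * (12 * real M * F)" by (rule chain_increment_le[OF N(2) u(3)])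
    also have "\<dots> \<le> (K * dist y x / \<epsilon> + K) * (12 * (K * D / \<epsilon> + K + 1) * F)"
      using N(1) M_le F0 K(1) \<epsilon> D0 by (intro mult_mono) auto
    finally have "\<epsilon>\<^sup>2 / 2 * (u x - u y) \<le> \<epsilon>\<^sup>2 / 2 * ((K * dist y x / \<epsilon> + K) * (12 * (K * D / \<epsilon> + K + 1) * F))"
      using e2 by (intro mult_left_mono) auto
    also have "\<dots> = 6 * K * (K * D + (K + 1) * \<epsilon>) * F * (dist x y + \<epsilon>)"
      using \<epsilon> by (simp add: field_simps power2_eq_square dist_commute)
    \<comment> \<open>Here \<epsilon> \<le> 1 frees the constant from \<epsilon>.\<close>
    also have "\<dots> \<le> 6 * K * (K * D + (K + 1)) * F * (dist x y + \<epsilon>)"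
      using K(1) F0 \<epsilon> D0 by (intro mult_right_mono mult_left_mono add_left_mono) (auto simp: mult_left_le)
    finally show "w x - w y \<le> 6 * K * (K * D + K + 1) * F * dist x y + 6 * K * (K * D + K + 1) * F * \<epsilon>"
      by (simp add: w_def algebra_simps)
  qed
qed

lemma game_limit_exists:
  fixes \<Omega> :: "'a::euclidean_space set"
  assumes comp: "compact (closure \<Omega>)" and x0: "x0 \<in> closure \<Omega>"
    and K: "0 < K" "\<And>x y. x \<in> closure \<Omega> \<Longrightarrow> y \<in> closure \<Omega> \<Longrightarrow> chain_bound (closure \<Omega>) K (K * dist x y) x y"
    and D: "\<And>x y. x \<in> closure \<Omega> \<Longrightarrow> y \<in> closure \<Omega> \<Longrightarrow> dist x y \<le> D"
    and F: "\<And>x. x \<in> closure \<Omega> \<Longrightarrow> \<bar>f x\<bar> \<le> F"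
    and c: "(c_const \<Omega> f \<longlongrightarrow> 0) (at_right 0)"
  obtains v where "game_limit \<Omega> f v" "(6 * K * (K * D + K + 1) * F)-lipschitz_on (closure \<Omega>) v"
proof -
  let ?X = "closure \<Omega>"
  define A where "A = 6 * K * (K * D + K + 1) * F"
  have D0: "0 \<le> D" using D[OF x0 x0] by simp
  have "0 \<le> F" using F[OF x0] by linarith
  then have A0: "0 \<le> A" using K(1) D0 by (simp add: A_def)
  define \<epsilon> :: "nat \<Rightarrow> real" where "\<epsilon> k = 1 / real (Suc k)" for k
  have \<epsilon>: "0 < \<epsilon> k" "\<epsilon> k \<le> 1" for k by (auto simp: \<epsilon>_def field_simps)
  have \<epsilon>_lim: "\<epsilon> \<longlonglongrightarrow> 0" unfolding \<epsilon>_def by (rule LIMSEQ_Suc[OF lim_1_over_n])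
  \<comment> \<open>The accuracy \<theta> is taken to be \<epsilon> k itself; the other summand
    tends to 0 by the hypothesis on c_f.\<close>
  define \<tau> where "\<tau> k = (\<epsilon> k + \<bar>c_const \<Omega> f (\<epsilon> k)\<bar>) / 2" for k
  have "filterlim \<epsilon> (at_right 0) sequentially"
    using \<epsilon>_lim \<epsilon>(1) by (auto simp: filterlim_at less_imp_neq[THEN not_sym])
  then have "(\<lambda>k. c_const \<Omega> f (\<epsilon> k)) \<longlonglongrightarrow> 0" by (rule filterlim_compose[OF c])
  then have "(\<lambda>k. (\<epsilon> k + \<bar>c_const \<Omega> f (\<epsilon> k)\<bar>) / 2) \<longlonglongrightarrow> (0 + \<bar>0\<bar>) / 2"
    by (intro tendsto_intros \<epsilon>_lim) auto
  then have \<tau>_lim: "\<tau> \<longlonglongrightarrow> 0" by (simp add: \<tau>_def[abs_def])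
  define Q where "Q k w \<longleftrightarrow> bounded (w ` ?X) \<and> w x0 = 0 \<and>
      (\<forall>x\<in>?X. \<bar>w x - tug \<Omega> (\<epsilon> k) w x - (\<epsilon> k)\<^sup>2 / 2 * f x\<bar> \<le> (\<epsilon> k)\<^sup>2 * \<tau> k) \<and>
      (\<forall>x\<in>?X. \<forall>y\<in>?X. w x - w y \<le> A * dist x y + A * \<epsilon> k)" for k w
  have "\<exists>w. Q k w" for k
  proof (rule scaled_game_solution[of \<Omega> x0 K D f F "\<epsilon> k" "\<epsilon> k", OF comp x0 K D F \<epsilon>[of k] \<epsilon>(1)[of k]])
    fix w assume "bounded (w ` ?X)" "w x0 = 0"
      and "\<And>x. x \<in> ?X \<Longrightarrow>
        \<bar>w x - tug \<Omega> (\<epsilon> k) w x - (\<epsilon> k)\<^sup>2 / 2 * f x\<bar> \<le> (\<epsilon> k)\<^sup>2 * ((\<epsilon> k + \<bar>c_const \<Omega> f (\<epsilon> k)\<bar>) / 2)"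
      and "\<And>x y. x \<in> ?X \<Longrightarrow> y \<in> ?X \<Longrightarrow>
        w x - w y \<le> 6 * K * (K * D + K + 1) * F * dist x y + 6 * K * (K * D + K + 1) * F * \<epsilon> k"
    then show ?thesis unfolding Q_def \<tau>_def A_def by (intro exI[of _ w] conjI ballI)
  qed
  then obtain w where "\<And>k. Q k (w k)" by metis
  then have w: "\<And>k. bounded (w k ` ?X)" "\<And>k. w k x0 = 0"
      "\<And>k x. x \<in> ?X \<Longrightarrow> \<bar>w k x - tug \<Omega> (\<epsilon> k) (w k) x - (\<epsilon> k)\<^sup>2 / 2 * f x\<bar> \<le> (\<epsilon> k)\<^sup>2 * \<tau> k"
      "\<And>k x y. x \<in> ?X \<Longrightarrow> y \<in> ?X \<Longrightarrow> w k x - w k y \<le> A * dist x y + A * \<epsilon> k"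
    unfolding Q_def by simp_all
  define R where "R k g \<longleftrightarrow> (\<forall>x\<in>?X. \<forall>y\<in>?X. \<bar>g x - g y\<bar> \<le> A * dist x y) \<and>
      (\<forall>x\<in>?X. g x \<le> w k x) \<and> (\<forall>x\<in>?X. w k x \<le> g x + A * \<epsilon> k)" for k g
  have "\<exists>g. R k g" for k
  proof (rule lipschitz_minorant[OF A0, of ?X "w k" "A * \<epsilon> k"])
    show "w k x - w k y \<le> A * dist x y + A * \<epsilon> k" if "x \<in> ?X" "y \<in> ?X" for x y
      using w(4)[OF that] .
    fix g assume "\<And>x y. x \<in> ?X \<Longrightarrow> y \<in> ?X \<Longrightarrow> \<bar>g x - g y\<bar> \<le> A * dist x y"
      and "\<And>x. x \<in> ?X \<Longrightarrow> g x \<le> w k x" and "\<And>x. x \<in> ?X \<Longrightarrow> w k x \<le> g x + A * \<epsilon> k"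
    then show ?thesis unfolding R_def by (intro exI[of _ g] conjI ballI)
  qed
  then obtain g where "\<And>k. R k (g k)" by metis
  then have g: "\<And>k x y. x \<in> ?X \<Longrightarrow> y \<in> ?X \<Longrightarrow> \<bar>g k x - g k y\<bar> \<le> A * dist x y"
      "\<And>k x. x \<in> ?X \<Longrightarrow> g k x \<le> w k x" "\<And>k x. x \<in> ?X \<Longrightarrow> w k x \<le> g k x + A * \<epsilon> k"
    unfolding R_def by simp_all
  \<comment> \<open>The normalisation \<open>w k x0 = 0\<close> turns the oscillation bound into a
    uniform bound.\<close>
  have g_bound: "norm (g k x) \<le> A * D + A" if x: "x \<in> ?X" for k x
  proof -
    have "A * dist x x0 \<le> A * D" using A0 D[OF x x0] by (rule mult_left_mono[rotated])
    moreover have "A * \<epsilon> k \<le> A * 1" using A0 \<epsilon>(2) by (rule mult_left_mono[rotated])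
    ultimately show ?thesis
      using g(1)[OF x x0, of k] g(2,3)[OF x0, of k] w(2)[of k] by (simp add: abs_le_iff)
  qed
  have equi: "\<exists>d>0. \<forall>n y. y \<in> ?X \<and> norm (x - y) < d \<longrightarrow> norm (g n x - g n y) < e"
    if x: "x \<in> ?X" and e: "0 < e" for x e
  proof (intro exI[of _ "e / (A + 1)"] conjI allI impI)
    show "0 < e / (A + 1)" using e A0 by simp
    fix n y assume y: "y \<in> ?X \<and> norm (x - y) < e / (A + 1)"
    then have "(A + 1) * dist x y < e" using A0 by (simp add: dist_norm field_simps)
    moreover have "A * dist x y \<le> (A + 1) * dist x y" by (simp add: distrib_right)
    ultimately show "norm (g n x - g n y) < e" using g(1)[OF x, of y n] y by simp
  qed
  have "\<exists>v r. strict_mono (r :: nat \<Rightarrow> nat) \<and>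
      (\<forall>e>0. \<exists>N. \<forall>n x. n \<ge> N \<and> x \<in> ?X \<longrightarrow> norm (g (r n) x - v x) < e)"
  proof (rule Arzela_Ascoli[OF comp, of g "A * D + A"])
    fix v and r :: "nat \<Rightarrow> nat"
    assume "strict_mono r"
      "\<And>e. 0 < e \<Longrightarrow> \<exists>N. \<forall>n x. n \<ge> N \<and> x \<in> ?X \<longrightarrow> norm (g (r n) x - v x) < e"
    then show ?thesis by (intro exI[of _ v] exI[of _ r] conjI allI impI)
  qed (use g_bound equi in auto)
  then obtain v r where r: "strict_mono (r :: nat \<Rightarrow> nat)"
    and v: "\<And>e. 0 < e \<Longrightarrow> \<exists>N. \<forall>n x. n \<ge> N \<and> x \<in> ?X \<longrightarrow> norm (g (r n) x - v x) < e"
  proof (elim exE conjE)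
    fix v and r :: "nat \<Rightarrow> nat"
    assume r: "strict_mono r"
      and v: "\<forall>e>0. \<exists>N. \<forall>n x. n \<ge> N \<and> x \<in> ?X \<longrightarrow> norm (g (r n) x - v x) < e"
    show thesis by (rule that[OF r]) (rule v[rule_format])
  qed
  have v_lim: "(\<lambda>n. g (r n) x) \<longlonglongrightarrow> v x" if "x \<in> ?X" for x
    unfolding LIMSEQ_def dist_norm using v that by blast
  have "\<bar>v x - v y\<bar> \<le> A * dist x y" if "x \<in> ?X" "y \<in> ?X" for x y
  proof (rule LIMSEQ_le_const2)
    show "(\<lambda>n. \<bar>g (r n) x - g (r n) y\<bar>) \<longlonglongrightarrow> \<bar>v x - v y\<bar>"
      using v_lim that by (intro tendsto_intros)
  qed (use g(1)[OF that] in blast)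
  then have lip: "A-lipschitz_on ?X v" using A0 by (intro lipschitz_onI) (auto simp: dist_real_def)
  have "game_limit \<Omega> f v"
    unfolding game_limit_def
  proof (rule exI[of _ "\<epsilon> \<circ> r"], rule exI[of _ "\<lambda>k. w (r k)"], rule exI[of _ "\<tau> \<circ> r"],
      intro conjI allI ballI impI)
    show "(\<epsilon> \<circ> r) \<longlonglongrightarrow> 0" "(\<tau> \<circ> r) \<longlonglongrightarrow> 0"
      using LIMSEQ_subseq_LIMSEQ[OF \<epsilon>_lim r] LIMSEQ_subseq_LIMSEQ[OF \<tau>_lim r] .
    fix e :: real assume e: "0 < e"
    then obtain N where N: "\<And>n x. n \<ge> N \<Longrightarrow> x \<in> ?X \<Longrightarrow> norm (g (r n) x - v x) < e / 2"
      using v[of "e / 2"] by auto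
    have "(\<lambda>k. A * \<epsilon> (r k)) \<longlonglongrightarrow> A * 0"
      using LIMSEQ_subseq_LIMSEQ[OF \<epsilon>_lim r] by (intro tendsto_intros) (simp add: o_def)
    then obtain N' where N': "\<And>k. k \<ge> N' \<Longrightarrow> A * \<epsilon> (r k) < e / 2"
      using order_tendstoD(2)[of "\<lambda>k. A * \<epsilon> (r k)" 0 sequentially "e / 2"] e by (auto simp: eventually_sequentially)
    have "\<bar>w (r k) x - v x\<bar> < e" if "k \<ge> max N N'" "x \<in> ?X" for k x
    proof -
      have "\<bar>g (r k) x - v x\<bar> < e / 2" "A * \<epsilon> (r k) < e / 2" using N[of k x] N'[of k] that by auto
      with g(2,3)[OF that(2), of "r k"] show ?thesis by linarith
    qed
    then show "\<exists>N. \<forall>k\<ge>N. \<forall>x\<in>?X. \<bar>w (r k) x - v x\<bar> < e" by blast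
  qed (use \<epsilon> w in auto)
  then show thesis using lip that unfolding A_def by blast
qed

section \<open>Contact with a test function\<close>

lemma approx_max:
  assumes "x0 \<in> C" "bounded ((h :: 'a \<Rightarrow> real) ` C)" "0 < \<eta>"
  shows "\<exists>x\<in>C. \<forall>y\<in>C. h y \<le> h x + \<eta>"
proof -
  have bdd: "bdd_above (h ` C)" using assms(2) by (rule bounded_imp_bdd_above)
  have "(SUP y\<in>C. h y) - \<eta> < (SUP y\<in>C. h y)" using assms(3) by simp
  then obtain x where x: "x \<in> C" "(SUP y\<in>C. h y) - \<eta> < h x"
    using less_cSUP_iff[OF _ bdd] assms(1) by blast
  show ?thesis
  proof (intro bexI[OF _ x(1)] ballI)
    fix y assume "y \<in> C"
    then have "h y \<le> (SUP y\<in>C. h y)" using bdd by (rule cSUP_upper)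
    then show "h y \<le> h x + \<eta>" using x(2) by simp
  qed
qed

text \<open>Where w - \<psi> is nearly maximal, \<open>tug_le_add\<close> transfers the discrete
  equation from w to \<psi>. The slack \<epsilon>^3 is there because w need not attain its supremum,
  and it disappears after division by \<epsilon>^2. The near-maximum x is only close to x0, hence a
  hypothesis on \<psi> in a whole neighbourhood.\<close>

lemma game_limit_test:
  assumes comp: "compact (closure \<Omega>)" and lim: "game_limit \<Omega> f v"
    and v: "continuous_on (closure \<Omega>) v" and f: "continuous_on (closure \<Omega>) f"
    and \<psi>: "continuous_on (closure \<Omega>) \<psi>" and x0: "x0 \<in> closure \<Omega>" and r: "0 < r"
    and max: "\<And>y. y \<in> closure \<Omega> \<Longrightarrow> dist x0 y < r \<Longrightarrow> y \<noteq> x0 \<Longrightarrow> v y - \<psi> y < v x0 - \<psi> x0"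
    and \<rho>: "0 < \<rho>" "\<And>x \<epsilon>. x \<in> closure \<Omega> \<Longrightarrow> dist x0 x < \<rho> \<Longrightarrow> 0 < \<epsilon> \<Longrightarrow> \<epsilon> < \<rho> \<Longrightarrow>
      tug \<Omega> \<epsilon> \<psi> x - \<psi> x \<le> \<epsilon>\<^sup>2 / 2 * m"
  shows "- m \<le> f x0"
proof (rule ccontr)
  let ?X = "closure \<Omega>"
  assume "\<not> - m \<le> f x0"
  define \<eta> where "\<eta> = (- m - f x0) / 2"
  have \<eta>: "0 < \<eta>" using \<open>\<not> - m \<le> f x0\<close> by (simp add: \<eta>_def)
  obtain d where d: "0 < d" "\<And>x. x \<in> ?X \<Longrightarrow> dist x x0 < d \<Longrightarrow> dist (f x) (f x0) < \<eta>"
    using f x0 \<eta> unfolding continuous_on_iff by blast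
  \<comment> \<open>The entry r / 4 keeps the ball of radius \<epsilon> k around x within distance r
    / 2 of x0.\<close>
  define \<rho>' where "\<rho>' = Min {d, \<rho>, r / 4}"
  have \<rho>': "0 < \<rho>'" "\<rho>' \<le> d" "\<rho>' \<le> \<rho>" "\<rho>' \<le> r / 4" using d(1) \<rho>(1) r by (auto simp: \<rho>'_def)
  define C where "C = ?X \<inter> cball x0 (r / 2)"
  define E where "E = C - ball x0 \<rho>'"
  have E: "compact E" unfolding E_def C_def using comp by (intro compact_diff compact_Int) auto
  have \<psi>b: "bounded (\<psi> ` ?X)" using \<psi> comp by (intro compact_imp_bounded compact_continuous_image)
  \<comment> \<open>Of the gap 3 \<kappa>, two parts pay for |w - v| at x and at x0, the third for
    the slack \<epsilon>^3.\<close>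
  have "\<exists>\<kappa>>0. \<forall>x\<in>E. v x - \<psi> x \<le> v x0 - \<psi> x0 - 3 * \<kappa>"
  proof (cases "E = {}")
    case False
    have "continuous_on E (\<lambda>x. v x - \<psi> x)"
      by (intro continuous_intros continuous_on_subset[OF v] continuous_on_subset[OF \<psi>]) (auto simp: E_def C_def)
    then obtain x where x: "x \<in> E" "\<And>y. y \<in> E \<Longrightarrow> v y - \<psi> y \<le> v x - \<psi> x"
      using continuous_attains_sup[OF E False] by blast
    have "v x - \<psi> x < v x0 - \<psi> x0"
      using x(1) r \<rho>'(1) by (intro max) (auto simp: E_def C_def)
    then show ?thesis
      using x(2) by (intro exI[of _ "((v x0 - \<psi> x0) - (v x - \<psi> x)) / 3"] conjI ballI)
        (simp_all only: nonzero_mult_div_cancel_left times_divide_eq_right, auto)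
  qed (auto intro: exI[of _ 1])
  then obtain \<kappa> where \<kappa>: "0 < \<kappa>" "\<And>x. x \<in> E \<Longrightarrow> v x - \<psi> x \<le> v x0 - \<psi> x0 - 3 * \<kappa>" by blast
  obtain \<epsilon> w \<tau> where L: "\<And>k::nat. 0 < \<epsilon> k" "\<epsilon> \<longlonglongrightarrow> 0" "\<tau> \<longlonglongrightarrow> 0" "\<And>k. bounded (w k ` ?X)"
      "\<And>k x. x \<in> ?X \<Longrightarrow> \<bar>w k x - tug \<Omega> (\<epsilon> k) (w k) x - (\<epsilon> k)\<^sup>2 / 2 * f x\<bar> \<le> (\<epsilon> k)\<^sup>2 * \<tau> k"
      "\<And>e. e > 0 \<Longrightarrow> \<exists>N. \<forall>k\<ge>N. \<forall>x\<in>?X. \<bar>w k x - v x\<bar> < e"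
    using lim unfolding game_limit_def by blast
  have "(\<lambda>k. (\<epsilon> k)^3) \<longlonglongrightarrow> 0^3" by (intro tendsto_intros L)
  then have "\<forall>\<^sub>F k in sequentially. (\<epsilon> k)^3 < \<kappa>" using \<kappa>(1) by (intro order_tendstoD(2)) auto
  moreover have "\<forall>\<^sub>F k in sequentially. \<epsilon> k < \<rho>'" using L(2) \<rho>'(1) by (rule order_tendstoD(2))
  moreover have "(\<lambda>k. 2 * \<epsilon> k + 2 * \<tau> k) \<longlonglongrightarrow> 2 * 0 + 2 * 0" by (intro tendsto_intros L)
  then have "\<forall>\<^sub>F k in sequentially. 2 * \<epsilon> k + 2 * \<tau> k < \<eta>" using \<eta> by (intro order_tendstoD(2)) auto
  moreover have "\<forall>\<^sub>F k in sequentially. \<forall>x\<in>?X. \<bar>w k x - v x\<bar> < \<kappa>"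
    using L(6)[OF \<kappa>(1)] by (simp add: eventually_sequentially)
  ultimately have "\<forall>\<^sub>F k in sequentially. (\<epsilon> k)^3 < \<kappa> \<and> \<epsilon> k < \<rho>' \<and> 2 * \<epsilon> k + 2 * \<tau> k < \<eta> \<and>
      (\<forall>x\<in>?X. \<bar>w k x - v x\<bar> < \<kappa>)"
    by eventually_elim simp
  then obtain k where k: "(\<epsilon> k)^3 < \<kappa>" "\<epsilon> k < \<rho>'" "2 * \<epsilon> k + 2 * \<tau> k < \<eta>"
      "\<And>x. x \<in> ?X \<Longrightarrow> \<bar>w k x - v x\<bar> < \<kappa>"
    by (auto simp: eventually_sequentially)
  have bC: "bounded ((\<lambda>x. w k x - \<psi> x) ` C)"
    by (rule bounded_subset[OF bounded_minus_comp[OF L(4)[of k] \<psi>b]]) (auto simp: C_def)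
  have "x0 \<in> C" using x0 r by (simp add: C_def)
  have "0 < (\<epsilon> k)^3" using L(1) by simp
  obtain x where x: "x \<in> C" "\<And>y. y \<in> C \<Longrightarrow> w k y - \<psi> y \<le> w k x - \<psi> x + (\<epsilon> k)^3"
    using approx_max[OF \<open>x0 \<in> C\<close> bC \<open>0 < (\<epsilon> k)^3\<close>] by (elim bexE) simp
  have xX: "x \<in> ?X" using x(1) by (simp add: C_def)
  have "x \<notin> E"
  proof
    assume "x \<in> E"
    from \<kappa>(2)[OF this] x(2)[OF \<open>x0 \<in> C\<close>] k(4)[OF x0] k(4)[OF xX] k(1) show False by linarith
  qed
  then have xd: "dist x0 x < \<rho>'" using x(1) by (auto simp: E_def)
  have "tug \<Omega> (\<epsilon> k) (w k) x \<le> tug \<Omega> (\<epsilon> k) \<psi> x + (w k x - \<psi> x + (\<epsilon> k)^3)"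
  proof (rule tug_le_add[OF xX less_imp_le[OF L(1)] L(4) \<psi>b])
    fix y assume "y \<in> intrinsic_cball \<Omega> x (\<epsilon> k)"
    then have y: "y \<in> ?X" "dist x y \<le> \<epsilon> k" using intrinsic_cball_subset[OF less_imp_le[OF L(1)[of k]], of \<Omega> x] by auto
    then have "dist x0 y \<le> r / 2" using dist_triangle[of x0 y x] xd k(2) \<rho>'(4) by linarith
    then have "y \<in> C" using y(1) by (simp add: C_def)
    then show "w k y \<le> \<psi> y + (w k x - \<psi> x + (\<epsilon> k)^3)" using x(2)[of y] by linarith
  qed
  moreover have "tug \<Omega> (\<epsilon> k) \<psi> x - \<psi> x \<le> (\<epsilon> k)\<^sup>2 / 2 * m"
    using \<rho>(2)[OF xX _ L(1)] xd k(2) \<rho>'(3) by simp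
  ultimately have "- ((\<epsilon> k)\<^sup>2 / 2 * m) - (\<epsilon> k)^3 \<le> (\<epsilon> k)\<^sup>2 / 2 * f x + (\<epsilon> k)\<^sup>2 * \<tau> k"
    using L(5)[OF xX, of k] by linarith
  then have "0 \<le> (\<epsilon> k)\<^sup>2 * (f x / 2 + \<tau> k + \<epsilon> k + m / 2)"
    by (simp add: algebra_simps power2_eq_square power3_eq_cube)
  then have "0 \<le> f x / 2 + \<tau> k + \<epsilon> k + m / 2"
    using L(1)[of k] by (simp add: zero_le_mult_iff)
  then have "- m - \<eta> < f x" using k(3) by simp
  moreover have "f x < f x0 + \<eta>"
    using d(2)[OF xX] xd \<rho>'(2) by (simp add: dist_commute dist_real_def abs_less_iff)
  moreover have "2 * \<eta> = - m - f x0" by (simp add: \<eta>_def)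
  ultimately show False by linarith
qed

section \<open>Quadratic test functions and the boundary\<close>

text \<open>Second differences of a quadratic are exact, so estimating \<open>tug\<close> on it
  produces no Taylor remainder; the remainder of a smooth test function will be absorbed into B
  beforehand.\<close>

definition quad :: "'a::euclidean_space \<Rightarrow> ('a \<Rightarrow> 'a \<Rightarrow> real) \<Rightarrow> 'a \<Rightarrow> 'a \<Rightarrow> real" where
  "quad p B x0 x = p \<bullet> (x - x0) + B (x - x0) (x - x0) / 2"

text \<open>Uniform over all nearby x, boundary points included: the moves opposite to d, slightly
  perturbed, stay in S. In use d is the direction of the gradient of the test function.\<close>

definition backward_cone :: "'a::euclidean_space set \<Rightarrow> 'a \<Rightarrow> 'a \<Rightarrow> bool" where
  "backward_cone S x0 d \<longleftrightarrow> (\<exists>\<delta>>0. \<forall>x\<in>S. \<forall>w s.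
    dist x0 x < \<delta> \<longrightarrow> dist w d < \<delta> \<longrightarrow> 0 \<le> s \<longrightarrow> s \<le> \<delta> \<longrightarrow> x - s *\<^sub>R w \<in> S)"

context
  fixes B :: "'a::euclidean_space \<Rightarrow> 'a \<Rightarrow> real"
  assumes B: "bounded_bilinear B"
begin

interpretation B: bounded_bilinear B by (rule B)

lemma quad_add: "quad p B x0 (x + h) =
    quad p B x0 x + p \<bullet> h + (B (x - x0) h + B h (x - x0)) / 2 + B h h / 2"
proof -
  have "x + h - x0 = (x - x0) + h" by simp
  then show ?thesis
    unfolding quad_def by (simp only: B.add_left B.add_right inner_add_right) (simp add: field_simps)
qed

lemma quad_second_diff: "quad p B x0 (x + h) + quad p B x0 (x - h) = 2 * quad p B x0 x + B h h"
  using quad_add[of p x0 x h] quad_add[of p x0 x "- h"]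
  by (simp add: B.minus_left B.minus_right field_simps)

lemma continuous_on_quad: "continuous_on S (quad p B x0)"
  unfolding quad_def by (intro continuous_intros B.continuous_on) simp

text \<open>The supremum is at most the maximum over the Euclidean ball, attained at some x +
  \<epsilon> w; the infimum is at most the value at x - \<epsilon> w, an admissible move by
  \<open>H\<close>. The sum of the two values is an exact second difference.\<close>

lemma tug_quad_le:
  assumes comp: "compact (closure \<Omega>)" and x: "x \<in> closure \<Omega>" and \<epsilon>: "0 < \<epsilon>"
    and H: "\<And>w. norm w \<le> 1 \<Longrightarrow>
      (\<And>w'. norm w' \<le> 1 \<Longrightarrow> quad p B x0 (x + \<epsilon> *\<^sub>R w') \<le> quad p B x0 (x + \<epsilon> *\<^sub>R w)) \<Longrightarrow>
      closed_segment x (x - \<epsilon> *\<^sub>R w) \<subseteq> closure \<Omega> \<and> B w w \<le> m"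
  shows "tug \<Omega> \<epsilon> (quad p B x0) x - quad p B x0 x \<le> \<epsilon>\<^sup>2 / 2 * m"
proof -
  let ?q = "quad p B x0" and ?B = "intrinsic_cball \<Omega> x \<epsilon>"
  have qb: "bounded (?q ` closure \<Omega>)"
    by (intro compact_imp_bounded compact_continuous_image continuous_on_quad comp)
  have "continuous_on (cball 0 1) (\<lambda>w. ?q (x + \<epsilon> *\<^sub>R w))"
    by (intro continuous_on_compose2[OF continuous_on_quad[of UNIV]] continuous_intros) auto
  then obtain w where w: "norm w \<le> 1" "\<And>w'. norm w' \<le> 1 \<Longrightarrow> ?q (x + \<epsilon> *\<^sub>R w') \<le> ?q (x + \<epsilon> *\<^sub>R w)"
    using continuous_attains_sup[of "cball 0 1" "\<lambda>w. ?q (x + \<epsilon> *\<^sub>R w)"] by (auto simp: dist_norm)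
  have seg: "closed_segment x (x - \<epsilon> *\<^sub>R w) \<subseteq> closure \<Omega>" and Bm: "B w w \<le> m"
    using H[OF w] by simp_all
  have "(SUP y\<in>?B. ?q y) \<le> ?q (x + \<epsilon> *\<^sub>R w)"
  proof (rule cSUP_least[OF intrinsic_cball_nonempty[OF x less_imp_le[OF \<epsilon>]]])
    fix y assume "y \<in> ?B"
    then have "dist x y \<le> \<epsilon>" using intrinsic_cball_subset[OF less_imp_le[OF \<epsilon>], of \<Omega> x] by auto
    then have "norm (y - x) / \<epsilon> \<le> 1" using \<epsilon> by (simp add: dist_norm norm_minus_commute)
    then have "norm ((y - x) /\<^sub>R \<epsilon>) \<le> 1" using \<epsilon> by (simp add: divide_inverse mult.commute)
    from w(2)[OF this] show "?q y \<le> ?q (x + \<epsilon> *\<^sub>R w)" using \<epsilon> by simp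
  qed
  moreover have "dist x (x - \<epsilon> *\<^sub>R w) \<le> \<epsilon>" using w(1) \<epsilon> by (simp add: dist_norm)
  then have "x - \<epsilon> *\<^sub>R w \<in> ?B" by (rule intrinsic_cball_segment[OF seg])
  then have "(INF y\<in>?B. ?q y) \<le> ?q (x - \<epsilon> *\<^sub>R w)"
    by (rule cINF_lower[OF bdd_intrinsic_cball(2)[OF x less_imp_le[OF \<epsilon>] qb]])
  moreover have "2 * tug \<Omega> \<epsilon> ?q x = (INF y\<in>?B. ?q y) + (SUP y\<in>?B. ?q y)" by (simp add: tug_def)
  moreover have "?q (x + \<epsilon> *\<^sub>R w) + ?q (x - \<epsilon> *\<^sub>R w) = 2 * ?q x + \<epsilon>\<^sup>2 * B w w"
    unfolding quad_second_diff by (simp add: B.scaleR_left B.scaleR_right power2_eq_square)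
  ultimately have "2 * tug \<Omega> \<epsilon> ?q x - 2 * ?q x \<le> \<epsilon>\<^sup>2 * B w w" by linarith
  also have "\<dots> \<le> \<epsilon>\<^sup>2 * m" using Bm by (intro mult_left_mono) auto
  finally show ?thesis by simp
qed

text \<open>Meant for critical points, where neither the direction nor the length of the maximiser w
  is known; hence a bound on B over the whole unit ball. Through w = 0 it forces m \<ge> 0.\<close>

lemma tug_quad_interior:
  assumes comp: "compact (closure \<Omega>)" and op: "open \<Omega>" and x0: "x0 \<in> \<Omega>"
    and m: "\<And>w. norm w \<le> 1 \<Longrightarrow> B w w \<le> m"
  obtains \<rho> where "0 < \<rho>" "\<And>x \<epsilon>. x \<in> closure \<Omega> \<Longrightarrow> dist x0 x < \<rho> \<Longrightarrow> 0 < \<epsilon> \<Longrightarrow> \<epsilon> < \<rho> \<Longrightarrow>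
      tug \<Omega> \<epsilon> (quad p B x0) x - quad p B x0 x \<le> \<epsilon>\<^sup>2 / 2 * m"
proof -
  obtain r where r: "0 < r" "ball x0 r \<subseteq> \<Omega>" using op x0 openE by blast
  show thesis
  proof (rule that[of "r / 2"])
    fix x \<epsilon> assume x: "x \<in> closure \<Omega>" "dist x0 x < r / 2" and \<epsilon>: "0 < \<epsilon>" "\<epsilon> < r / 2"
    show "tug \<Omega> \<epsilon> (quad p B x0) x - quad p B x0 x \<le> \<epsilon>\<^sup>2 / 2 * m"
    proof (rule tug_quad_le[OF comp x(1) \<epsilon>(1)])
      fix w :: 'a assume w: "norm w \<le> 1"
      have "dist x (x - \<epsilon> *\<^sub>R w) \<le> \<epsilon>" using w \<epsilon> by (simp add: dist_norm)
      then have "x - \<epsilon> *\<^sub>R w \<in> ball x0 r"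
        using dist_triangle[of x0 "x - \<epsilon> *\<^sub>R w" x] x(2) \<epsilon>(2) by simp
      then have "closed_segment x (x - \<epsilon> *\<^sub>R w) \<subseteq> ball x0 r"
        using x(2) r(1) by (intro closed_segment_subset) auto
      then have "closed_segment x (x - \<epsilon> *\<^sub>R w) \<subseteq> closure \<Omega>" using r(2) closure_subset by blast
      then show "closed_segment x (x - \<epsilon> *\<^sub>R w) \<subseteq> closure \<Omega> \<and> B w w \<le> m" using m[OF w] by simp
    qed
  qed (use r in simp)
qed

text \<open>For small \<open>\<epsilon>\<close> the maximiser over the Euclidean ball lies almost in direction \<open>p\<close>, and the cone
  condition provides its reflection as a competitor for the infimum.\<close>
lemma tug_quad_cone:
  assumes comp: "compact (closure \<Omega>)" and p: "p \<noteq> 0"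
    and cone: "backward_cone (closure \<Omega>) x0 (p /\<^sub>R norm p)"
    and m: "B (p /\<^sub>R norm p) (p /\<^sub>R norm p) < m"
  obtains \<rho> where "0 < \<rho>" "\<And>x \<epsilon>. x \<in> closure \<Omega> \<Longrightarrow> dist x0 x < \<rho> \<Longrightarrow> 0 < \<epsilon> \<Longrightarrow> \<epsilon> < \<rho> \<Longrightarrow>
      tug \<Omega> \<epsilon> (quad p B x0) x - quad p B x0 x \<le> \<epsilon>\<^sup>2 / 2 * m"
proof -
  define d where "d = p /\<^sub>R norm p"
  have d: "norm d = 1" "p = norm p *\<^sub>R d" using p by (auto simp: d_def)
  obtain \<delta>1 where \<delta>1: "0 < \<delta>1" "\<And>x w s. x \<in> closure \<Omega> \<Longrightarrow> dist x0 x < \<delta>1 \<Longrightarrow> dist w d < \<delta>1 \<Longrightarrow>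
      0 \<le> s \<Longrightarrow> s \<le> \<delta>1 \<Longrightarrow> x - s *\<^sub>R w \<in> closure \<Omega>"
    using cone unfolding backward_cone_def d_def by blast
  have "open {w. B w w < m}"
    by (intro open_Collect_less B.continuous_on continuous_intros)
  moreover have "d \<in> {w. B w w < m}" using m by (simp add: d_def)
  ultimately obtain \<delta>2 where \<delta>2: "0 < \<delta>2" "ball d \<delta>2 \<subseteq> {w. B w w < m}" using openE by blast
  obtain K where K: "0 < K" "\<And>a b. norm (B a b) \<le> norm a * norm b * K"
    using B.pos_bounded by blast
  define \<delta> where "\<delta> = min \<delta>1 \<delta>2"
  have \<delta>: "0 < \<delta>" "\<delta> \<le> \<delta>1" "\<delta> \<le> \<delta>2" using \<delta>1 \<delta>2 by (auto simp: \<delta>_def)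
  \<comment> \<open>The quadratic terms contribute at most 2 K \<rho> \<epsilon>, so comparing w
    with d gives |p| (1 - d \<bullet> w) \<le> 4 K \<rho>. Then |w - d|^2 \<le> 2 (1 - d \<bullet>
    w) \<le> \<delta>^2 / 2.\<close>
  define \<rho> where "\<rho> = min \<delta> (\<delta>\<^sup>2 * norm p / (16 * K))"
  have \<rho>: "0 < \<rho>" "\<rho> \<le> \<delta>" using \<delta> p K by (auto simp: \<rho>_def)
  have "\<rho> \<le> \<delta>\<^sup>2 * norm p / (16 * K)" by (simp add: \<rho>_def)
  then have \<rho>K: "16 * K * \<rho> \<le> \<delta>\<^sup>2 * norm p" using K(1) by (simp add: field_simps)
  show thesis
  proof (rule that[OF \<rho>(1)])
    fix x \<epsilon> assume x: "x \<in> closure \<Omega>" "dist x0 x < \<rho>" and \<epsilon>: "0 < \<epsilon>" "\<epsilon> < \<rho>"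
    show "tug \<Omega> \<epsilon> (quad p B x0) x - quad p B x0 x \<le> \<epsilon>\<^sup>2 / 2 * m"
    proof (rule tug_quad_le[OF comp x(1) \<epsilon>(1)])
      fix w assume w: "norm w \<le> 1"
        and max: "\<And>w'. norm w' \<le> 1 \<Longrightarrow> quad p B x0 (x + \<epsilon> *\<^sub>R w') \<le> quad p B x0 (x + \<epsilon> *\<^sub>R w)"
      have lin: "\<bar>quad p B x0 (x + \<epsilon> *\<^sub>R w) - quad p B x0 x - \<epsilon> * (p \<bullet> w)\<bar> \<le> 2 * K * \<rho> * \<epsilon>"
        if w: "norm w \<le> 1" for w
      proof -
        have nx: "norm (x - x0) \<le> \<rho>" using x(2) by (simp add: dist_norm norm_minus_commute)
        have nw: "norm (\<epsilon> *\<^sub>R w) \<le> \<epsilon>" using w \<epsilon>(1) by simp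
        have "norm (x - x0) * norm (\<epsilon> *\<^sub>R w) * K \<le> \<rho> * \<epsilon> * K"
          using nx nw K(1) \<rho>(1) by (intro mult_mono mult_right_mono) auto
        then have 1: "\<bar>B (x - x0) (\<epsilon> *\<^sub>R w)\<bar> \<le> K * \<rho> * \<epsilon>" "\<bar>B (\<epsilon> *\<^sub>R w) (x - x0)\<bar> \<le> K * \<rho> * \<epsilon>"
          using K(2)[of "x - x0" "\<epsilon> *\<^sub>R w"] K(2)[of "\<epsilon> *\<^sub>R w" "x - x0"]
          unfolding real_norm_def by (simp_all only: mult.commute mult.left_commute)
        have "norm (\<epsilon> *\<^sub>R w) * norm (\<epsilon> *\<^sub>R w) * K \<le> \<rho> * \<epsilon> * K"
          using nw K(1) \<rho>(1) order_trans[OF nw less_imp_le[OF \<epsilon>(2)]]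
          by (intro mult_mono[of _ \<rho>] mult_right_mono) (auto simp del: norm_scaleR)
        then have 2: "\<bar>B (\<epsilon> *\<^sub>R w) (\<epsilon> *\<^sub>R w)\<bar> \<le> K * \<rho> * \<epsilon>"
          using K(2)[of "\<epsilon> *\<^sub>R w" "\<epsilon> *\<^sub>R w"]
          unfolding real_norm_def by (simp only: mult.commute mult.left_commute)
        have "quad p B x0 (x + \<epsilon> *\<^sub>R w) - quad p B x0 x - \<epsilon> * (p \<bullet> w) =
            (B (x - x0) (\<epsilon> *\<^sub>R w) + B (\<epsilon> *\<^sub>R w) (x - x0)) / 2 + B (\<epsilon> *\<^sub>R w) (\<epsilon> *\<^sub>R w) / 2"
          unfolding quad_add by simp
        moreover have "\<bar>(a + b) / 2 + c / 2\<bar> \<le> 2 * l" if "\<bar>a\<bar> \<le> l" "\<bar>b\<bar> \<le> l" "\<bar>c\<bar> \<le> l"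
          for a b c l :: real using that by (simp add: add_divide_distrib[symmetric])
        ultimately show ?thesis using 1 2 by (simp only: mult.assoc)
      qed
      have "\<epsilon> * (p \<bullet> d) - \<epsilon> * (p \<bullet> w) \<le> 4 * K * \<rho> * \<epsilon>"
        using lin[of d] lin[OF w] max[of d] d(1) by (simp add: abs_le_iff)
      then have "\<epsilon> * (p \<bullet> d - p \<bullet> w) \<le> \<epsilon> * (4 * K * \<rho>)" by (simp add: algebra_simps)
      then have "p \<bullet> d - p \<bullet> w \<le> 4 * K * \<rho>" using \<epsilon>(1) by simp
      moreover have "p \<bullet> d = norm p" using d by (metis inner_scaleR_left mult.right_neutral norm_eq_1)
      moreover have "p \<bullet> w = norm p * (d \<bullet> w)" using d(2) by (metis inner_scaleR_left)
      ultimately have "norm p * (1 - d \<bullet> w) \<le> 4 * K * \<rho>" by (simp add: algebra_simps)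
      then have "norm p * (4 * (1 - d \<bullet> w)) \<le> norm p * \<delta>\<^sup>2" using \<rho>K by (simp add: algebra_simps)
      then have "4 * (1 - d \<bullet> w) \<le> \<delta>\<^sup>2" using p by simp
      moreover have "(dist w d)\<^sup>2 = (norm w)\<^sup>2 + (norm d)\<^sup>2 - 2 * (d \<bullet> w)"
        by (simp add: dist_norm power2_norm_eq_inner inner_diff_left inner_diff_right inner_commute)
      moreover have "(norm w)\<^sup>2 \<le> 1" using w by (simp add: power_le_one)
      ultimately have "(dist w d)\<^sup>2 \<le> \<delta>\<^sup>2 / 2" using d(1) by simp
      then have "(dist w d)\<^sup>2 < \<delta>\<^sup>2" using \<delta>(1) by (smt (verit) field_sum_of_halves zero_less_power)
      then have wd: "dist w d < \<delta>" using \<delta>(1) by (simp add: power_less_imp_less_base)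
      have "closed_segment x (x - \<epsilon> *\<^sub>R w) \<subseteq> closure \<Omega>"
      proof
        fix y assume "y \<in> closed_segment x (x - \<epsilon> *\<^sub>R w)"
        then obtain t where t: "0 \<le> t" "t \<le> 1" "y = (1 - t) *\<^sub>R x + t *\<^sub>R (x - \<epsilon> *\<^sub>R w)"
          unfolding in_segment by blast
        then have "y = x - (t * \<epsilon>) *\<^sub>R w" by (simp add: algebra_simps)
        moreover have t\<epsilon>: "0 \<le> t * \<epsilon>" "t * \<epsilon> \<le> \<epsilon>" using t \<epsilon>(1) by (simp_all add: mult_left_le_one_le)
        have "x - (t * \<epsilon>) *\<^sub>R w \<in> closure \<Omega>"
          by (rule \<delta>1(2)[OF x(1) _ _ t\<epsilon>(1)]) (use wd x(2) \<epsilon>(2) t\<epsilon>(2) \<rho>(2) \<delta> in linarith)+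
        ultimately show "y \<in> closure \<Omega>" by simp
      qed
      moreover have "w \<in> ball d \<delta>2" using wd \<delta>(3) by (simp add: dist_commute)
      then have "B w w < m" using \<delta>2(2) by blast
      ultimately show "closed_segment x (x - \<epsilon> *\<^sub>R w) \<subseteq> closure \<Omega> \<and> B w w \<le> m" by simp
    qed
  qed
qed

end

section \<open>Backward cones and the outward normal\<close>

lemma backward_cone_interior:
  assumes "open \<Omega>" "x0 \<in> \<Omega>"
  shows "backward_cone (closure \<Omega>) x0 d"
proof -
  obtain r where r: "0 < r" "ball x0 r \<subseteq> \<Omega>" using assms openE by blast
  \<comment> \<open>As |w| \<le> |d| + 1, the point x - s w is within \<delta> (|d| + 2) of
    x0.\<close>
  define \<delta> where "\<delta> = min 1 (r / (norm d + 2))"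
  have nd: "0 < norm d + 2" by (simp add: add_nonneg_pos)
  have "0 < r / (norm d + 2)" using r(1) nd by simp
  then have \<delta>: "0 < \<delta>" "\<delta> \<le> 1" "\<delta> \<le> r / (norm d + 2)" unfolding \<delta>_def by auto
  have \<delta>r: "\<delta> * (norm d + 2) \<le> r" using \<delta>(3) nd by (simp add: pos_le_divide_eq)
  show ?thesis
    unfolding backward_cone_def
  proof (intro exI[of _ \<delta>] conjI ballI allI impI)
    fix x w s assume *: "x \<in> closure \<Omega>" "dist x0 x < \<delta>" "dist w d < \<delta>" "0 \<le> s" "s \<le> \<delta>"
    have "norm w \<le> norm d + 1" using norm_triangle_sub[of w d] *(3) \<delta>(2) by (simp add: dist_norm)
    then have "s * norm w \<le> \<delta> * (norm d + 1)" using * by (intro mult_mono) auto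
    then have "dist x (x - s *\<^sub>R w) \<le> \<delta> * (norm d + 1)" using *(4) by (simp add: dist_norm)
    then have "dist x0 (x - s *\<^sub>R w) < \<delta> + \<delta> * (norm d + 1)"
      using dist_triangle[of x0 "x - s *\<^sub>R w" x] *(2) by linarith
    also have "\<dots> = \<delta> * (norm d + 2)" by (simp add: algebra_simps)
    also have "\<dots> \<le> r" by (rule \<delta>r)
    finally have "x - s *\<^sub>R w \<in> \<Omega>" using r(2) by auto
    then show "x - s *\<^sub>R w \<in> closure \<Omega>" using closure_subset by blast
  qed (rule \<delta>(1))
qed

context boundary_chart
begin

text \<open>By continuity G y \<bullet> w stays positive for y near z and w near d, so F does not
  increase along -w and F \<le> 0 persists, even from a start on the boundary.\<close>

lemma backward_cone_chart:
  assumes d: "0 < G z \<bullet> d"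
  shows "backward_cone (closure \<Omega>) z d"
proof -
  have "continuous_on UNIV (\<lambda>q. G (fst q) \<bullet> snd q)"
    by (intro continuous_intros continuous_on_compose2[OF G_cont]) auto
  then have "open {q. 0 < G (fst q) \<bullet> snd q}" by (intro open_Collect_less) (auto intro: continuous_intros)
  moreover have "(z, d) \<in> {q. 0 < G (fst q) \<bullet> snd q}" using d by simp
  ultimately obtain A D where AD: "open A" "open D" "z \<in> A" "d \<in> D" "A \<times> D \<subseteq> {q. 0 < G (fst q) \<bullet> snd q}"
    by (rule open_prod_elim) (metis SigmaD1 SigmaD2)
  obtain a where a: "0 < a" "ball z a \<subseteq> A" using AD(1,3) openE by blast
  obtain b where b: "0 < b" "ball d b \<subseteq> D" using AD(2,4) openE by blast
  define R where "R = min r a"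
  have R: "0 < R" using r_pos a by (simp add: R_def)
  have nd: "0 < norm d + 2" by (simp add: add_nonneg_pos)
  define \<delta> where "\<delta> = Min {1, b, R / (norm d + 2)}"
  have "0 < R / (norm d + 2)" using R nd by simp
  then have \<delta>: "0 < \<delta>" "\<delta> \<le> 1" "\<delta> \<le> b" "\<delta> \<le> R / (norm d + 2)" using b(1) unfolding \<delta>_def by auto
  have \<delta>R: "\<delta> * (norm d + 2) \<le> R" using \<delta>(4) nd by (simp add: field_simps)
  show ?thesis
    unfolding backward_cone_def
  proof (intro exI[of _ \<delta>] conjI ballI allI impI)
    fix x w s assume *: "x \<in> closure \<Omega>" "dist z x < \<delta>" "dist w d < \<delta>" "0 \<le> s" "s \<le> \<delta>"
    have nw: "norm w \<le> norm d + 1" using norm_triangle_sub[of w d] *(3) \<delta>(2) by (simp add: dist_norm)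
    have near: "x - t *\<^sub>R w \<in> ball z R" if t: "0 \<le> t" "t \<le> s" for t
    proof -
      have "t * norm w \<le> \<delta> * (norm d + 1)" using t * nw by (intro mult_mono) auto
      then have "dist x (x - t *\<^sub>R w) \<le> \<delta> * (norm d + 1)" using t(1) by (simp add: dist_norm)
      then have "dist z (x - t *\<^sub>R w) < \<delta> + \<delta> * (norm d + 1)"
        using dist_triangle[of z "x - t *\<^sub>R w" x] *(2) by linarith
      also have "\<dots> = \<delta> * (norm d + 2)" by (simp add: algebra_simps)
      also have "\<dots> \<le> R" by (rule \<delta>R)
      finally show ?thesis by simp
    qed
    have "w \<in> D" using *(3) \<delta>(3) b(2) by (auto simp: dist_commute)
    have "F (x - s *\<^sub>R w) \<le> F (x - 0 *\<^sub>R w)"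
    proof (rule DERIV_nonpos_imp_nonincreasing[OF *(4)])
      fix t assume t: "0 \<le> t" "t \<le> s"
      have "((\<lambda>t. F (x - t *\<^sub>R w)) has_derivative (\<lambda>h. G (x - t *\<^sub>R w) \<bullet> - (h *\<^sub>R w))) (at t)"
        by (rule has_derivative_compose[OF _ F_deriv]) (auto intro!: derivative_eq_intros)
      then have "((\<lambda>t. F (x - t *\<^sub>R w)) has_real_derivative - (G (x - t *\<^sub>R w) \<bullet> w)) (at t)"
        by (rule has_derivative_imp_has_field_derivative) (simp add: mult.commute)
      moreover have "x - t *\<^sub>R w \<in> A" using near[OF t] a(2) by (auto simp: R_def)
      then have "0 < G (x - t *\<^sub>R w) \<bullet> w" using AD(5) \<open>w \<in> D\<close> by auto
      ultimately show "\<exists>y. ((\<lambda>t. F (x - t *\<^sub>R w)) has_real_derivative y) (at t) \<and> y \<le> 0"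
        by (intro exI[of _ "- (G (x - t *\<^sub>R w) \<bullet> w)"]) simp
    qed
    moreover have "x \<in> ball z r" using near[of 0] *(4) by (simp add: R_def)
    then have "F x \<le> 0" using mem_closure_chart *(1) by simp
    ultimately have "F (x - s *\<^sub>R w) \<le> 0" by simp
    moreover have "x - s *\<^sub>R w \<in> ball z r" using near[of s] *(4) by (simp add: R_def)
    ultimately show "x - s *\<^sub>R w \<in> closure \<Omega>" using mem_closure_chart by blast
  qed (rule \<delta>(1))
qed

text \<open>Differentiate \<open>F_shift\<close>. In particular the gradient of F never
  vanishes.\<close>

lemma G_e: "G x \<bullet> e = - 1"
proof -
  have "((\<lambda>t. F (x + t *\<^sub>R e)) has_derivative (\<lambda>h. G (x + 0 *\<^sub>R e) \<bullet> (h *\<^sub>R e))) (at 0)"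
    by (rule has_derivative_compose[OF _ F_deriv]) (auto intro!: derivative_eq_intros)
  then have "((\<lambda>t. F x - t) has_derivative (\<lambda>h. G x \<bullet> (h *\<^sub>R e))) (at 0)"
    by (simp only: F_shift scaleR_zero_left add_0_right)
  moreover have "((\<lambda>t. F x - t) has_derivative (\<lambda>h. - h)) (at 0)" by (auto intro!: derivative_eq_intros)
  ultimately have "(\<lambda>h. G x \<bullet> (h *\<^sub>R e)) = (\<lambda>h. - h)" by (rule has_derivative_unique)
  from fun_cong[OF this, of 1] show ?thesis by simp
qed

lemma tangent_vector_chart_iff:
  assumes z: "z \<in> frontier \<Omega>"
  shows "tangent_vector (frontier \<Omega>) z v \<longleftrightarrow> G z \<bullet> v = 0"
proof
  have z0: "F z = 0" using frontier_chart z r_pos by (metis (mono_tags, lifting) Int_iff centre_in_ball mem_Collect_eq)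
  show "G z \<bullet> v = 0" if tv: "tangent_vector (frontier \<Omega>) z v"
  proof -
    obtain g \<delta> where g: "\<delta> > 0" "g 0 = z" "\<And>t. \<bar>t\<bar> < \<delta> \<Longrightarrow> g t \<in> frontier \<Omega>"
      "(g has_vector_derivative v) (at 0)"
      using tv unfolding tangent_vector_def by (elim exE conjE) simp
    have gd: "(g has_derivative (\<lambda>h. h *\<^sub>R v)) (at 0)" using g(4) by (simp add: has_vector_derivative_def)
    have Fg: "((\<lambda>t. F (g t)) has_derivative (\<lambda>h. G (g 0) \<bullet> (h *\<^sub>R v))) (at 0)"
      by (rule has_derivative_compose[OF gd F_deriv])
    have "isCont g 0" using gd by (rule has_derivative_continuous)
    then obtain \<eta> where \<eta>: "0 < \<eta>" "\<And>t. \<bar>t\<bar> < \<eta> \<Longrightarrow> dist (g t) (g 0) < r"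
      using r_pos unfolding continuous_at_eps_delta by (auto simp: dist_real_def)
    have "F (g t) = 0" if "\<bar>t\<bar> < min \<delta> \<eta>" for t
    proof -
      have "g t \<in> frontier \<Omega> \<inter> ball z r" using that g(2,3) \<eta>(2)[of t] by (simp add: dist_commute)
      then show ?thesis unfolding frontier_chart by simp
    qed
    then have "((\<lambda>t. 0) has_derivative (\<lambda>h. G (g 0) \<bullet> (h *\<^sub>R v))) (at (0::real))"
      using g(1) \<eta>(1)
      by (intro has_derivative_transform_within[OF Fg, of "min \<delta> \<eta>"]) (auto simp: dist_real_def)
    moreover have "((\<lambda>t. 0 :: real) has_derivative (\<lambda>h. 0)) (at (0::real))" by simp
    ultimately have "(\<lambda>h::real. G (g 0) \<bullet> (h *\<^sub>R v)) = (\<lambda>h. 0)" by (rule has_derivative_unique)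
    from fun_cong[OF this, of 1] show ?thesis using g(2) by simp
  qed
  show "tangent_vector (frontier \<Omega>) z v" if v: "G z \<bullet> v = 0"
  proof -
    \<comment> \<open>The line z + t v is pushed back along e to the zero set of F; as G z \<bullet>
      v = 0, the correction has derivative 0.\<close>
    define g where "g t = z + t *\<^sub>R v + F (z + t *\<^sub>R v) *\<^sub>R e" for t :: real
    have "((\<lambda>t. F (z + t *\<^sub>R v)) has_derivative (\<lambda>h. G (z + 0 *\<^sub>R v) \<bullet> (h *\<^sub>R v))) (at 0)"
      by (rule has_derivative_compose[OF _ F_deriv]) (auto intro!: derivative_eq_intros)
    then have "((\<lambda>t. F (z + t *\<^sub>R v)) has_derivative (\<lambda>h. 0)) (at 0)" using v by simp
    then have gd: "(g has_derivative (\<lambda>h. h *\<^sub>R v)) (at 0)"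
      unfolding g_def by (auto intro!: derivative_eq_intros)
    have g0: "g 0 = z" using z0 by (simp add: g_def)
    have "isCont g 0" using gd by (rule has_derivative_continuous)
    then obtain \<eta> where \<eta>: "0 < \<eta>" "\<And>t. \<bar>t\<bar> < \<eta> \<Longrightarrow> dist (g t) (g 0) < r"
      using r_pos unfolding continuous_at_eps_delta by (auto simp: dist_real_def)
    have "g t \<in> frontier \<Omega>" if "\<bar>t\<bar> < \<eta>" for t
    proof -
      have "g t \<in> {y \<in> ball z r. F y = 0}"
      proof -
        have "g t \<in> ball z r" using \<eta>(2)[OF that] unfolding g0 by (simp add: dist_commute)
        moreover have "F (g t) = 0" by (simp add: g_def F_shift)
        ultimately show ?thesis by simp
      qed
      then show ?thesis unfolding frontier_chart[symmetric] by simp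
    qed
    then show ?thesis
      unfolding tangent_vector_def has_vector_derivative_def
      using \<eta>(1) g0 gd by (intro exI[of _ g] exI[of _ \<eta>]) auto
  qed
qed

text \<open>A vector orthogonal to the kernel of G z is a multiple of G z, so norm 1 leaves two
  candidates. The sign of F along the rays, determined by G z \<bullet> u, selects one of
  them.\<close>

lemma outward_normal_chart:
  assumes z: "z \<in> frontier \<Omega>"
  shows "outward_normal \<Omega> z = G z /\<^sub>R norm (G z)"
proof -
  have z0: "F z = 0" using frontier_chart z r_pos by (metis (mono_tags, lifting) Int_iff centre_in_ball mem_Collect_eq)
  have G0: "G z \<noteq> 0" using G_e[of z] by auto
  define n where "n = G z /\<^sub>R norm (G z)"
  have n1: "norm n = 1" using G0 by (simp add: n_def)
  have Gn: "0 < G z \<bullet> n" using G0 by (simp add: n_def)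
  have sign: "\<forall>\<^sub>F t in at_right 0. sgn (F (z + t *\<^sub>R u)) = sgn (G z \<bullet> u) \<and> z + t *\<^sub>R u \<in> ball z r"
    if u: "G z \<bullet> u \<noteq> 0" for u
  proof -
    have "((\<lambda>t. F (z + t *\<^sub>R u)) has_derivative (\<lambda>h. G (z + 0 *\<^sub>R u) \<bullet> (h *\<^sub>R u))) (at 0)"
      by (rule has_derivative_compose[OF _ F_deriv]) (auto intro!: derivative_eq_intros)
    then have "((\<lambda>t. F (z + t *\<^sub>R u)) has_real_derivative (G z \<bullet> u)) (at 0)"
      by (rule has_derivative_imp_has_field_derivative) (simp add: mult.commute)
    then have "((\<lambda>t. F (z + t *\<^sub>R u) / t) \<longlongrightarrow> G z \<bullet> u) (at 0)"
      unfolding DERIV_def using z0 by simp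
    then have lim: "((\<lambda>t. F (z + t *\<^sub>R u) / t) \<longlongrightarrow> G z \<bullet> u) (at_right 0)"
      by (rule tendsto_within_subset) simp
    have "\<forall>\<^sub>F t in at_right 0. sgn (F (z + t *\<^sub>R u) / t) = sgn (G z \<bullet> u)"
    proof (cases "0 < G z \<bullet> u")
      case True
      from order_tendstoD(1)[OF lim this] show ?thesis by eventually_elim (use True in \<open>simp add: sgn_pos del: sgn_divide\<close>)
    next
      case False
      then have neg: "G z \<bullet> u < 0" using u by simp
      from order_tendstoD(2)[OF lim this] show ?thesis by eventually_elim (use neg in \<open>simp add: sgn_neg del: sgn_divide\<close>)
    qed
    moreover have "((\<lambda>t. z + t *\<^sub>R u) \<longlongrightarrow> z + 0 *\<^sub>R u) (at_right 0)" by (intro tendsto_intros)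
    then have "\<forall>\<^sub>F t in at_right 0. z + t *\<^sub>R u \<in> ball z r"
      using r_pos by (intro topological_tendstoD) auto
    moreover have "\<forall>\<^sub>F t in at_right (0::real). 0 < t" by (rule eventually_at_right_less)
    ultimately show ?thesis by eventually_elim (auto simp: sgn_divide)
  qed
  have "is_outward_normal \<Omega> z n"
    unfolding is_outward_normal_def
  proof (intro conjI allI impI)
    fix v assume "tangent_vector (frontier \<Omega>) z v"
    then show "n \<bullet> v = 0" using tangent_vector_chart_iff[OF z] by (simp add: n_def)
  next
    from sign[of n] Gn show "\<forall>\<^sub>F t in at_right 0. z + t *\<^sub>R n \<notin> closure \<Omega>"
      by (auto elim!: eventually_mono simp: mem_closure_chart sgn_1_pos)
  qed (rule n1)
  moreover have "n' = n" if n': "is_outward_normal \<Omega> z n'" for n'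
  proof -
    have n'1: "norm n' = 1" and tang: "\<And>v. G z \<bullet> v = 0 \<Longrightarrow> n' \<bullet> v = 0"
      and out: "\<forall>\<^sub>F t in at_right 0. z + t *\<^sub>R n' \<notin> closure \<Omega>"
      using n' tangent_vector_chart_iff[OF z] unfolding is_outward_normal_def by auto
    define v where "v = n' - (n \<bullet> n') *\<^sub>R n"
    have nn: "n \<bullet> n = 1" using n1 by (simp add: norm_eq_1)
    have "n \<bullet> v = 0" by (simp add: v_def inner_diff_right nn)
    then have "n' \<bullet> v = 0" using tang[of v] G0 by (simp add: n_def)
    with \<open>n \<bullet> v = 0\<close> have "v \<bullet> v = 0" by (simp add: v_def inner_diff_left)
    then have n'_eq: "n' = (n \<bullet> n') *\<^sub>R n" by (simp add: v_def)
    then have "\<bar>n \<bullet> n'\<bar> = 1" using n'1 n1 by (metis mult.right_neutral norm_scaleR)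
    moreover have "n \<bullet> n' \<noteq> - 1"
    proof
      assume "n \<bullet> n' = - 1"
      then have "n' = - n" using n'_eq by simp
      then have "G z \<bullet> n' < 0" using Gn by simp
      with sign[of n'] have "\<forall>\<^sub>F t in at_right 0. z + t *\<^sub>R n' \<in> closure \<Omega>"
        by (auto elim!: eventually_mono simp: mem_closure_chart sgn_1_neg)
      with out have "\<forall>\<^sub>F t in at_right (0::real). False" by eventually_elim simp
      then show False by simp
    qed
    ultimately have "n \<bullet> n' = 1" by linarith
    then show ?thesis using n'_eq by simp
  qed
  ultimately have "(THE n. is_outward_normal \<Omega> z n) = n" by (rule the_equality)
  then show ?thesis by (simp add: outward_normal_def n_def)
qed

end

section \<open>The viscosity property\<close>

lemma smooth_gradient:
  assumes "\<phi> differentiable (at x)"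
  shows "frechet_derivative \<phi> (at x) h = gradient \<phi> x \<bullet> h"
    "(\<phi> has_derivative (\<lambda>h. gradient \<phi> x \<bullet> h)) (at x)"
proof -
  have lin: "linear (frechet_derivative \<phi> (at x))" using assms by (rule linear_frechet_derivative)
  have *: "frechet_derivative \<phi> (at x) h = gradient \<phi> x \<bullet> h" for h
  proof -
    have "frechet_derivative \<phi> (at x) h = frechet_derivative \<phi> (at x) (\<Sum>i\<in>Basis. (h \<bullet> i) *\<^sub>R i)"
      by (simp add: euclidean_representation)
    also have "\<dots> = (\<Sum>i\<in>Basis. (h \<bullet> i) * frechet_derivative \<phi> (at x) i)"
      by (simp add: linear_sum[OF lin] linear_scale[OF lin])
    also have "\<dots> = gradient \<phi> x \<bullet> h"
      unfolding gradient_def inner_sum_left inner_scaleR_left partial_deriv_def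
      by (simp only: inner_commute mult.commute)
    finally show ?thesis .
  qed
  show "frechet_derivative \<phi> (at x) h = gradient \<phi> x \<bullet> h" by (rule *)
  have "frechet_derivative \<phi> (at x) = (\<lambda>h. gradient \<phi> x \<bullet> h)" using * by (rule ext)
  then show "(\<phi> has_derivative (\<lambda>h. gradient \<phi> x \<bullet> h)) (at x)"
    using assms by (simp add: frechet_derivative_works)
qed

text \<open>The two-argument form behind \<open>hessian_form\<close>, needed to put a test function
  into the shape of \<open>quad\<close>.\<close>

definition hessian_bilinear :: "('a::euclidean_space \<Rightarrow> real) \<Rightarrow> 'a \<Rightarrow> 'a \<Rightarrow> 'a \<Rightarrow> real" where
  "hessian_bilinear \<phi> x h k = (\<Sum>i\<in>Basis. \<Sum>j\<in>Basis. partial_deriv j (partial_deriv i \<phi>) x * (h \<bullet> i) * (k \<bullet> j))"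

lemma bounded_bilinear_hessian: "bounded_bilinear (hessian_bilinear \<phi> x)"
  unfolding bilinear_conv_bounded_bilinear[symmetric] bilinear_def hessian_bilinear_def
  by (intro conjI allI linearI)
    (simp_all add: inner_add_left sum.distrib[symmetric] sum_distrib_left algebra_simps)

lemma hessian_form_eq: "hessian_form \<phi> x h = hessian_bilinear \<phi> x h h"
  by (simp add: hessian_form_def hessian_bilinear_def)

text \<open>Second derivatives are assumed at x alone. The remainder along the segment from x to x +
  h has a derivative that differentiability of the gradient at x bounds by e |h|^2, and the mean
  value theorem applies.\<close>

lemma second_order_expansion:
  fixes \<phi> :: "'a::euclidean_space \<Rightarrow> real"
  assumes U: "open U" "x \<in> U" and d1: "\<And>y. y \<in> U \<Longrightarrow> \<phi> differentiable (at y)"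
    and d2: "\<And>i. i \<in> Basis \<Longrightarrow> partial_deriv i \<phi> differentiable (at x)" and e: "0 < e"
  shows "\<exists>\<delta>>0. \<forall>h. norm h < \<delta> \<longrightarrow>
    \<bar>\<phi> (x + h) - \<phi> x - gradient \<phi> x \<bullet> h - hessian_bilinear \<phi> x h h / 2\<bar> \<le> e * (norm h)\<^sup>2"
proof -
  define A where "A h = (\<Sum>i\<in>Basis. (gradient (partial_deriv i \<phi>) x \<bullet> h) *\<^sub>R i)" for h
  have A_hess: "A h \<bullet> h = hessian_bilinear \<phi> x h h" for h
    unfolding A_def hessian_bilinear_def gradient_def inner_sum_left inner_scaleR_left sum_distrib_right
    by (intro sum.cong refl) (simp only: inner_commute ac_simps)
  have "(gradient \<phi> has_derivative A) (at x)"
    unfolding gradient_def A_def[abs_def]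
    by (intro has_derivative_sum has_derivative_scaleR_left smooth_gradient(2)[unfolded gradient_def] d2)
  then have lin: "linear A" and A: "\<exists>d>0. \<forall>y. norm (y - x) < d \<longrightarrow>
      norm (gradient \<phi> y - gradient \<phi> x - A (y - x)) \<le> e * norm (y - x)"
    using e unfolding has_derivative_at_alt by (auto intro: bounded_linear.linear)
  obtain d where d: "0 < d" "\<And>y. norm (y - x) < d \<Longrightarrow>
      norm (gradient \<phi> y - gradient \<phi> x - A (y - x)) \<le> e * norm (y - x)" using A by blast
  obtain r where r: "0 < r" "ball x r \<subseteq> U" using U openE by blast
  show ?thesis
  proof (intro exI[of _ "min d r"] conjI allI impI)
    fix h :: 'a assume h: "norm h < min d r"
    define g where "g t = \<phi> (x + t *\<^sub>R h) - t * (gradient \<phi> x \<bullet> h) - t\<^sup>2 / 2 * (A h \<bullet> h)" for t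
    define g' where "g' t = gradient \<phi> (x + t *\<^sub>R h) \<bullet> h - gradient \<phi> x \<bullet> h - t * (A h \<bullet> h)" for t
    have g: "(g has_real_derivative g' t) (at t)" and g'_le: "\<bar>g' t\<bar> \<le> e * (norm h)\<^sup>2"
      if t: "0 \<le> t" "t \<le> 1" for t
    proof -
      have nt: "norm (t *\<^sub>R h) \<le> norm h" using t by (simp add: mult_left_le_one_le)
      then have "x + t *\<^sub>R h \<in> U" using h r(2) by (auto simp: dist_norm)
      then have "((\<lambda>t. \<phi> (x + t *\<^sub>R h)) has_derivative (\<lambda>s. gradient \<phi> (x + t *\<^sub>R h) \<bullet> (s *\<^sub>R h))) (at t)"
        by (intro has_derivative_compose[OF _ smooth_gradient(2)[OF d1]]) (auto intro!: derivative_eq_intros)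
      then have "((\<lambda>t. \<phi> (x + t *\<^sub>R h)) has_real_derivative (gradient \<phi> (x + t *\<^sub>R h) \<bullet> h)) (at t)"
        by (rule has_derivative_imp_has_field_derivative) (simp add: mult.commute)
      then show "(g has_real_derivative g' t) (at t)"
        unfolding g_def g'_def by (auto intro!: derivative_eq_intros)
      have "g' t = (gradient \<phi> (x + t *\<^sub>R h) - gradient \<phi> x - A (t *\<^sub>R h)) \<bullet> h"
        by (simp add: g'_def inner_diff_left linear_scale[OF lin])
      also have "\<bar>\<dots>\<bar> \<le> norm (gradient \<phi> (x + t *\<^sub>R h) - gradient \<phi> x - A (t *\<^sub>R h)) * norm h"
        by (rule Cauchy_Schwarz_ineq2)
      also have "\<dots> \<le> (e * norm (t *\<^sub>R h)) * norm h"
        using d(2)[of "x + t *\<^sub>R h"] nt h by (intro mult_right_mono) auto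
      also have "\<dots> \<le> (e * norm h) * norm h"
        using nt e by (intro mult_right_mono mult_left_mono) auto
      finally show "\<bar>g' t\<bar> \<le> e * (norm h)\<^sup>2" by (simp add: power2_eq_square mult.assoc)
    qed
    obtain t where t: "0 < t" "t < 1" "g 1 - g 0 = (1 - 0) * g' t"
      using MVT2[of 0 1 g g'] g by auto
    then have "\<bar>g 1 - g 0\<bar> \<le> e * (norm h)\<^sup>2" using g'_le[of t] by simp
    moreover have "g 1 - g 0 = \<phi> (x + h) - \<phi> x - gradient \<phi> x \<bullet> h - hessian_bilinear \<phi> x h h / 2"
      by (simp add: g_def A_hess)
    ultimately show "\<bar>\<phi> (x + h) - \<phi> x - gradient \<phi> x \<bullet> h - hessian_bilinear \<phi> x h h / 2\<bar> \<le> e * (norm h)\<^sup>2"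
      by simp
  qed (use d(1) r(1) in simp)
qed

lemma bounded_bilinear_scaled_inner: "bounded_bilinear (\<lambda>h k :: 'a::euclidean_space. c * (h \<bullet> k))"
proof -
  have "bounded_bilinear (\<lambda>h k :: 'a. h \<bullet> (c *\<^sub>R k))"
    by (intro bounded_bilinear.comp[OF bounded_bilinear_inner] bounded_linear_ident bounded_linear_scaleR_right)
  then show ?thesis by simp
qed

lemma bounded_bilinear_add_scaled_inner:
  fixes B :: "'a::euclidean_space \<Rightarrow> 'a \<Rightarrow> real"
  assumes "bounded_bilinear B"
  shows "bounded_bilinear (\<lambda>h k. B h k + c * (h \<bullet> k))"
  using assms bounded_bilinear_scaled_inner[of c]
  unfolding bilinear_conv_bounded_bilinear[symmetric] bilinear_def
  by (auto intro: linear_compose_add)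

text \<open>Handles every contact with nonzero gradient; the boundary enters through the cone
  condition only.\<close>

lemma game_limit_quad_test:
  assumes comp: "compact (closure \<Omega>)" and lim: "game_limit \<Omega> f v"
    and v: "continuous_on (closure \<Omega>) v" and f: "continuous_on (closure \<Omega>) f"
    and x0: "x0 \<in> closure \<Omega>" and r: "0 < r"
    and B: "bounded_bilinear B" and p: "p \<noteq> 0" and cone: "backward_cone (closure \<Omega>) x0 (p /\<^sub>R norm p)"
    and max: "\<And>y. y \<in> closure \<Omega> \<Longrightarrow> dist x0 y < r \<Longrightarrow> y \<noteq> x0 \<Longrightarrow> v y - quad p B x0 y < v x0 - quad p B x0 x0"
    and m: "B (p /\<^sub>R norm p) (p /\<^sub>R norm p) < m"
  shows "- m \<le> f x0"
proof (rule tug_quad_cone[OF B comp p cone m])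
  fix \<rho> :: real
  assume \<rho>: "0 < \<rho>" "\<And>x \<epsilon>. x \<in> closure \<Omega> \<Longrightarrow> dist x0 x < \<rho> \<Longrightarrow> 0 < \<epsilon> \<Longrightarrow> \<epsilon> < \<rho> \<Longrightarrow>
    tug \<Omega> \<epsilon> (quad p B x0) x - quad p B x0 x \<le> \<epsilon>\<^sup>2 / 2 * m"
  show ?thesis
  proof (rule game_limit_test[OF comp lim v f continuous_on_quad[OF B, of _ p x0] x0 r _ \<rho>(1)])
    fix y assume "y \<in> closure \<Omega>" "dist x0 y < r" "y \<noteq> x0"
    then show "v y - quad p B x0 y < v x0 - quad p B x0 x0" by (rule max)
  qed (rule \<rho>(2))
qed

text \<open>Excludes strictly concave test functions at a critical point, where the step towards the
  maximum is shorter than \<open>\<epsilon>\<close>: recentring the paraboloid at a nearby point \<open>q\<close> moves the point of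
  contact off the vertex, so that the gradient there does not vanish.\<close>
lemma no_concave_touching:
  fixes \<Omega> :: "'a::euclidean_space set"
  assumes comp: "compact (closure \<Omega>)" and op: "open \<Omega>" and lim: "game_limit \<Omega> f v"
    and v: "continuous_on (closure \<Omega>) v" and f: "continuous_on (closure \<Omega>) f"
    and x0: "x0 \<in> \<Omega>" and r: "0 < r" and b: "0 < b" "f x0 < b"
    and max: "\<And>y. y \<in> closure \<Omega> \<Longrightarrow> dist x0 y < r \<Longrightarrow> y \<noteq> x0 \<Longrightarrow> v y + b / 2 * (dist x0 y)\<^sup>2 < v x0"
  shows False
proof -
  let ?X = "closure \<Omega>"
  have x0X: "x0 \<in> ?X" using x0 closure_subset by blast
  define \<kappa> where "\<kappa> = (b - f x0) / 2"
  have \<kappa>: "0 < \<kappa>" "f x0 = b - 2 * \<kappa>" using b(2) by (simp_all add: \<kappa>_def field_simps)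
  obtain r1 where r1: "0 < r1" "ball x0 r1 \<subseteq> \<Omega>" using op x0 openE by blast
  obtain r2 where r2: "0 < r2" "\<And>x. x \<in> ?X \<Longrightarrow> dist x x0 < r2 \<Longrightarrow> dist (f x) (f x0) < \<kappa>"
    using f x0X \<kappa>(1) unfolding continuous_on_iff by blast
  define R where "R = Min {r, r1, r2} / 2"
  have R: "0 < R" "R < r" "R < r1" "R < r2" using r r1(1) r2(1) by (auto simp: R_def)
  have cb: "cball x0 R \<subseteq> \<Omega>" using r1(2) R(3) by auto
  then have cbX: "cball x0 R \<subseteq> ?X" using closure_subset by blast
  have f_lt: "f y < b - \<kappa>" if "y \<in> cball x0 R" for y
  proof -
    have "dist (f y) (f x0) < \<kappa>" using that cbX R(4) by (intro r2(2)) (auto simp: dist_commute)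
    then show ?thesis using \<kappa>(2) by (simp add: dist_real_def abs_less_iff)
  qed
  define E where "E = cball x0 R - ball x0 (R / 2)"
  have "compact E" unfolding E_def by (intro compact_diff) auto
  have vE: "continuous_on E (\<lambda>y. v y + b / 2 * (dist x0 y)\<^sup>2)"
    by (intro continuous_intros continuous_on_subset[OF v]) (use cbX in \<open>auto simp: E_def\<close>)
  have "\<exists>\<mu>>0. \<forall>y\<in>E. v y + b / 2 * (dist x0 y)\<^sup>2 \<le> v x0 - \<mu>"
  proof (cases "E = {}")
    case False
    obtain y where y: "y \<in> E" "\<And>y'. y' \<in> E \<Longrightarrow> v y' + b / 2 * (dist x0 y')\<^sup>2 \<le> v y + b / 2 * (dist x0 y)\<^sup>2"
      using continuous_attains_sup[OF \<open>compact E\<close> False vE] by blast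
    have "v y + b / 2 * (dist x0 y)\<^sup>2 < v x0"
      using y(1) R(1,2) cbX by (intro max) (auto simp: E_def)
    then show ?thesis
      using y(2) by (intro exI[of _ "v x0 - (v y + b / 2 * (dist x0 y)\<^sup>2)"] conjI ballI) auto
  qed (auto intro: exI[of _ 1])
  then obtain \<mu> where \<mu>: "0 < \<mu>" "\<And>y. y \<in> E \<Longrightarrow> v y + b / 2 * (dist x0 y)\<^sup>2 \<le> v x0 - \<mu>" by blast
  \<comment> \<open>The new contact point could lie in E only if \<mu> \<le> b R \<eta>, which this
    choice excludes.\<close>
  define \<eta> where "\<eta> = min (R / 2) (\<mu> / (3 * b * R))"
  have \<eta>: "0 < \<eta>" "\<eta> < R" "\<eta> \<le> \<mu> / (3 * b * R)" using R(1) \<mu>(1) b(1) by (auto simp: \<eta>_def)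
  have \<eta>\<mu>: "3 * b * R * \<eta> \<le> \<mu>" using \<eta>(3) b(1) R(1) by (simp add: field_simps)
  obtain e :: 'a where e: "e \<in> Basis" using nonempty_Basis by blast
  define q where "q = x0 + \<eta> *\<^sub>R e"
  have q: "dist x0 q = \<eta>" "q \<noteq> x0" using \<eta>(1) e by (auto simp: q_def dist_norm)
  have cont: "continuous_on (cball x0 R) (\<lambda>y. v y + b / 2 * (dist q y)\<^sup>2)"
    by (intro continuous_intros continuous_on_subset[OF v cbX])
  obtain y0 where y0: "y0 \<in> cball x0 R"
    "\<And>y. y \<in> cball x0 R \<Longrightarrow> v y + b / 2 * (dist q y)\<^sup>2 \<le> v y0 + b / 2 * (dist q y0)\<^sup>2"
    using continuous_attains_sup[OF compact_cball _ cont] R(1) by (metis cball_eq_empty less_imp_le not_le)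
  have "v x0 + b / 2 * (dist q x0)\<^sup>2 \<le> v y0 + b / 2 * (dist q y0)\<^sup>2" using R(1) by (intro y0(2)) simp
  then have touch: "v x0 + b / 2 * \<eta>\<^sup>2 \<le> v y0 + b / 2 * (dist q y0)\<^sup>2" using q(1) by (simp add: dist_commute)
  \<comment> \<open>At its vertex q the shifted paraboloid adds nothing, at x0 it adds b \<eta>^2 /
    2, and v q < v x0; so q is not a maximum.\<close>
  have "y0 \<noteq> q"
  proof
    assume "y0 = q"
    moreover have "v q + b / 2 * (dist x0 q)\<^sup>2 < v x0"
      using q \<eta>(2) R(2) cbX by (intro max) auto
    moreover have "0 < b / 2 * \<eta>\<^sup>2" using b(1) \<eta>(1) by simp
    ultimately show False using touch q(1) by simp
  qed
  have "y0 \<notin> E"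
  proof
    assume "y0 \<in> E"
    have "dist q y0 \<le> \<eta> + dist x0 y0" using dist_triangle[of q y0 x0] q(1) by (simp add: dist_commute)
    then have "(dist q y0)\<^sup>2 \<le> (\<eta> + dist x0 y0)\<^sup>2" by (intro power_mono) auto
    also have "\<dots> = \<eta>\<^sup>2 + \<eta> * (2 * dist x0 y0) + (dist x0 y0)\<^sup>2" by (simp add: power2_eq_square algebra_simps)
    also have "\<eta> * (2 * dist x0 y0) \<le> \<eta> * (2 * R)" using y0(1) \<eta>(1) by simp
    finally have "b / 2 * (dist q y0)\<^sup>2 \<le> b / 2 * (\<eta>\<^sup>2 + \<eta> * (2 * R) + (dist x0 y0)\<^sup>2)"
      using b(1) by simp
    then have "v y0 + b / 2 * (dist q y0)\<^sup>2 \<le> (v y0 + b / 2 * (dist x0 y0)\<^sup>2) + b / 2 * \<eta>\<^sup>2 + b * R * \<eta>"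
      by (simp add: algebra_simps)
    also have "\<dots> \<le> (v x0 - \<mu>) + b / 2 * \<eta>\<^sup>2 + b * R * \<eta>" using \<mu>(2)[OF \<open>y0 \<in> E\<close>] by simp
    finally have "\<mu> \<le> b * R * \<eta>" using touch by linarith
    moreover have "0 < b * R * \<eta>" using b(1) R(1) \<eta>(1) by simp
    ultimately show False using \<eta>\<mu> by linarith
  qed
  then have y0_near: "dist x0 y0 < R / 2" using y0(1) by (simp add: E_def)
  \<comment> \<open>The gradient at y0 of -b / 2 |y - q|^2. The term \<kappa> / 2 in
    \<open>B\<close> makes the contact strict and stays below the margin \<kappa> by which b exceeds
    f near x0.\<close>
  define p where "p = - b *\<^sub>R (y0 - q)"
  have p: "p \<noteq> 0" using b(1) \<open>y0 \<noteq> q\<close> by (simp add: p_def)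
  define B where "B h k = (- b + \<kappa> / 2) * (h \<bullet> k)" for h k :: 'a
  have B: "bounded_bilinear B" unfolding B_def[abs_def] by (rule bounded_bilinear_scaled_inner)
  have y0\<Omega>: "y0 \<in> \<Omega>" using y0(1) cb by blast
  have "- (- b + \<kappa>) \<le> f y0"
  proof (rule game_limit_quad_test[OF comp lim v f _ _ B p backward_cone_interior[OF op y0\<Omega>]])
    show "y0 \<in> ?X" using y0\<Omega> closure_subset by blast
    show "0 < R / 2" using R(1) by simp
    have "norm (p /\<^sub>R norm p) = 1" using p by simp
    then have "(p /\<^sub>R norm p) \<bullet> (p /\<^sub>R norm p) = 1" by (simp only: norm_eq_1)
    then show "B (p /\<^sub>R norm p) (p /\<^sub>R norm p) < - b + \<kappa>" using \<kappa>(1) by (simp only: B_def) simp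
    fix y assume y: "y \<in> ?X" "dist y0 y < R / 2" "y \<noteq> y0"
    have "dist x0 y \<le> R" using dist_triangle[of x0 y y0] y0_near y(2) by linarith
    then have le: "v y + b / 2 * (dist q y)\<^sup>2 \<le> v y0 + b / 2 * (dist q y0)\<^sup>2" by (intro y0(2)) simp
    have "y - q = (y - y0) + (y0 - q)" by simp
    then have "(dist q y)\<^sup>2 = (norm ((y - y0) + (y0 - q)))\<^sup>2" by (simp add: dist_norm norm_minus_commute)
    also have "\<dots> = (y - y0) \<bullet> (y - y0) + 2 * ((y0 - q) \<bullet> (y - y0)) + (dist q y0)\<^sup>2"
      by (simp only: power2_norm_eq_inner inner_add_left inner_add_right dist_norm norm_minus_commute[of q y0])
        (simp add: inner_commute)
    finally have "v y + b / 2 * ((y - y0) \<bullet> (y - y0)) + b * ((y0 - q) \<bullet> (y - y0)) \<le> v y0"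
      using le by (simp add: distrib_left)
    moreover have "- b * c + (- b + \<kappa> / 2) * s / 2 = - (b * c) - b / 2 * s + \<kappa> / 4 * s" for c s
      by (simp add: field_simps)
    then have "quad p B y0 y = - (b * ((y0 - q) \<bullet> (y - y0))) - b / 2 * ((y - y0) \<bullet> (y - y0))
        + \<kappa> / 4 * ((y - y0) \<bullet> (y - y0))"
      unfolding quad_def p_def B_def inner_scaleR_left .
    moreover have "0 < \<kappa> / 4 * ((y - y0) \<bullet> (y - y0))" using \<kappa>(1) y(3) by simp
    moreover have "quad p B y0 y0 = 0" unfolding quad_def B_def by simp
    ultimately show "v y - quad p B y0 y < v y0 - quad p B y0 y0" by linarith
  qed
  then show False using f_lt[OF y0(1)] by simp
qed

text \<open>By contradiction. If the gradient is nonzero, failure of the Neumann alternative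
  supplies the cone at boundary points. If it vanishes, that alternative would hold on the boundary,
  so x0 is interior; the sign of m + \<kappa> then decides between the direct estimate and
  \<open>no_concave_touching\<close>.\<close>

lemma game_limit_subsolution:
  fixes \<Omega> :: "'a::euclidean_space set"
  assumes dom: "domain \<Omega>" and C1: "C1_boundary \<Omega>" and lim: "game_limit \<Omega> f v"
    and v: "continuous_on (closure \<Omega>) v" and f: "continuous_on (closure \<Omega>) f"
  shows "viscosity_subsolution \<Omega> f v"
  unfolding viscosity_subsolution_def
proof (intro conjI allI impI)
  show "continuous_on (closure \<Omega>) v" by (rule v)
  let ?X = "closure \<Omega>"
  have op: "open \<Omega>" and comp: "compact ?X" using dom by (auto simp: domain_def compact_closure)
  fix \<phi> x0
  assume smooth: "smooth_on_closure \<Omega> \<phi>" and x0: "x0 \<in> ?X"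
    and max: "strict_local_max_on ?X (\<lambda>x. v x - \<phi> x) x0"
  obtain U where U: "open U" "?X \<subseteq> U"
    "\<And>is x. set is \<subseteq> Basis \<Longrightarrow> x \<in> U \<Longrightarrow> iter_partial_deriv is \<phi> differentiable (at x)"
    using smooth unfolding smooth_on_closure_def by blast
  have x0U: "x0 \<in> U" using U(2) x0 by blast
  have d1: "\<phi> differentiable (at y)" if "y \<in> U" for y using U(3)[of "[]" y] that by simp
  have d2: "partial_deriv i \<phi> differentiable (at x0)" if "i \<in> Basis" for i
    using U(3)[of "[i]" x0] that x0U by simp
  define p where "p = gradient \<phi> x0"
  define H where "H = hessian_bilinear \<phi> x0"
  define m where "m = inf_laplacian_plus \<phi> x0"
  have H: "bounded_bilinear H" unfolding H_def by (rule bounded_bilinear_hessian)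
  show "- inf_laplacian_plus \<phi> x0 \<le> f x0 \<or>
      x0 \<in> frontier \<Omega> \<and> frechet_derivative \<phi> (at x0) (outward_normal \<Omega> x0) \<le> 0"
  proof (rule ccontr)
    assume neg: "\<not> ?thesis"
    define \<kappa> where "\<kappa> = (- m - f x0) / 4"
    have \<kappa>: "0 < \<kappa>" "f x0 = - m - 4 * \<kappa>" using neg by (auto simp: \<kappa>_def m_def field_simps)
    \<comment> \<open>The extra \<kappa> makes the quadratic dominate the Taylor remainder of
      \<phi>, so v still touches it strictly. The resulting loss, at most 2 \<kappa>, is below the
      gap 4 \<kappa>.\<close>
    define B where "B h k = H h k + \<kappa> * (h \<bullet> k)" for h k
    have B: "bounded_bilinear B" unfolding B_def[abs_def] by (rule bounded_bilinear_add_scaled_inner[OF H])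
    obtain r1 where r1: "0 < r1" "\<And>y. y \<in> ?X \<Longrightarrow> dist x0 y < r1 \<Longrightarrow> y \<noteq> x0 \<Longrightarrow> v y - \<phi> y < v x0 - \<phi> x0"
      using max unfolding strict_local_max_on_def by auto
    have "\<exists>\<delta>>0. \<forall>h. norm h < \<delta> \<longrightarrow> \<bar>\<phi> (x0 + h) - \<phi> x0 - p \<bullet> h - H h h / 2\<bar> \<le> \<kappa> / 2 * (norm h)\<^sup>2"
      unfolding p_def H_def
      by (rule second_order_expansion[OF U(1) x0U]) (use d1 d2 \<kappa>(1) in simp_all)
    then obtain r2 where r2: "0 < r2" "\<And>h. norm h < r2 \<Longrightarrow>
        \<bar>\<phi> (x0 + h) - \<phi> x0 - p \<bullet> h - H h h / 2\<bar> \<le> \<kappa> / 2 * (norm h)\<^sup>2"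
      by blast
    define r where "r = min r1 r2"
    have r: "0 < r" using r1(1) r2(1) by (simp add: r_def)
    have touch: "v y - quad p B x0 y < v x0 - quad p B x0 x0"
      if y: "y \<in> ?X" "dist x0 y < r" "y \<noteq> x0" for y
    proof -
      have eq: "x0 + (y - x0) = y" by simp
      have "norm (y - x0) < r2" using y(2) by (simp add: r_def dist_norm norm_minus_commute)
      from r2(2)[OF this, unfolded eq] have "\<phi> y - \<phi> x0 - p \<bullet> (y - x0) - H (y - x0) (y - x0) / 2 \<le> \<kappa> / 2 * (norm (y - x0))\<^sup>2"
        by (rule abs_le_D1)
      moreover have "quad p B x0 y = p \<bullet> (y - x0) + H (y - x0) (y - x0) / 2 + \<kappa> / 2 * (norm (y - x0))\<^sup>2"
        by (simp add: quad_def B_def power2_norm_eq_inner add_divide_distrib)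
      moreover have "quad p B x0 x0 = 0"
        using bounded_bilinear.zero_left[OF B] by (simp add: quad_def)
      moreover have "v y - \<phi> y < v x0 - \<phi> x0" using y by (intro r1(2)) (auto simp: r_def)
      ultimately show ?thesis by linarith
    qed
    show False
    proof (cases "p = 0")
      case False
      define d where "d = p /\<^sub>R norm p"
      have "norm d = 1" using False by (simp add: d_def)
      then have d: "d \<bullet> d = 1" by (simp only: norm_eq_1)
      have pd: "p = norm p *\<^sub>R d" using False by (simp add: d_def)
      have "hessian_form \<phi> x0 p = (norm p)\<^sup>2 * H d d"
        unfolding hessian_form_eq H_def[symmetric]
        by (subst (1 2) pd) (simp add: bounded_bilinear.scaleR_left[OF H] bounded_bilinear.scaleR_right[OF H] power2_eq_square)
      then have mH: "m = H d d" using False unfolding m_def inf_laplacian_plus_def p_def[symmetric] by simp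
      have cone: "backward_cone ?X x0 d"
      proof (cases "x0 \<in> \<Omega>")
        case True
        then show ?thesis by (rule backward_cone_interior[OF op])
      next
        case nin: False
        then have fr: "x0 \<in> frontier \<Omega>" using x0 op by (simp add: frontier_def interior_open)
        then obtain r e F G where "boundary_chart \<Omega> x0 r e F G"
          using boundary_chart_exists[OF op C1] by metis
        then interpret boundary_chart \<Omega> x0 r e F G .
        have G0: "G x0 \<noteq> 0" using G_e[of x0] by auto
        \<comment> \<open>This is the negated Neumann alternative.\<close>
        have "0 < p \<bullet> outward_normal \<Omega> x0"
          using neg fr smooth_gradient(1)[OF d1[OF x0U]] by (simp add: p_def)
        then have "0 < (p \<bullet> G x0) / norm (G x0)" unfolding outward_normal_chart[OF fr] by (simp add: divide_inverse mult.commute)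
        then have "0 < p \<bullet> G x0" using G0 by (simp add: zero_less_divide_iff)
        then have "0 < G x0 \<bullet> d" using False by (simp add: d_def inner_commute)
        then show ?thesis by (rule backward_cone_chart)
      qed
      have "- (m + 2 * \<kappa>) \<le> f x0"
      proof (rule game_limit_quad_test[OF comp lim v f x0 r B False _ touch])
        show "backward_cone ?X x0 (p /\<^sub>R norm p)" using cone by (simp add: d_def)
        show "B (p /\<^sub>R norm p) (p /\<^sub>R norm p) < m + 2 * \<kappa>"
          unfolding d_def[symmetric] using d mH \<kappa>(1) by (simp add: B_def)
      qed
      then show False using \<kappa> by simp
    next
      case True
      have "x0 \<notin> frontier \<Omega>"
        using neg smooth_gradient(1)[OF d1[OF x0U]] True by (auto simp: p_def)
      then have x0\<Omega>: "x0 \<in> \<Omega>" using x0 op by (simp add: frontier_def interior_open)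
      have "continuous_on (sphere 0 1) (\<lambda>w. H w w)"
        by (intro bounded_bilinear.continuous_on[OF H] continuous_intros)
      then have "bounded ((\<lambda>w. H w w) ` sphere 0 1)"
        by (intro compact_imp_bounded compact_continuous_image) auto
      then have bdd: "bdd_above ((\<lambda>w. H w w) ` sphere 0 1)" by (rule bounded_imp_bdd_above)
      have m_sup: "m = (SUP w\<in>sphere 0 1. H w w)"
        using True unfolding m_def inf_laplacian_plus_def p_def by (simp add: hessian_form_eq H_def)
      have Hm: "H w w \<le> m * (norm w)\<^sup>2" for w
      proof (cases "w = 0")
        case True
        then show ?thesis by (simp add: bounded_bilinear.zero_left[OF H])
      next
        case False
        define u where "u = w /\<^sub>R norm w"
        have "u \<in> sphere 0 1" using False by (simp add: u_def)
        then have "H u u \<le> m" unfolding m_sup using bdd by (rule cSUP_upper)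
        moreover have wu: "w = norm w *\<^sub>R u" using False by (simp add: u_def)
        have "H w w = (norm w)\<^sup>2 * H u u"
          by (subst (1 2) wu) (simp add: bounded_bilinear.scaleR_left[OF H] bounded_bilinear.scaleR_right[OF H] power2_eq_square)
        ultimately show ?thesis
          using mult_left_mono[of "H u u" m "(norm w)\<^sup>2"] by (simp add: mult.commute)
      qed
      have Bm: "B w w \<le> (m + \<kappa>) * (norm w)\<^sup>2" for w
        using Hm[of w] by (simp add: B_def power2_norm_eq_inner distrib_right)
      show False
      proof (cases "0 \<le> m + \<kappa>")
        case m0: True
        have Bw: "B w w \<le> m + \<kappa>" if "norm w \<le> 1" for w
        proof -
          have "(norm w)\<^sup>2 \<le> 1" using that by (simp add: power_le_one)
          then have "(m + \<kappa>) * (norm w)\<^sup>2 \<le> m + \<kappa>" using m0 by (simp add: mult_left_le)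
          then show ?thesis using Bm[of w] by linarith
        qed
        have "- (m + \<kappa>) \<le> f x0"
        proof (rule tug_quad_interior[OF B comp op x0\<Omega> Bw])
          fix \<rho> :: real
          assume \<rho>: "0 < \<rho>" "\<And>x \<epsilon>. x \<in> ?X \<Longrightarrow> dist x0 x < \<rho> \<Longrightarrow> 0 < \<epsilon> \<Longrightarrow> \<epsilon> < \<rho> \<Longrightarrow>
            tug \<Omega> \<epsilon> (quad p B x0) x - quad p B x0 x \<le> \<epsilon>\<^sup>2 / 2 * (m + \<kappa>)"
          show ?thesis
          proof (rule game_limit_test[OF comp lim v f continuous_on_quad[OF B, of _ p x0] x0 r _ \<rho>(1)])
            fix y assume "y \<in> ?X" "dist x0 y < r" "y \<noteq> x0"
            then show "v y - quad p B x0 y < v x0 - quad p B x0 x0" by (rule touch)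
          qed (rule \<rho>(2))
        qed
        then show False using \<kappa> by simp
      next
        case m0: False
        show False
        proof (rule no_concave_touching[OF comp op lim v f x0\<Omega> r])
          show "0 < - (m + \<kappa>)" using m0 by simp
          show "f x0 < - (m + \<kappa>)" using \<kappa> by simp
          fix y assume y: "y \<in> ?X" "dist x0 y < r" "y \<noteq> x0"
          have "quad p B x0 x0 = 0"
            using bounded_bilinear.zero_left[OF B] by (simp add: quad_def)
          then have "v y - B (y - x0) (y - x0) / 2 < v x0" using touch[OF y] True by (simp add: quad_def)
          moreover have "B (y - x0) (y - x0) \<le> (m + \<kappa>) * (dist x0 y)\<^sup>2"
            using Bm[of "y - x0"] by (simp add: dist_norm norm_minus_commute)
          moreover have "- (m + \<kappa>) / 2 * (dist x0 y)\<^sup>2 = - ((m + \<kappa>) * (dist x0 y)\<^sup>2 / 2)"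
            by (simp add: algebra_simps)
          ultimately show "v y + - (m + \<kappa>) / 2 * (dist x0 y)\<^sup>2 < v x0" by linarith
        qed
      qed
    qed
  qed
qed

theorem theorem1p11:
  fixes \<Omega> :: "'a::euclidean_space set"
  assumes "domain \<Omega>"
    and "intrinsic_diameter \<Omega> < \<infinity>"
    and "C1_boundary \<Omega>"
  shows "\<exists>L :: real \<Rightarrow> real. \<forall>f :: 'a \<Rightarrow> real.
    continuous_on (closure \<Omega>) f \<longrightarrow> (c_const \<Omega> f \<longlongrightarrow> 0) (at_right 0) \<longrightarrow>
    (\<exists>u. viscosity_solution \<Omega> f u \<and> (L (sup_norm \<Omega> f))-lipschitz_on (closure \<Omega>) u)"
proof (cases "closure \<Omega> = {}")
  \<comment> \<open>\<open>domain\<close> admits the empty set, where every function is a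
    solution.\<close>
  case True
  have "viscosity_solution \<Omega> f (\<lambda>x. 0)" for f
    unfolding viscosity_solution_def viscosity_supersolution_def viscosity_subsolution_def True by simp
  moreover have "0-lipschitz_on (closure \<Omega>) (\<lambda>x. 0 :: real)" by (simp add: lipschitz_on_def)
  ultimately show ?thesis by (intro exI[of _ "\<lambda>_. 0"]) blast
next
  case False
  then obtain x0 where x0: "x0 \<in> closure \<Omega>" by (auto simp only: ex_in_conv[symmetric])
  have comp: "compact (closure \<Omega>)" using assms(1) by (simp add: domain_def compact_closure)
  obtain K where K: "0 < K"
    "\<And>x y. x \<in> closure \<Omega> \<Longrightarrow> y \<in> closure \<Omega> \<Longrightarrow> chain_bound (closure \<Omega>) K (K * dist x y) x y"
    by (rule chain_bound_closure[OF assms(1,3)]) (rule that)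
  define D where "D = diameter (closure \<Omega>)"
  have D: "dist x y \<le> D" if "x \<in> closure \<Omega>" "y \<in> closure \<Omega>" for x y
    unfolding D_def using compact_imp_bounded[OF comp] that by (rule diameter_bounded_bound)
  \<comment> \<open>Linear in the norm of f; K and D are fixed before f and come from \<Omega>
    alone.\<close>
  define L where "L s = 6 * K * (K * D + K + 1) * s" for s
  have "\<exists>u. viscosity_solution \<Omega> f u \<and> (L (sup_norm \<Omega> f))-lipschitz_on (closure \<Omega>) u"
    if f: "continuous_on (closure \<Omega>) f" and c: "(c_const \<Omega> f \<longlongrightarrow> 0) (at_right 0)" for f :: "'a \<Rightarrow> real"
  proof -
    have "continuous_on (closure \<Omega>) (\<lambda>x. \<bar>f x\<bar>)" using f by (intro continuous_intros)
    then have "bounded ((\<lambda>x. \<bar>f x\<bar>) ` closure \<Omega>)"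
      using comp by (intro compact_imp_bounded compact_continuous_image)
    then have bdd: "bdd_above ((\<lambda>x. \<bar>f x\<bar>) ` closure \<Omega>)" by (rule bounded_imp_bdd_above)
    have F: "\<bar>f x\<bar> \<le> sup_norm \<Omega> f" if "x \<in> closure \<Omega>" for x
      unfolding sup_norm_def using that bdd by (rule cSUP_upper)
    show ?thesis
    proof (rule game_limit_exists[OF comp x0 K D F c])
      fix v assume lim: "game_limit \<Omega> f v"
        and lip: "(6 * K * (K * D + K + 1) * sup_norm \<Omega> f)-lipschitz_on (closure \<Omega>) v"
      have v: "continuous_on (closure \<Omega>) v" using lip by (rule lipschitz_on_continuous_on)
      have "viscosity_subsolution \<Omega> f v"
        by (rule game_limit_subsolution[OF assms(1,3) lim v f])
      moreover have "viscosity_supersolution \<Omega> f v"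
        unfolding viscosity_supersolution_def
        by (rule game_limit_subsolution[OF assms(1,3) game_limit_uminus[OF lim]])
          (intro continuous_intros v f)+
      ultimately show ?thesis using lip unfolding viscosity_solution_def L_def by blast
    qed
  qed
  then show ?thesis by blast
qed

end
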